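(* Let $N\ge1$ be an integer, $1<p<2$, $p'=\frac{p}{p-1}$, $q>1$, $\delta=\frac{p}{2-p}$, $p_1=\frac{2N}{N+1}$, $p_2=\frac{2N}{N+2}$, and $q^\ast=\frac{N(p-1)+p}{N-p}$ if $p<N$, $q^\ast=\infty$ if $N\le p$. Assume $\delta\le\alpha$. For $a\in\mathbb{R}$ let $w(\cdot,a)$ be the solution of $$(|w'|^{p-2}w')'+\frac{N-1}{r}|w'|^{p-2}w'+rw'+\alpha w+|w|^{q-1}w=0\ \text{ in }(0,\infty),\qquad w(0)=a,\quad w'(0)=0.$$ (i) If $p\le p_2$, then for any $a>0$, $w(r,a)>0$ on $[0,\infty)$ and $$\lim_{r\to\infty}r^\delta w(r,a)=\ell:=\Big(\delta^{p-1}\frac{\delta-N}{\delta-\alpha}\Big)^{1/(2-p)}\ \text{ if }\delta<\alpha,$$ $$\lim_{r\to\infty}r^\delta(\ln r)^{-1/(2-p)}w(r,a)=\big((2-p)\delta^{p-1}(N-\delta)\big)^{1/(2-p)}\ \text{ if }\alpha=\delta.$$ (ii) If $p_2<p<p_1$, $\alpha<(N-1)p'/2$, and $q\ge q^\ast_\alpha$, where $q^\ast_\alpha>q^\ast$ is given by $$\frac1{q^\ast_\alpha+1}=\frac{N-1}{2\alpha}-\frac1{p'},$$ then again, for any $a>0$, $w(r,a)>0$ on $[0,\infty)$ and the same limits as in (i) hold (according to whether $\delta<\alpha$ or $\alpha=\delta$).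
   Context: For every $a\in\mathbb{R}$ the initial value problem has a unique solution $w(\cdot,a)\in C^1([0,\infty))$ with $|w'|^{p-2}w'\in C^1([0,\infty))$. *)

theory Defs
  imports Complex_Main "HOL-Library.Extended_Real"
begin

definition delta :: "real \<Rightarrow> real" where
  "delta p = p / (2 - p)"

definition conj_exp :: "real \<Rightarrow> real" where
  "conj_exp p = p / (p - 1)"

definition p_one :: "nat \<Rightarrow> real" where
  "p_one N = 2 * real N / (real N + 1)"

definition p_two :: "nat \<Rightarrow> real" where
  "p_two N = 2 * real N / (real N + 2)"

definition q_star :: "nat \<Rightarrow> real \<Rightarrow> ereal" where
  "q_star N p =
     (if p < real N then ereal ((real N * (p - 1) + p) / (real N - p)) else \<infinity>)"

text \<open>The solution \<open>x\<close> of \<open>1 / (x + 1) = (N - 1) / (2 * \<alpha>) - 1 / p'\<close>,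
  which is the defining equation; see the lemma below.\<close>

definition q_star_alpha :: "nat \<Rightarrow> real \<Rightarrow> real \<Rightarrow> real" where
  "q_star_alpha N p \<alpha> = 1 / ((real N - 1) / (2 * \<alpha>) - 1 / conj_exp p) - 1"

lemma q_star_alpha_iff:
  "1 / (x + 1) = (real N - 1) / (2 * \<alpha>) - 1 / conj_exp p \<longleftrightarrow> x = q_star_alpha N p \<alpha>"
proof -
  have solve: "1 / (x + 1) = c \<longleftrightarrow> x = 1 / c - 1" for c :: real
    by (metis add_diff_cancel diff_add_cancel inverse_eq_divide inverse_inverse_eq)
  show ?thesis
    unfolding q_star_alpha_def by (rule solve)
qed

text \<open>The map \<open>t \<mapsto> |t|^(p-2) t\<close>. At \<open>t = 0\<close> it takes the value \<open>0\<close>, which is the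
  continuous extension for \<open>p > 1\<close>.\<close>

definition signed_pow :: "real \<Rightarrow> real \<Rightarrow> real" where
  "signed_pow p t = \<bar>t\<bar> powr (p - 2) * t"

text \<open>\<open>f\<close> is of class \<open>C^1\<close> on \<open>[0,\<infinity>)\<close> with derivative \<open>f'\<close>, one-sided at \<open>0\<close>. Values at
  negative arguments are irrelevant.\<close>

definition C1_halfline :: "(real \<Rightarrow> real) \<Rightarrow> (real \<Rightarrow> real) \<Rightarrow> bool" where
  "C1_halfline f f' \<longleftrightarrow>
     (\<forall>r\<ge>0. (f has_real_derivative f' r) (at r within {0..})) \<and> continuous_on {0..} f'"

text \<open>In the definition below \<open>w'\<close> is the derivative of \<open>w\<close> and \<open>F'\<close> that of
  \<open>|w'|^(p-2) w'\<close>.\<close>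

definition ivp_solution ::
  "nat \<Rightarrow> real \<Rightarrow> real \<Rightarrow> real \<Rightarrow> real \<Rightarrow> (real \<Rightarrow> real) \<Rightarrow> bool" where
  "ivp_solution N p q \<alpha> a w \<longleftrightarrow>
     (\<exists>w' F'. C1_halfline w w' \<and>
        C1_halfline (\<lambda>r. signed_pow p (w' r)) F' \<and>
        (\<forall>r>0. F' r + (real N - 1) / r * signed_pow p (w' r) + r * w' r + \<alpha> * w r
                 + \<bar>w r\<bar> powr (q - 1) * w r = 0) \<and>
        w 0 = a \<and> w' 0 = 0)"

definition ell :: "nat \<Rightarrow> real \<Rightarrow> real \<Rightarrow> real" where
  "ell N p \<alpha> =
     (delta p powr (p - 1) * ((delta p - real N) / (delta p - \<alpha>))) powr (1 / (2 - p))"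

end

theory Submission
  imports Defs "HOL-Analysis.Interval_Integral"
begin

text \<open>
  A solution with \<open>w(0) > 0\<close> decreases as long as it is positive, and an energy of Pohozaev type
  starting at \<open>0\<close> decreases along it. The energy is nonnegative at a zero of \<open>w\<close>, so there is none; the
  energy staying below a negative constant also bounds the decay of \<open>w\<close> from below.

  In the variables \<open>y = r^\<delta> w\<close>, \<open>Y = r^(\<delta> - 1) |w'|^(p - 1)\<close>, \<open>t = ln r\<close> the equation is asymptotically
  autonomous. With \<open>\<eta> = (N - p) / (p - 1)\<close>, if \<open>\<alpha> < \<eta>\<close> then, in terms of \<open>r |w'| / (\<alpha> w + w^q)\<close> and
  \<open>(r^\<delta> (\<alpha> w + w^q))^(2 - p)\<close>, it is a predator-prey system with increasing prey isocline, which has a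
  Lyapunov function; for \<open>\<alpha> = \<delta>\<close> its equilibrium escapes to infinity, at a rate
  which gives the logarithmic correction. If \<open>2 \<delta> \<le> N\<close> and \<open>\<delta> < \<alpha>\<close>, then \<open>Y\<close> satisfies a Lienard equation
  with positive friction, whose energy is decreasing. In both cases the decay bound keeps the orbit
  away from the equilibrium at the origin.
\<close>

section \<open>Differential inequalities\<close>

text \<open>Let \<open>n = N - \<delta>\<close> and \<open>\<nu> = 1 / (p - 1)\<close>. Linearised
  at the origin, the limit system in \<open>(y, Y)\<close> is a saddle with rates
  \<open>\<delta>\<close> and \<open>- n\<close>; on its stable curve \<open>y\<close> is of order
  \<open>Y^\<nu>\<close>, so \<open>y Y + y^2\<close> decays like
  \<open>exp (- (1 + \<nu>) n t)\<close>. An energy with weight \<open>r^\<mu>\<close> gives the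
  lower bound \<open>c exp (- (\<mu> - 2 \<delta>) t)\<close>. For \<open>\<mu> = 2 \<alpha>\<close>
  the inequality \<open>\<mu> - 2 \<delta> < (1 + \<nu>) n\<close> is exactly
  \<open>\<alpha> < (N - 1) p' / 2\<close>. There are two convergence arguments because
  \<open>\<alpha>\<close> has no upper bound when \<open>p \<le> p_two N\<close>, while the isocline
  ceases to be increasing for \<open>\<alpha> > \<eta>\<close>. The friction of the Lienard equation
  contains \<open>n - \<delta> = N - 2 \<delta>\<close>, which is nonnegative precisely when
  \<open>p \<le> p_two N\<close>. The perturbation \<open>w^(q - 1)\<close> tends to zero at no rate
  known beforehand. It is absorbed through its monotone decrease, so no estimate of its size is
  required.\<close>

lemma stays_below:
  fixes f f' :: "real \<Rightarrow> real"
  assumes deriv: "\<And>t. t \<ge> T \<Longrightarrow> (f has_real_derivative f' t) (at t)"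
    and init: "f T < b"
    and barrier: "\<And>t. t \<ge> T \<Longrightarrow> f t = b \<Longrightarrow> f' t < 0"
    and "t \<ge> T"
  shows "f t < b"
proof (rule ccontr)
  assume "\<not> f t < b"
  then have ft: "f t \<ge> b" by simp
  have cont: "continuous_on {T..t'} f" for t'
    using deriv by (meson DERIV_atLeastAtMost_imp_continuous_on atLeastAtMost_iff)
  define S where "S = {s \<in> {T..t}. f s = b}"
  have "S = {T..t} \<inter> f -` {b}" by (auto simp: S_def)
  then have "closed S"
    using continuous_on_closed_vimage[of "{T..t}" f] cont[of t] by (metis closed_real_atLeastAtMost closed_singleton inf_commute)
  moreover have "bdd_below S" by (rule bdd_belowI[of _ T]) (auto simp: S_def)
  moreover have ne: "S \<noteq> {}"
    using IVT'[of f T b t] init ft \<open>t \<ge> T\<close> cont[of t] by (auto simp: S_def)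
  ultimately have inS: "Inf S \<in> S" using closed_contains_Inf by blast
  \<comment> \<open>The earliest time at which the level \<open>b\<close> is attained. The barrier
    makes \<open>f\<close> exceed \<open>b\<close> just before it, and the intermediate value
    theorem then yields a still earlier one.\<close>
  define s where "s = Inf S"
  have s: "T \<le> s" "s \<le> t" "f s = b" using inS by (auto simp: S_def s_def)
  with init have "T < s" by (cases "T = s") auto
  from DERIV_neg_dec_left[OF deriv[OF s(1)] barrier[OF s(1,3)]]
  obtain d where d: "d > 0" "\<And>k. 0 < k \<Longrightarrow> k < d \<Longrightarrow> f s < f (s - k)" by blast
  define k where "k = min (d / 2) ((s - T) / 2)"
  have k: "0 < k" "k < d" "T \<le> s - k" using d(1) \<open>T < s\<close> by (auto simp: k_def min_def field_simps)
  obtain x where x: "T \<le> x" "x \<le> s - k" "f x = b"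
    using IVT'[of f T b "s - k"] init d(2)[OF k(1,2)] s(3) k cont[of "s - k"] by auto
  then have "x \<in> S" using s(2) k(1) by (auto simp: S_def)
  then have "s \<le> x" unfolding s_def using \<open>bdd_below S\<close> by (rule cInf_lower)
  with x(2) k(1) show False by simp
qed

lemma deriv_le_imp_linear_bound:
  fixes f f' :: "real \<Rightarrow> real"
  assumes deriv: "\<And>t. a \<le> t \<Longrightarrow> t \<le> b \<Longrightarrow> (f has_real_derivative f' t) (at t)"
    and le: "\<And>t. a \<le> t \<Longrightarrow> t \<le> b \<Longrightarrow> f' t \<le> m"
    and "a \<le> b"
  shows "f b \<le> f a + m * (b - a)"
proof -
  have "((\<lambda>t. f t - m * t) has_real_derivative f' t - m) (at t)" if "a \<le> t" "t \<le> b" for t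
    using deriv[OF that] by (auto intro!: derivative_eq_intros)
  then have "f b - m * b \<le> f a - m * a"
    using le by (intro DERIV_nonpos_imp_nonincreasing[OF \<open>a \<le> b\<close>]) (meson diff_le_0_iff_le)
  then show ?thesis by (simp add: algebra_simps)
qed

text \<open>A drift of at most \<open>- m\<close> at or above the level brings \<open>f\<close>
  below it after a time of about \<open>(f T - b) / m\<close>; from then on
  \<open>stays_below\<close> applies.\<close>

lemma eventually_below_barrier:
  fixes f f' :: "real \<Rightarrow> real"
  assumes deriv: "\<And>t. t \<ge> T \<Longrightarrow> (f has_real_derivative f' t) (at t)"
    and "m > 0"
    and barrier: "\<And>t. t \<ge> T \<Longrightarrow> b \<le> f t \<Longrightarrow> f' t \<le> - m"
  shows "eventually (\<lambda>t. f t < b) at_top"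
proof -
  have "\<exists>s\<ge>T. f s < b"
  proof (rule ccontr)
    assume "\<not> ?thesis"
    then have ge: "f s \<ge> b" if "s \<ge> T" for s using that by force
    define t where "t = T + (f T - b) / m + 1"
    have "t \<ge> T" using ge[of T] \<open>m > 0\<close> by (simp add: t_def)
    then have "f t \<le> f T + (- m) * (t - T)"
      using deriv barrier ge by (intro deriv_le_imp_linear_bound[where f' = f']) auto
    also have "\<dots> = b - m" using \<open>m > 0\<close> by (simp add: t_def field_simps)
    also have "\<dots> < b" using \<open>m > 0\<close> by simp
    finally show False using ge[OF \<open>t \<ge> T\<close>] by simp
  qed
  then obtain s where s: "s \<ge> T" "f s < b" by blast
  have "f t < b" if "t \<ge> s" for t
  proof (rule stays_below[where T = s and f = f and f' = f' and b = b])
    fix r assume r: "s \<le> r"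
    then show "(f has_real_derivative f' r) (at r)" using s(1) by (intro deriv) auto
    assume "f r = b"
    then show "f' r < 0" using barrier[of r] r s(1) \<open>m > 0\<close> by auto
  qed (use s(2) that in auto)
  then show ?thesis using eventually_at_top_linorder by blast
qed

text \<open>A Barbalat argument, taking the place of LaSalle's principle for systems that are not
  autonomous. The bound on \<open>f'\<close> stretches a single time with
  \<open>\<bar>f t\<bar> \<ge> e\<close> to an interval of fixed length on which \<open>L\<close>
  loses a fixed amount. Once \<open>L\<close> is close to its infimum, no such time can
  occur.\<close>

lemma lyapunov_tendsto_0:
  fixes f f' L L' :: "real \<Rightarrow> real"
  assumes dL: "\<And>t. t \<ge> T \<Longrightarrow> (L has_real_derivative L' t) (at t)"
    and bdd: "\<And>t. t \<ge> T \<Longrightarrow> m \<le> L t"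
    and nonpos: "\<And>t. t \<ge> T \<Longrightarrow> L' t \<le> 0"
    and df: "\<And>t. t \<ge> T \<Longrightarrow> (f has_real_derivative f' t) (at t)"
    and lip: "\<And>t. t \<ge> T \<Longrightarrow> \<bar>f' t\<bar> \<le> K"
    and diss: "\<And>e. e > 0 \<Longrightarrow> \<exists>d>0. \<forall>t\<ge>T. e \<le> \<bar>f t\<bar> \<longrightarrow> L' t \<le> - d"
  shows "(f \<longlongrightarrow> 0) at_top"
proof (rule tendstoI)
  fix e :: real
  assume "e > 0"
  then obtain d where d: "d > 0" "\<And>t. t \<ge> T \<Longrightarrow> e / 2 \<le> \<bar>f t\<bar> \<Longrightarrow> L' t \<le> - d"
    using diss[of "e / 2"] by auto
  have "K \<ge> 0" using lip[of T] by linarith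
  \<comment> \<open>Within time \<open>\<tau>\<close> a function of slope at most \<open>K\<close>
    cannot fall from \<open>e\<close> below \<open>e / 2\<close>; the summand \<open>1\<close> keeps
    the quotient meaningful for \<open>K = 0\<close>.\<close>
  define \<tau> where "\<tau> = e / (2 * (K + 1))"
  have "\<tau> > 0" using \<open>e > 0\<close> \<open>K \<ge> 0\<close> by (simp add: \<tau>_def)
  have dec: "L b \<le> L a" if "T \<le> a" "a \<le> b" for a b
  proof (rule DERIV_nonpos_imp_nonincreasing[OF that(2)])
    fix x assume "a \<le> x" "x \<le> b"
    then have "T \<le> x" using that by simp
    then show "\<exists>y. (L has_real_derivative y) (at x) \<and> y \<le> 0" using dL nonpos by blast
  qed
  have drop: "L (t + \<tau>) \<le> L t - d * \<tau>" if t: "t \<ge> T" "e \<le> \<bar>f t\<bar>" for t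
  proof -
    have big: "e / 2 \<le> \<bar>f s\<bar>" if s: "t \<le> s" "s \<le> t + \<tau>" for s
    proof -
      have "norm (f s - f t) \<le> K * norm (s - t)"
        using s t df lip
        by (intro field_differentiable_bound[of "{t..s}" f f'])
           (auto intro: has_field_derivative_at_within)
      also have "\<dots> \<le> (K + 1) * \<tau>"
        using s \<open>K \<ge> 0\<close> by (intro mult_mono) auto
      also have "\<dots> = e / 2" using \<open>K \<ge> 0\<close> by (simp add: \<tau>_def field_simps)
      finally show ?thesis using t(2) by (auto simp: abs_if split: if_splits)
    qed
    have "L (t + \<tau>) \<le> L t + (- d) * (t + \<tau> - t)"
      using t \<open>\<tau> > 0\<close> big by (intro deriv_le_imp_linear_bound[where f' = L'] dL d(2)) auto
    then show ?thesis by simp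
  qed
  define I where "I = Inf (L ` {T..})"
  have bb: "bdd_below (L ` {T..})" using bdd by (auto intro!: bdd_belowI[of _ m])
  have "\<exists>s\<ge>T. L s < I + d * \<tau>"
  proof (rule ccontr)
    assume "\<not> ?thesis"
    then have "I + d * \<tau> \<le> I"
      unfolding I_def by (intro cInf_greatest) (auto simp: I_def not_less)
    then show False using d(1) \<open>\<tau> > 0\<close> by (simp add: mult_le_0_iff)
  qed
  then obtain s where s: "s \<ge> T" "L s < I + d * \<tau>" by blast
  have "\<bar>f t\<bar> < e" if "t \<ge> s" for t
  proof (rule ccontr)
    assume "\<not> \<bar>f t\<bar> < e"
    then have "L (t + \<tau>) \<le> L t - d * \<tau>" using drop[of t] s that by auto
    also have "\<dots> < I" using dec[OF s(1) that] s(2) by simp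
    also have "I \<le> L (t + \<tau>)"
      unfolding I_def using bb s that \<open>\<tau> > 0\<close> by (intro cInf_lower) auto
    finally show False by simp
  qed
  then show "eventually (\<lambda>t. dist (f t) 0 < e) at_top"
    unfolding eventually_at_top_linorder by (auto simp: dist_real_def)
qed

text \<open>Recovers the limit of a quantity on which a Lyapunov function gives no direct control.
  On \<open>[t, t + 1]\<close> the mean value theorem provides a point where \<open>f'\<close>,
  hence \<open>g\<close>, is small, and the smallness of \<open>g'\<close> carries this back to
  \<open>t\<close>.\<close>

lemma tendsto_0_of_slow_derivative:
  fixes f f' g g' :: "real \<Rightarrow> real"
  assumes df: "\<And>t. t \<ge> T \<Longrightarrow> (f has_real_derivative f' t) (at t)"
    and dg: "\<And>t. t \<ge> T \<Longrightarrow> (g has_real_derivative g' t) (at t)"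
    and f: "(f \<longlongrightarrow> l) at_top"
    and diff: "((\<lambda>t. f' t - g t) \<longlongrightarrow> 0) at_top"
    and g': "(g' \<longlongrightarrow> 0) at_top"
  shows "(g \<longlongrightarrow> 0) at_top"
proof (rule tendstoI)
  fix e :: real
  assume "e > 0"
  have "eventually (\<lambda>t. dist (f t) l < e / 6) at_top" "eventually (\<lambda>t. dist (f' t - g t) 0 < e / 3) at_top"
    "eventually (\<lambda>t. dist (g' t) 0 < e / 3) at_top"
    using tendstoD[OF f, of "e / 6"] tendstoD[OF diff, of "e / 3"] tendstoD[OF g', of "e / 3"] \<open>e > 0\<close>
    by simp_all
  then have "eventually (\<lambda>t. t \<ge> T \<and> dist (f t) l < e / 6 \<and> dist (f' t - g t) 0 < e / 3 \<and> dist (g' t) 0 < e / 3) at_top"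
    using eventually_ge_at_top[of T] by eventually_elim auto
  then obtain S where S: "\<And>t. t \<ge> S \<Longrightarrow> t \<ge> T" "\<And>t. t \<ge> S \<Longrightarrow> \<bar>f t - l\<bar> < e / 6"
    "\<And>t. t \<ge> S \<Longrightarrow> \<bar>f' t - g t\<bar> < e / 3" "\<And>t. t \<ge> S \<Longrightarrow> \<bar>g' t\<bar> < e / 3"
    unfolding eventually_at_top_linorder by (auto simp: dist_real_def)
  have "\<bar>g t\<bar> < e" if t: "t \<ge> S" for t
  proof -
    obtain c where c: "t < c" "c < t + 1" "f (t + 1) - f t = (t + 1 - t) * f' c"
      using MVT2[of t "t + 1" f f'] df S(1) t by fastforce
    obtain x where x: "t < x" "x < c" "g c - g t = (c - t) * g' x"
      using MVT2[of t c g g'] dg S(1) t c(1) by fastforce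
    have "f' c = f (t + 1) - f t" using c(3) by simp
    then have "\<bar>f' c\<bar> < e / 3" using S(2)[of t] S(2)[of "t + 1"] t by linarith
    moreover have "\<bar>f' c - g c\<bar> < e / 3" using S(3)[of c] t c by auto
    moreover have "\<bar>(c - t) * g' x\<bar> < e / 3"
    proof -
      have "\<bar>(c - t) * g' x\<bar> \<le> 1 * \<bar>g' x\<bar>"
        unfolding abs_mult using c by (intro mult_right_mono) auto
      then show ?thesis using S(4)[of x] t x by auto
    qed
    ultimately show ?thesis using x(3) by linarith
  qed
  then show "eventually (\<lambda>t. dist (g t) 0 < e) at_top"
    unfolding eventually_at_top_linorder by (auto simp: dist_real_def)
qed

lemma exp_decay_bound:
  fixes f f' :: "real \<Rightarrow> real"
  assumes deriv: "\<And>t. t \<ge> T \<Longrightarrow> (f has_real_derivative f' t) (at t)"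
    and le: "\<And>t. t \<ge> T \<Longrightarrow> f' t \<le> - m * f t" and "t \<ge> T"
  shows "f t \<le> f T * exp (m * T) * exp (- m * t)"
proof -
  have "f t * exp (m * t) \<le> f T * exp (m * T)"
  proof (rule DERIV_nonpos_imp_nonincreasing[OF \<open>t \<ge> T\<close>])
    fix s assume s: "T \<le> s" "s \<le> t"
    have "((\<lambda>t. f t * exp (m * t)) has_real_derivative (f' s + m * f s) * exp (m * s)) (at s)"
      by (rule derivative_eq_intros refl deriv[OF s(1)])+ (simp add: algebra_simps)
    moreover have "(f' s + m * f s) * exp (m * s) \<le> 0"
      using le[OF s(1)] by (intro mult_nonpos_nonneg) auto
    ultimately show "\<exists>y. ((\<lambda>t. f t * exp (m * t)) has_real_derivative y) (at s) \<and> y \<le> 0" by blast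
  qed
  then have "f t * exp (m * t) * exp (- m * t) \<le> f T * exp (m * T) * exp (- m * t)"
    by (intro mult_right_mono) auto
  then show ?thesis by (simp add: mult.assoc flip: exp_add)
qed

text \<open>The final contradiction in the arguments against too fast decay. The linear bound
  \<open>exp x \<ge> x\<close> is already enough to exceed \<open>C\<close>.\<close>

lemma exp_not_dominated:
  fixes c C l m T :: real
  assumes "c > 0" "l < m" and le: "\<And>t. t \<ge> T \<Longrightarrow> c * exp (- l * t) \<le> C * exp (- m * t)"
  shows False
proof -
  have bound: "c * ((m - l) * t) \<le> C" if "t \<ge> T" for t
  proof -
    have "(m - l) * t \<le> exp ((m - l) * t)"
      using exp_ge_add_one_self[of "(m - l) * t"] by linarith
    then have "c * ((m - l) * t) \<le> c * exp ((m - l) * t)"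
      using \<open>c > 0\<close> by (intro mult_left_mono) auto
    also have "\<dots> = c * exp (- l * t) * exp (m * t)"
      by (simp add: algebra_simps flip: exp_add)
    also have "\<dots> \<le> C * exp (- m * t) * exp (m * t)"
      using le[OF that] by (intro mult_right_mono) auto
    also have "\<dots> = C" by (simp add: mult.assoc flip: exp_add)
    finally show ?thesis .
  qed
  define t where "t = max T (C / (c * (m - l)) + 1)"
  have D: "0 < c * (m - l)" using assms by simp
  have "c * ((m - l) * (C / (c * (m - l)) + 1)) = c * (m - l) * (C / (c * (m - l))) + c * (m - l)"
    by (simp only: distrib_left mult.assoc mult_1_right)
  also have "\<dots> = C + c * (m - l)"
  proof -
    obtain d where d: "c * (m - l) = d" by blast
    show ?thesis using D unfolding d by simp
  qed
  finally have "C < c * ((m - l) * (C / (c * (m - l)) + 1))" using D by simp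
  also have "\<dots> \<le> c * ((m - l) * t)"
    using assms by (intro mult_left_mono) (auto simp: t_def)
  also have "\<dots> \<le> C" by (rule bound) (simp add: t_def)
  finally show False by simp
qed

lemma powr_minus_one_mult:
  fixes x a :: real
  assumes "0 < x"
  shows "x powr (a - 1) * x = x powr a"
  using assms by (simp add: powr_diff)

section \<open>Predator-prey systems\<close>

text \<open>\<open>A\<close> stands for the drifting value of \<open>\<alpha>\<close>, and
  \<open>T\<close> is a time after which the orbit lies in \<open>\<xi> < 1\<close> and
  \<open>A\<close> is below \<open>\<eta> = \<delta> + \<nu> * n\<close>. The latter makes the
  isocline increasing. The equation of \<open>A\<close> is recorded because the decrease of
  \<open>A\<close> has to pay for the perturbation.\<close>

locale gause_system =
  fixes \<nu> \<delta> n \<alpha> q T :: real and \<xi> u A :: "real \<Rightarrow> real"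
  assumes nu: "1 < \<nu>" and delta_pos: "0 < \<delta>" and n_pos: "0 < n" and alpha_ge: "\<delta> \<le> \<alpha>" and q: "1 < q"
    and xi: "\<And>t. t \<ge> T \<Longrightarrow> 0 < \<xi> t" "\<And>t. t \<ge> T \<Longrightarrow> \<xi> t < 1"
    and u_pos: "\<And>t. t \<ge> T \<Longrightarrow> 0 < u t"
    and A_gt: "\<And>t. t \<ge> T \<Longrightarrow> \<alpha> < A t" and A_less: "\<And>t. t \<ge> T \<Longrightarrow> A t < \<delta> + \<nu> * n"
    and A_lim: "(A \<longlongrightarrow> \<alpha>) at_top"
    and xi_deriv: "\<And>t. t \<ge> T \<Longrightarrow> (\<xi> has_real_derivative
        \<xi> t * (A t * \<xi> t - (\<delta> + \<nu> * n)) + \<nu> * \<xi> t powr (1 - 1 / \<nu>) * u t * (1 - \<xi> t)) (at t)"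
    and u_deriv: "\<And>t. t \<ge> T \<Longrightarrow> (u has_real_derivative (1 - 1 / \<nu>) * u t * (\<delta> - A t * \<xi> t)) (at t)"
    and A_deriv: "\<And>t. t \<ge> T \<Longrightarrow> (A has_real_derivative
        - (q - 1) * (A t - \<alpha>) * (\<alpha> + (A t - \<alpha>) / q) * \<xi> t) (at t)"
begin

lemma alpha_pos: "0 < \<alpha>" using delta_pos alpha_ge by simp

lemma theta: "0 < 1 - 1 / \<nu>" "1 - 1 / \<nu> < 1" "0 < 1 / \<nu>" using nu by (auto simp: field_simps)

text \<open>The isocline \<open>\<xi>' = 0\<close> reads \<open>\<nu> u = x^(1/\<nu>) (\<eta> - a x) / (1 - x)\<close> with \<open>\<eta> = \<delta> + \<nu> n\<close>.
  Both factors increase with \<open>x\<close> because \<open>a < \<eta>\<close>; this is what makes the Lyapunov function work.\<close>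

definition isocline :: "real \<Rightarrow> real \<Rightarrow> real" where
  "isocline a x = x powr (1 / \<nu>) * ((\<delta> + \<nu> * n - a * x) / (1 - x))"

text \<open>The rational factor equals \<open>a + (\<eta> - a) / (1 - x)\<close>, which is
  increasing and at least \<open>\<eta>\<close>. The resulting bound is independent of
  \<open>a\<close>, so the dissipation is uniform along the drifting coefficient
  \<open>A t\<close>.\<close>

lemma isocline_mono:
  assumes "0 < x" "x \<le> z" "z < 1" "a < \<delta> + \<nu> * n"
  shows "isocline a z - isocline a x \<ge> (\<delta> + \<nu> * n) * (z powr (1 / \<nu>) - x powr (1 / \<nu>))"
proof -
  define \<eta> where "\<eta> = \<delta> + \<nu> * n"
  define K where "K = (\<lambda>x. (\<eta> - a * x) / (1 - x))"
  have K: "K v = a + (\<eta> - a) / (1 - v)" if "v < 1" for v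
    using that by (simp add: K_def field_simps)
  have "(\<eta> - a) / (1 - x) \<le> (\<eta> - a) / (1 - z)"
    using assms by (intro divide_left_mono) (auto simp: \<eta>_def)
  then have KK: "K x \<le> K z" using K assms by auto
  have K1: "\<eta> \<le> K z"
  proof -
    have "\<eta> * (1 - z) \<le> \<eta> - a * z"
      using assms mult_right_mono[of a \<eta> z] by (simp add: \<eta>_def algebra_simps)
    then show ?thesis using assms by (simp add: K_def pos_le_divide_eq)
  qed
  have pw: "x powr (1 / \<nu>) \<le> z powr (1 / \<nu>)"
    using assms nu by (intro powr_mono2) auto
  have "isocline a v = v powr (1 / \<nu>) * K v" for v
    by (simp add: isocline_def K_def \<eta>_def)
  then have "isocline a z - isocline a x
      = (z powr (1 / \<nu>) - x powr (1 / \<nu>)) * K z + x powr (1 / \<nu>) * (K z - K x)"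
    by (simp add: algebra_simps)
  moreover have "(z powr (1 / \<nu>) - x powr (1 / \<nu>)) * \<eta> \<le> (z powr (1 / \<nu>) - x powr (1 / \<nu>)) * K z"
    using pw K1 by (intro mult_left_mono) auto
  moreover have "0 \<le> x powr (1 / \<nu>) * (K z - K x)" using KK by simp
  ultimately show ?thesis unfolding \<eta>_def[symmetric] by (simp add: algebra_simps)
qed

lemma isocline_mono_product:
  assumes "0 < x" "x < 1" "0 < z" "z < 1" "a < \<delta> + \<nu> * n"
  shows "(\<delta> + \<nu> * n) * ((z - x) * (z powr (1 / \<nu>) - x powr (1 / \<nu>)))
       \<le> (z - x) * (isocline a z - isocline a x)"
proof (cases "x \<le> z")
  case True
  then show ?thesis
    using mult_left_mono[OF isocline_mono[of x z a], of "z - x"] assms by (simp add: algebra_simps)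
next
  case False
  then show ?thesis
    using mult_left_mono[OF isocline_mono[of z x a], of "x - z"] assms by (simp add: algebra_simps)
qed

lemma xi_deriv':
  assumes "t \<ge> T"
  shows "(\<xi> has_real_derivative
    \<xi> t powr (1 - 1 / \<nu>) * (1 - \<xi> t) * (\<nu> * u t - isocline (A t) (\<xi> t))) (at t)"
proof -
  have "\<xi> t powr (1 - 1 / \<nu>) * \<xi> t powr (1 / \<nu>) = \<xi> t"
    using xi[OF assms] by (simp flip: powr_add)
  then have "\<xi> t powr (1 - 1 / \<nu>) * (1 - \<xi> t) * isocline (A t) (\<xi> t)
      = \<xi> t * (\<delta> + \<nu> * n - A t * \<xi> t)"
    using xi[OF assms] by (simp add: isocline_def field_simps)
  then have "\<xi> t powr (1 - 1 / \<nu>) * (1 - \<xi> t) * (\<nu> * u t - isocline (A t) (\<xi> t))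
     = \<xi> t * (A t * \<xi> t - (\<delta> + \<nu> * n)) + \<nu> * \<xi> t powr (1 - 1 / \<nu>) * u t * (1 - \<xi> t)"
    by (simp add: algebra_simps)
  then show ?thesis using xi_deriv[OF assms] by simp
qed

end

section \<open>Convergence to the interior equilibrium for
  \<open>\<delta> < \<alpha>\<close>\<close>

locale gause_interior = gause_system +
  assumes alpha_gt: "\<delta> < \<alpha>"
begin

text \<open>The equilibrium for the limiting coefficient \<open>A = \<alpha>\<close>:
  \<open>u' = 0\<close> forces \<open>\<xi> = \<delta> / \<alpha>\<close>, and \<open>u0\<close> is
  then read off the isocline.\<close>

definition "\<xi>0 = \<delta> / \<alpha>"
definition "u0 = isocline \<alpha> \<xi>0 / \<nu>"

lemma xi0: "0 < \<xi>0" "\<xi>0 < 1" "\<alpha> * \<xi>0 = \<delta>"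
  using delta_pos alpha_gt by (auto simp: \<xi>0_def)

lemma u0_pos: "0 < u0"
  using xi0 n_pos nu delta_pos by (auto simp: u0_def isocline_def intro!: divide_pos_pos mult_pos_pos)

text \<open>For constant \<open>A = \<alpha>\<close> the function \<open>\<Psi>(\<xi>) + \<nu>/(\<theta> \<alpha>) (u - u0 ln u)\<close> decreases, as for
  predator-prey systems; here \<open>\<theta> = 1 - 1/\<nu>\<close> and \<open>\<Psi>'(x) = (x - \<xi>0) / (x^\<theta> (1 - x))\<close>. The terms caused by \<open>A - \<alpha>\<close> are bounded by a multiple of
  \<open>(A - \<alpha>) \<xi>\<close>, hence of \<open>- A'\<close>, and are absorbed by adding a multiple of \<open>A\<close>.\<close>

lemma lyapunov_exists:
  obtains L L' where
    "\<And>t. t \<ge> T \<Longrightarrow> (L has_real_derivative L' t) (at t)"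
    "\<And>t. t \<ge> T \<Longrightarrow> L' t \<le> - (\<delta> + \<nu> * n) * ((\<xi> t - \<xi>0) * (\<xi> t powr (1 / \<nu>) - \<xi>0 powr (1 / \<nu>)))"
    "\<And>t. t \<ge> T \<Longrightarrow> \<nu> / ((1 - 1 / \<nu>) * \<alpha>) * (u t - u0 * ln (u t)) \<le> L t"
proof -
  define \<theta> where "\<theta> = 1 - 1 / \<nu>"
  have \<theta>: "0 < \<theta>" using theta by (simp add: \<theta>_def)
  define psi where "psi = (\<lambda>z. (z - \<xi>0) / (z powr \<theta> * (1 - z)))"
  \<comment> \<open>The integrand is singular at both ends, so its primitive is taken on the open
    interval \<open>(0, 1)\<close>. Its denominator is the positive prefactor of
    \<open>\<xi>'\<close> in \<open>xi_deriv'\<close>, which it cancels.\<close>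
  have "\<exists>F. \<forall>x. ereal 0 < ereal x \<longrightarrow> ereal x < ereal 1 \<longrightarrow> (F has_vector_derivative psi x) (at x)"
    by (rule einterval_antiderivative) (auto simp: psi_def intro!: continuous_intros)
  then obtain F where F: "\<And>x. 0 < x \<Longrightarrow> x < 1 \<Longrightarrow> (F has_real_derivative psi x) (at x)"
    by (auto simp: has_real_derivative_iff_has_vector_derivative)
  have Fmin: "F \<xi>0 \<le> F x" if x: "0 < x" "x < 1" for x
  proof (cases "\<xi>0 \<le> x")
    case True
    show ?thesis
    proof (rule DERIV_nonneg_imp_nondecreasing[OF True])
      fix z assume "\<xi>0 \<le> z" "z \<le> x"
      then show "\<exists>y. (F has_real_derivative y) (at z) \<and> 0 \<le> y"
        using F[of z] xi0 x by (intro exI[of _ "psi z"]) (auto simp: psi_def)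
    qed
  next
    case False
    then have "x \<le> \<xi>0" by simp
    then show ?thesis
    proof (rule DERIV_nonpos_imp_nonincreasing)
      fix z assume "x \<le> z" "z \<le> \<xi>0"
      then show "\<exists>y. (F has_real_derivative y) (at z) \<and> y \<le> 0"
        using F[of z] xi0 x by (intro exI[of _ "psi z"]) (auto simp: psi_def divide_nonpos_pos)
    qed
  qed
  define c0 where "c0 = \<xi>0 powr (1 / \<nu>) * \<xi>0 / (1 - \<xi>0)"
  have c0: "0 \<le> c0" using xi0 by (simp add: c0_def)
  \<comment> \<open>Replacing \<open>\<alpha>\<close> by \<open>A\<close> produces two errors:
    \<open>c0 * (A - \<alpha>)\<close> from the shift of the isocline at \<open>\<xi>0\<close>, and
    \<open>\<nu> * u0 / \<alpha> * (A - \<alpha>) * \<xi>\<close> from the equation of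
    \<open>u\<close>. \<open>C\<close> is the weight with which the decrease of \<open>A\<close>
    covers their sum.\<close>
  define C where "C = (c0 + \<nu> * u0 / \<alpha>) / ((q - 1) * \<alpha>)"
  have C: "0 \<le> C" "C * ((q - 1) * \<alpha>) = c0 + \<nu> * u0 / \<alpha>"
    using c0 u0_pos nu alpha_pos q by (auto simp: C_def)
  define L where "L = (\<lambda>t. F (\<xi> t) - F \<xi>0 + \<nu> / (\<theta> * \<alpha>) * (u t - u0 * ln (u t)) + C * (A t - \<alpha>))"
  define L' where "L' = (\<lambda>t. (\<xi> t - \<xi>0) * (\<nu> * u t - isocline (A t) (\<xi> t))
      + \<nu> / \<alpha> * (u t - u0) * (\<delta> - A t * \<xi> t)
      + C * (- (q - 1) * (A t - \<alpha>) * (\<alpha> + (A t - \<alpha>) / q) * \<xi> t))"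
  show thesis
  proof
    fix t assume t: "t \<ge> T"
    note x = xi[OF t] and u = u_pos[OF t]
    have "((\<lambda>t. F (\<xi> t)) has_real_derivative
        psi (\<xi> t) * (\<xi> t powr (1 - 1 / \<nu>) * (1 - \<xi> t) * (\<nu> * u t - isocline (A t) (\<xi> t)))) (at t)"
      by (rule DERIV_chain2[OF F[OF x] xi_deriv'[OF t]])
    moreover have "psi (\<xi> t) * (\<xi> t powr (1 - 1 / \<nu>) * (1 - \<xi> t) * (\<nu> * u t - isocline (A t) (\<xi> t)))
        = (\<xi> t - \<xi>0) * (\<nu> * u t - isocline (A t) (\<xi> t))"
      using x by (simp add: psi_def \<theta>_def)
    ultimately have 1: "((\<lambda>t. F (\<xi> t)) has_real_derivative
        (\<xi> t - \<xi>0) * (\<nu> * u t - isocline (A t) (\<xi> t))) (at t)" by simp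
    have "((\<lambda>t. u t - u0 * ln (u t)) has_real_derivative
       \<theta> * u t * (\<delta> - A t * \<xi> t) - u0 * (\<theta> * u t * (\<delta> - A t * \<xi> t) / u t)) (at t)"
      using u unfolding \<theta>_def by (auto intro!: derivative_eq_intros u_deriv[OF t])
    moreover have "\<theta> * u t * (\<delta> - A t * \<xi> t) - u0 * (\<theta> * u t * (\<delta> - A t * \<xi> t) / u t)
        = \<theta> * ((u t - u0) * (\<delta> - A t * \<xi> t))"
      using u by (simp add: field_simps)
    ultimately have 2: "((\<lambda>t. \<nu> / (\<theta> * \<alpha>) * (u t - u0 * ln (u t))) has_real_derivative
       \<nu> / (\<theta> * \<alpha>) * (\<theta> * ((u t - u0) * (\<delta> - A t * \<xi> t)))) (at t)"
      by (metis DERIV_cmult)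
    have "\<nu> / (\<theta> * \<alpha>) * (\<theta> * ((u t - u0) * (\<delta> - A t * \<xi> t))) = \<nu> / \<alpha> * (u t - u0) * (\<delta> - A t * \<xi> t)"
      using \<theta> by simp
    with 2 have 3: "((\<lambda>t. \<nu> / (\<theta> * \<alpha>) * (u t - u0 * ln (u t))) has_real_derivative
       \<nu> / \<alpha> * (u t - u0) * (\<delta> - A t * \<xi> t)) (at t)" by simp
    have 4: "((\<lambda>t. C * (A t - \<alpha>)) has_real_derivative
       C * (- (q - 1) * (A t - \<alpha>) * (\<alpha> + (A t - \<alpha>) / q) * \<xi> t)) (at t)"
      by (rule derivative_eq_intros refl A_deriv[OF t])+ simp
    show "(L has_real_derivative L' t) (at t)"
      unfolding L_def L'_def
      by (rule derivative_eq_intros refl 1 3 4)+ simp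
    show "\<nu> / ((1 - 1 / \<nu>) * \<alpha>) * (u t - u0 * ln (u t)) \<le> L t"
      using Fmin[OF x] mult_nonneg_nonneg[OF C(1), of "A t - \<alpha>"] A_gt[OF t] unfolding L_def \<theta>_def
      by simp
    define B where "B = A t - \<alpha>"
    have B: "0 < B" using A_gt[OF t] by (simp add: B_def)
    have i1: "\<nu> * u0 - isocline (A t) \<xi>0 = c0 * B"
    proof -
      have "\<nu> * u0 - isocline (A t) \<xi>0
          = \<xi>0 powr (1 / \<nu>) * ((\<delta> + \<nu> * n - \<alpha> * \<xi>0 - (\<delta> + \<nu> * n - A t * \<xi>0)) / (1 - \<xi>0))"
        using nu by (simp add: u0_def isocline_def diff_divide_distrib right_diff_distrib)
      then show ?thesis by (simp add: c0_def B_def algebra_simps)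
    qed
    have i2: "(\<delta> + \<nu> * n) * ((\<xi> t - \<xi>0) * (\<xi> t powr (1 / \<nu>) - \<xi>0 powr (1 / \<nu>)))
       \<le> (\<xi> t - \<xi>0) * (isocline (A t) (\<xi> t) - isocline (A t) \<xi>0)"
      using x xi0 A_less[OF t] by (intro isocline_mono_product) auto
    have i3: "(\<xi> t - \<xi>0) * (c0 * B) \<le> \<xi> t * (c0 * B)"
      using xi0 c0 B by (intro mult_right_mono) auto
    have i4: "\<nu> / \<alpha> * (u t - u0) * (\<delta> - A t * \<xi> t) \<le> \<nu> * (u t - u0) * (\<xi>0 - \<xi> t) + \<nu> * u0 / \<alpha> * (B * \<xi> t)"
    proof -
      have "\<delta> - A t * \<xi> t = \<alpha> * (\<xi>0 - \<xi> t) - B * \<xi> t"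
        by (simp add: B_def \<xi>0_def algebra_simps alpha_pos[THEN less_imp_neq, symmetric])
      then have "\<nu> / \<alpha> * (u t - u0) * (\<delta> - A t * \<xi> t)
          = \<nu> / \<alpha> * (u t - u0) * (\<alpha> * (\<xi>0 - \<xi> t) - B * \<xi> t)" by simp
      also have "\<dots> = \<nu> * (u t - u0) * (\<xi>0 - \<xi> t) + \<nu> * u0 / \<alpha> * (B * \<xi> t) - \<nu> / \<alpha> * u t * (B * \<xi> t)"
        using alpha_pos by (simp add: field_simps)
      finally show ?thesis using u nu alpha_pos B x by simp
    qed
    have i5: "C * (- (q - 1) * (A t - \<alpha>) * (\<alpha> + (A t - \<alpha>) / q) * \<xi> t)
        \<le> - ((c0 + \<nu> * u0 / \<alpha>) * (B * \<xi> t))"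
    proof -
      have "C * ((q - 1) * \<alpha>) * (B * \<xi> t) \<le> C * ((q - 1) * (\<alpha> + B / q)) * (B * \<xi> t)"
        using C(1) q B x by (intro mult_right_mono mult_left_mono) auto
      moreover obtain k where k: "\<alpha> + (A t - \<alpha>) / q = k" by blast
      ultimately show ?thesis unfolding C(2) B_def k by (simp add: algebra_simps)
    qed
    \<comment> \<open>The weight \<open>\<nu> / (\<theta> * \<alpha>)\<close> of the logarithmic
      part was chosen to make the products of \<open>\<xi> - \<xi>0\<close> and
      \<open>u - u0\<close> cancel here; only the difference of isocline values and the shift
      remain.\<close>
    have "(\<xi> t - \<xi>0) * (\<nu> * u t - isocline (A t) (\<xi> t)) + \<nu> * (u t - u0) * (\<xi>0 - \<xi> t)
       = (\<xi> t - \<xi>0) * (\<nu> * u0 - isocline (A t) \<xi>0) - (\<xi> t - \<xi>0) * (isocline (A t) (\<xi> t) - isocline (A t) \<xi>0)"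
      by (simp add: algebra_simps)
    then show "L' t \<le> - (\<delta> + \<nu> * n) * ((\<xi> t - \<xi>0) * (\<xi> t powr (1 / \<nu>) - \<xi>0 powr (1 / \<nu>)))"
      using i2 i3 i4 i5 unfolding L'_def i1 by (simp add: algebra_simps)
  qed
qed

text \<open>Comparing the logarithm with its tangent at \<open>2 * u0\<close> shows that
  \<open>u - u0 * ln u\<close> is at least \<open>u / 2\<close> minus a constant, so the decreasing
  Lyapunov function bounds \<open>u\<close>.\<close>

lemma u_bounded: "\<exists>M. \<forall>t\<ge>T. u t \<le> M"
  and lyapunov_bounded_below: "\<exists>m. \<forall>t\<ge>T. m \<le> u t - u0 * ln (u t)"
proof -
  have ln_le: "u t / 2 - u0 * (ln (2 * u0) - 1) \<le> u t - u0 * ln (u t)" if "t \<ge> T" for t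
  proof -
    have "ln (u t / (2 * u0)) \<le> u t / (2 * u0) - 1"
      using u_pos[OF that] u0_pos by (intro ln_le_minus_one) auto
    then have "ln (u t) \<le> u t / (2 * u0) - 1 + ln (2 * u0)"
      using u_pos[OF that] u0_pos by (simp add: ln_div)
    then have "u0 * ln (u t) \<le> u0 * (u t / (2 * u0) - 1 + ln (2 * u0))"
      using u0_pos by (intro mult_left_mono) auto
    also have "\<dots> = u t / 2 + u0 * (ln (2 * u0) - 1)" using u0_pos by (simp add: algebra_simps)
    finally show ?thesis by simp
  qed
  show "\<exists>m. \<forall>t\<ge>T. m \<le> u t - u0 * ln (u t)"
  proof (intro exI allI impI)
    fix t assume "t \<ge> T"
    then show "- u0 * (ln (2 * u0) - 1) \<le> u t - u0 * ln (u t)"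
      using ln_le[of t] u_pos[of t] by simp
  qed
  obtain L L' where L: "\<And>t. t \<ge> T \<Longrightarrow> (L has_real_derivative L' t) (at t)"
    "\<And>t. t \<ge> T \<Longrightarrow> L' t \<le> - (\<delta> + \<nu> * n) * ((\<xi> t - \<xi>0) * (\<xi> t powr (1 / \<nu>) - \<xi>0 powr (1 / \<nu>)))"
    "\<And>t. t \<ge> T \<Longrightarrow> \<nu> / ((1 - 1 / \<nu>) * \<alpha>) * (u t - u0 * ln (u t)) \<le> L t"
    using lyapunov_exists by blast
  have nonpos: "L' t \<le> 0" if "t \<ge> T" for t
  proof -
    have "0 \<le> (\<xi> t - \<xi>0) * (\<xi> t powr (1 / \<nu>) - \<xi>0 powr (1 / \<nu>))"
    proof (cases "\<xi> t \<le> \<xi>0")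
      case True
      then show ?thesis
        using xi[OF that] nu by (intro mult_nonpos_nonpos) (auto intro!: powr_mono2)
    next
      case False
      then show ?thesis
        using xi0 nu by (intro mult_nonneg_nonneg) (auto intro!: powr_mono2)
    qed
    then have "0 \<le> (\<delta> + \<nu> * n) * ((\<xi> t - \<xi>0) * (\<xi> t powr (1 / \<nu>) - \<xi>0 powr (1 / \<nu>)))"
      using delta_pos nu n_pos by (intro mult_nonneg_nonneg[of "\<delta> + \<nu> * n"]) auto
    then show ?thesis using L(2)[OF that] unfolding minus_mult_left[symmetric] by linarith
  qed
  define c where "c = \<nu> / ((1 - 1 / \<nu>) * \<alpha>)"
  have c: "c > 0" using nu alpha_pos theta by (simp add: c_def)
  have "u t \<le> 2 * (L T / c + u0 * (ln (2 * u0) - 1))" if t: "t \<ge> T" for t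
  proof -
    have "L t \<le> L T"
    proof (rule DERIV_nonpos_imp_nonincreasing[OF t])
      fix s assume "T \<le> s" "s \<le> t"
      then show "\<exists>y. (L has_real_derivative y) (at s) \<and> y \<le> 0" using L(1) nonpos by blast
    qed
    then have "c * (u t / 2 - u0 * (ln (2 * u0) - 1)) \<le> L T"
      using L(3)[OF t] mult_left_mono[OF ln_le[OF t], of c] c by (simp add: c_def)
    then show ?thesis using c by (simp add: field_simps)
  qed
  then show "\<exists>M. \<forall>t\<ge>T. u t \<le> M" by blast
qed

text \<open>Supplies the uniform dissipation that \<open>lyapunov_tendsto_0\<close> demands. The
  difference of powers grows with the distance from \<open>\<xi>0\<close> on either side, so its
  values at distance \<open>e\<close> serve as bounds.\<close>

lemma powr_gap:
  assumes "e > 0"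
  obtains d where "d > 0"
    "\<And>x. 0 < x \<Longrightarrow> e \<le> \<bar>x - \<xi>0\<bar> \<Longrightarrow> d \<le> (x - \<xi>0) * (x powr (1 / \<nu>) - \<xi>0 powr (1 / \<nu>))"
proof
  \<comment> \<open>Truncation at zero keeps the base of the power nonnegative when \<open>e\<close>
    exceeds \<open>\<xi>0\<close>.\<close>
  define a where "a = max (\<xi>0 - e) 0"
  define d1 where "d1 = (\<xi>0 + e) powr (1 / \<nu>) - \<xi>0 powr (1 / \<nu>)"
  define d2 where "d2 = \<xi>0 powr (1 / \<nu>) - a powr (1 / \<nu>)"
  have "d1 > 0" "d2 > 0"
    using xi0 nu assms unfolding d1_def d2_def a_def by (auto intro!: powr_less_mono2)
  then show "e * min d1 d2 > 0" using assms by simp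
  fix x assume x: "0 < x" "e \<le> \<bar>x - \<xi>0\<bar>"
  show "e * min d1 d2 \<le> (x - \<xi>0) * (x powr (1 / \<nu>) - \<xi>0 powr (1 / \<nu>))"
  proof (cases "\<xi>0 \<le> x")
    case True
    then have "d1 \<le> x powr (1 / \<nu>) - \<xi>0 powr (1 / \<nu>)"
      using x xi0 nu assms unfolding d1_def by (auto intro!: powr_mono2)
    then have "e * min d1 d2 \<le> (x - \<xi>0) * (x powr (1 / \<nu>) - \<xi>0 powr (1 / \<nu>))"
      using True x assms \<open>d1 > 0\<close> \<open>d2 > 0\<close> by (intro mult_mono) auto
    then show ?thesis .
  next
    case False
    then have "d2 \<le> \<xi>0 powr (1 / \<nu>) - x powr (1 / \<nu>)"
      using x xi0 nu assms unfolding d2_def a_def by (auto intro!: powr_mono2)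
    then have "e * min d1 d2 \<le> (\<xi>0 - x) * (\<xi>0 powr (1 / \<nu>) - x powr (1 / \<nu>))"
      using False x assms \<open>d1 > 0\<close> \<open>d2 > 0\<close> by (intro mult_mono) auto
    then show ?thesis by (simp add: algebra_simps)
  qed
qed

lemma xi_tendsto: "(\<xi> \<longlongrightarrow> \<xi>0) at_top"
proof -
  obtain L L' where L: "\<And>t. t \<ge> T \<Longrightarrow> (L has_real_derivative L' t) (at t)"
    "\<And>t. t \<ge> T \<Longrightarrow> L' t \<le> - (\<delta> + \<nu> * n) * ((\<xi> t - \<xi>0) * (\<xi> t powr (1 / \<nu>) - \<xi>0 powr (1 / \<nu>)))"
    "\<And>t. t \<ge> T \<Longrightarrow> \<nu> / ((1 - 1 / \<nu>) * \<alpha>) * (u t - u0 * ln (u t)) \<le> L t"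
    using lyapunov_exists by blast
  obtain M where M: "\<And>t. t \<ge> T \<Longrightarrow> u t \<le> M" using u_bounded by blast
  obtain m where m: "\<And>t. t \<ge> T \<Longrightarrow> m \<le> u t - u0 * ln (u t)" using lyapunov_bounded_below by blast
  have eta: "0 < \<delta> + \<nu> * n" using delta_pos nu n_pos by (simp add: add_pos_pos)
  have diss: "\<exists>d>0. \<forall>t\<ge>T. e \<le> \<bar>\<xi> t - \<xi>0\<bar> \<longrightarrow> L' t \<le> - d" if e: "e > 0" for e
  proof -
    obtain d where d: "d > 0"
      "\<And>x. 0 < x \<Longrightarrow> e \<le> \<bar>x - \<xi>0\<bar> \<Longrightarrow> d \<le> (x - \<xi>0) * (x powr (1 / \<nu>) - \<xi>0 powr (1 / \<nu>))"
      using powr_gap[OF e] by blast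
    show ?thesis
    proof (intro exI conjI allI impI)
      show "0 < (\<delta> + \<nu> * n) * d" using eta d(1) by simp
      fix t assume t: "t \<ge> T" "e \<le> \<bar>\<xi> t - \<xi>0\<bar>"
      have "(\<delta> + \<nu> * n) * d \<le> (\<delta> + \<nu> * n) * ((\<xi> t - \<xi>0) * (\<xi> t powr (1 / \<nu>) - \<xi>0 powr (1 / \<nu>)))"
        using eta d(2)[OF xi(1)[OF t(1)] t(2)] by (intro mult_left_mono) auto
      then show "L' t \<le> - ((\<delta> + \<nu> * n) * d)" using L(2)[OF t(1)] by (simp only: minus_mult_left[symmetric])
    qed
  qed
  have "((\<lambda>t. \<xi> t - \<xi>0) \<longlongrightarrow> 0) at_top"
  proof (rule lyapunov_tendsto_0[OF L(1)])
    fix t assume t: "t \<ge> T"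
    show "\<nu> / ((1 - 1 / \<nu>) * \<alpha>) * m \<le> L t"
    proof -
      have "\<nu> / ((1 - 1 / \<nu>) * \<alpha>) * m \<le> \<nu> / ((1 - 1 / \<nu>) * \<alpha>) * (u t - u0 * ln (u t))"
        using m[OF t] nu theta alpha_pos by (intro mult_left_mono) auto
      then show ?thesis using L(3)[OF t] by simp
    qed
    show "L' t \<le> 0"
    proof (cases "\<xi> t = \<xi>0")
      case True
      then show ?thesis using L(2)[OF t] by simp
    next
      case False
      then show ?thesis using diss[of "\<bar>\<xi> t - \<xi>0\<bar>"] t by force
    qed
    show "((\<lambda>t. \<xi> t - \<xi>0) has_real_derivative
        \<xi> t * (A t * \<xi> t - (\<delta> + \<nu> * n)) + \<nu> * \<xi> t powr (1 - 1 / \<nu>) * u t * (1 - \<xi> t)) (at t)"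
      by (auto intro!: derivative_eq_intros xi_deriv[OF t])
    have "\<bar>\<xi> t * (A t * \<xi> t - (\<delta> + \<nu> * n))\<bar> \<le> 1 * (\<delta> + \<nu> * n)"
    proof -
      have "0 \<le> A t * \<xi> t" using A_gt[OF t] alpha_pos xi(1)[OF t] by simp
      moreover have "A t * \<xi> t \<le> (\<delta> + \<nu> * n) * 1"
        using A_less[OF t] A_gt[OF t] alpha_pos xi[OF t] eta by (intro mult_mono) auto
      ultimately have "\<bar>A t * \<xi> t - (\<delta> + \<nu> * n)\<bar> \<le> \<delta> + \<nu> * n" using eta by auto
      then show ?thesis unfolding abs_mult using xi[OF t] by (intro mult_mono) auto
    qed
    moreover have "\<bar>\<nu> * \<xi> t powr (1 - 1 / \<nu>) * u t * (1 - \<xi> t)\<bar> \<le> \<nu> * 1 * M * 1"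
    proof -
      have "\<xi> t powr (1 - 1 / \<nu>) \<le> 1" using xi[OF t] theta by (intro powr_le1) auto
      then show ?thesis unfolding abs_mult
        using xi[OF t] M[OF t] u_pos[OF t] nu by (intro mult_mono) auto
    qed
    ultimately show "\<bar>\<xi> t * (A t * \<xi> t - (\<delta> + \<nu> * n)) + \<nu> * \<xi> t powr (1 - 1 / \<nu>) * u t * (1 - \<xi> t)\<bar>
        \<le> (\<delta> + \<nu> * n) + \<nu> * M"
      by simp
  qed (use diss in auto)
  then show ?thesis by (simp add: LIM_zero_cancel)
qed

text \<open>The Lyapunov function dissipates only in \<open>\<xi>\<close>, so \<open>u\<close> must
  be recovered from the equation. As \<open>\<xi>\<close> converges, \<open>\<xi>'\<close> differs
  from \<open>k * (u - u0)\<close> by a null term, and \<open>u'\<close> tends to zero because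
  \<open>u\<close> is bounded and \<open>\<delta> - A * \<xi>\<close> tends to zero.\<close>

lemma u_tendsto: "(u \<longlongrightarrow> u0) at_top"
proof -
  define k where "k = \<nu> * \<xi>0 powr (1 - 1 / \<nu>) * (1 - \<xi>0)"
  have k: "k > 0" using xi0 nu by (simp add: k_def)
  obtain M where M: "\<And>t. t \<ge> T \<Longrightarrow> u t \<le> M" using u_bounded by blast
  have ubd: "eventually (\<lambda>t. norm (u t) \<le> M) at_top"
    using eventually_ge_at_top[of T] by eventually_elim (use M u_pos in force)
  have powr_lim: "((\<lambda>t. \<xi> t powr (1 - 1 / \<nu>)) \<longlongrightarrow> \<xi>0 powr (1 - 1 / \<nu>)) at_top"
    using xi0 by (intro tendsto_intros xi_tendsto) auto
  have equilibrium: "\<xi>0 * (\<alpha> * \<xi>0 - (\<delta> + \<nu> * n)) + k * u0 = 0"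
  proof -
    have "\<xi>0 powr (1 - 1 / \<nu>) * \<xi>0 powr (1 / \<nu>) = \<xi>0"
      using xi0 by (simp flip: powr_add)
    moreover have "k * u0 = (\<xi>0 powr (1 - 1 / \<nu>) * \<xi>0 powr (1 / \<nu>)) * (\<delta> + \<nu> * n - \<alpha> * \<xi>0)"
      using xi0(2) nu by (simp add: k_def u0_def isocline_def)
    ultimately show ?thesis by (simp add: algebra_simps)
  qed
  have "((\<lambda>t. k * (u t - u0)) \<longlongrightarrow> 0) at_top"
  proof (rule tendsto_0_of_slow_derivative[OF xi_deriv _ xi_tendsto])
    fix t assume t: "t \<ge> T"
    show "((\<lambda>t. k * (u t - u0)) has_real_derivative k * ((1 - 1 / \<nu>) * u t * (\<delta> - A t * \<xi> t))) (at t)"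
      by (auto intro!: derivative_eq_intros u_deriv[OF t])
  next
    have "((\<lambda>t. \<nu> * \<xi> t powr (1 - 1 / \<nu>) * (1 - \<xi> t) - k) \<longlongrightarrow> k - k) at_top"
      unfolding k_def by (intro tendsto_intros powr_lim xi_tendsto)
    then have "((\<lambda>t. (\<nu> * \<xi> t powr (1 - 1 / \<nu>) * (1 - \<xi> t) - k) * u t) \<longlongrightarrow> 0) at_top"
      by (intro lim_null_mult_right_bounded[OF _ ubd]) simp
    moreover have "((\<lambda>t. \<xi> t * (A t * \<xi> t - (\<delta> + \<nu> * n)) + k * u0) \<longlongrightarrow> 0) at_top"
      unfolding equilibrium[symmetric] by (intro tendsto_intros xi_tendsto A_lim)
    ultimately have "((\<lambda>t. (\<nu> * \<xi> t powr (1 - 1 / \<nu>) * (1 - \<xi> t) - k) * u t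
        + (\<xi> t * (A t * \<xi> t - (\<delta> + \<nu> * n)) + k * u0)) \<longlongrightarrow> 0 + 0) at_top"
      by (rule tendsto_add)
    then show "((\<lambda>t. \<xi> t * (A t * \<xi> t - (\<delta> + \<nu> * n)) + \<nu> * \<xi> t powr (1 - 1 / \<nu>) * u t * (1 - \<xi> t)
        - k * (u t - u0)) \<longlongrightarrow> 0) at_top"
      by (simp add: algebra_simps)
    have "((\<lambda>t. k * (1 - 1 / \<nu>) * (\<delta> - A t * \<xi> t)) \<longlongrightarrow> k * (1 - 1 / \<nu>) * (\<delta> - \<alpha> * \<xi>0)) at_top"
      by (intro tendsto_intros xi_tendsto A_lim)
    then have "((\<lambda>t. k * (1 - 1 / \<nu>) * (\<delta> - A t * \<xi> t) * u t) \<longlongrightarrow> 0) at_top"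
      by (intro lim_null_mult_right_bounded[OF _ ubd]) (simp add: xi0)
    then show "((\<lambda>t. k * ((1 - 1 / \<nu>) * u t * (\<delta> - A t * \<xi> t))) \<longlongrightarrow> 0) at_top"
      by (simp add: mult_ac)
  qed
  then have "((\<lambda>t. k * (u t - u0) / k) \<longlongrightarrow> 0 / k) at_top"
    using k by (intro tendsto_divide tendsto_const) auto
  then show ?thesis using k by (simp add: LIM_zero_cancel)
qed

end

section \<open>Equilibrium at infinity for \<open>\<alpha> = \<delta>\<close>\<close>

locale gause_boundary = gause_system +
  assumes alpha_eq: "\<alpha> = \<delta>"
begin

text \<open>Here \<open>u' = 0\<close> asks for \<open>\<xi> = 1\<close>, where the isocline is
  infinite. The function \<open>c * A - ln u\<close> decreases; were it bounded below,
  \<open>u\<close> would be bounded and \<open>\<xi>\<close> would tend to \<open>1\<close>, but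
  then \<open>\<xi>'\<close> would tend to \<open>- \<nu> * n\<close>, which is impossible for a
  convergent function.\<close>

lemma u_at_top: "filterlim u at_top at_top"
proof -
  \<comment> \<open>The weight at which the decrease of \<open>A\<close> outweighs the term
    \<open>(1 - 1 / \<nu>) * (A - \<delta>) * \<xi>\<close> coming from \<open>ln u\<close>.\<close>
  define c where "c = (1 - 1 / \<nu>) / ((q - 1) * \<delta>)"
  have c: "0 \<le> c" "c * ((q - 1) * \<delta>) = 1 - 1 / \<nu>"
    using theta q delta_pos by (auto simp: c_def)
  define L where "L = (\<lambda>t. c * A t - ln (u t))"
  define L' where "L' = (\<lambda>t. c * (- (q - 1) * (A t - \<alpha>) * (\<alpha> + (A t - \<alpha>) / q) * \<xi> t)
    - (1 - 1 / \<nu>) * (\<delta> - A t * \<xi> t))"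
  have dL: "(L has_real_derivative L' t) (at t)" if t: "t \<ge> T" for t
  proof -
    have "((\<lambda>t. ln (u t)) has_real_derivative (1 - 1 / \<nu>) * (\<delta> - A t * \<xi> t)) (at t)"
      using u_pos[OF t] by (auto intro!: derivative_eq_intros u_deriv[OF t])
    then show ?thesis unfolding L_def L'_def by (intro DERIV_diff DERIV_cmult A_deriv[OF t])
  qed
  have L'_le: "L' t \<le> - ((1 - 1 / \<nu>) * \<delta>) * (1 - \<xi> t)" if t: "t \<ge> T" for t
  proof -
    define B where "B = A t - \<delta>"
    have B: "0 < B" using A_gt[OF t] by (simp add: B_def alpha_eq)
    have "c * ((q - 1) * \<delta>) * (B * \<xi> t) \<le> c * ((q - 1) * (\<delta> + B / q)) * (B * \<xi> t)"
      using c(1) q B xi[OF t] by (intro mult_right_mono mult_left_mono) auto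
    moreover have "L' t = - ((1 - 1 / \<nu>) * \<delta>) * (1 - \<xi> t) + (1 - 1 / \<nu>) * (B * \<xi> t)
        - c * ((q - 1) * (\<delta> + B / q)) * (B * \<xi> t)"
    proof -
      obtain k where k: "\<delta> + (A t - \<delta>) / q = k" by blast
      show ?thesis unfolding L'_def B_def alpha_eq k by (simp add: algebra_simps)
    qed
    ultimately show ?thesis unfolding c(2) by linarith
  qed
  have L'_nonpos: "L' t \<le> 0" if t: "t \<ge> T" for t
  proof -
    have "0 \<le> (1 - 1 / \<nu>) * \<delta> * (1 - \<xi> t)"
      using theta delta_pos xi[OF t] by simp
    then show ?thesis using L'_le[OF t] by simp
  qed
  have dec: "L b \<le> L a" if "T \<le> a" "a \<le> b" for a b
  proof (rule DERIV_nonpos_imp_nonincreasing[OF that(2)])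
    fix x assume "a \<le> x" "x \<le> b"
    then have "T \<le> x" using that by simp
    then show "\<exists>y. (L has_real_derivative y) (at x) \<and> y \<le> 0" using dL L'_nonpos by blast
  qed
  have unbounded: "\<exists>t\<ge>T. L t < m" for m
  proof (rule ccontr)
    assume "\<not> ?thesis"
    then have m: "m \<le> L t" if "t \<ge> T" for t using that by force
    define M where "M = exp (c * (\<delta> + \<nu> * n) - m)"
    have M: "u t \<le> M" if t: "t \<ge> T" for t
    proof -
      have "ln (u t) \<le> c * A t - m" using m[OF t] by (simp add: L_def)
      also have "\<dots> \<le> c * (\<delta> + \<nu> * n) - m"
        using A_less[OF t] c(1) by (simp add: mult_left_mono)
      finally have "exp (ln (u t)) \<le> M" unfolding M_def by simp
      then show ?thesis using u_pos[OF t] by simp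
    qed
    have bound: "\<bar>\<nu> * \<xi> t powr (1 - 1 / \<nu>) * u t\<bar> \<le> \<nu> * M" if t: "t \<ge> T" for t
    proof -
      have "\<xi> t powr (1 - 1 / \<nu>) \<le> 1" using xi[OF t] theta by (intro powr_le1) auto
      then have "\<bar>\<nu> * \<xi> t powr (1 - 1 / \<nu>) * u t\<bar> \<le> \<nu> * 1 * M" unfolding abs_mult
        using xi[OF t] M[OF t] u_pos[OF t] nu by (intro mult_mono) auto
      then show ?thesis by simp
    qed
    have eta: "0 < \<delta> + \<nu> * n" using delta_pos nu n_pos by (simp add: add_pos_pos)
    have "((\<lambda>t. \<xi> t - 1) \<longlongrightarrow> 0) at_top"
    proof (rule lyapunov_tendsto_0[OF dL m L'_nonpos])
      fix t assume t: "t \<ge> T"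
      show "((\<lambda>t. \<xi> t - 1) has_real_derivative
          \<xi> t * (A t * \<xi> t - (\<delta> + \<nu> * n)) + \<nu> * \<xi> t powr (1 - 1 / \<nu>) * u t * (1 - \<xi> t)) (at t)"
        by (auto intro!: derivative_eq_intros xi_deriv[OF t])
      have "\<bar>\<xi> t * (A t * \<xi> t - (\<delta> + \<nu> * n))\<bar> \<le> 1 * (\<delta> + \<nu> * n)"
      proof -
        have "0 \<le> A t * \<xi> t" using A_gt[OF t] alpha_pos xi(1)[OF t] by simp
        moreover have "A t * \<xi> t \<le> (\<delta> + \<nu> * n) * 1"
          using A_less[OF t] A_gt[OF t] alpha_pos xi[OF t] eta by (intro mult_mono) auto
        ultimately have "\<bar>A t * \<xi> t - (\<delta> + \<nu> * n)\<bar> \<le> \<delta> + \<nu> * n" using eta by auto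
        then show ?thesis unfolding abs_mult using xi[OF t] by (intro mult_mono) auto
      qed
      moreover have "\<bar>\<nu> * \<xi> t powr (1 - 1 / \<nu>) * u t * (1 - \<xi> t)\<bar> \<le> \<nu> * M * 1"
        unfolding abs_mult[of _ "1 - \<xi> t"]
        using bound[OF t] xi[OF t] by (intro mult_mono) auto
      ultimately show "\<bar>\<xi> t * (A t * \<xi> t - (\<delta> + \<nu> * n)) + \<nu> * \<xi> t powr (1 - 1 / \<nu>) * u t * (1 - \<xi> t)\<bar>
          \<le> (\<delta> + \<nu> * n) + \<nu> * M"
        by simp
    next
      fix e :: real assume e: "e > 0"
      show "\<exists>d>0. \<forall>t\<ge>T. e \<le> \<bar>\<xi> t - 1\<bar> \<longrightarrow> L' t \<le> - d"
      proof (intro exI conjI allI impI)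
        show "(1 - 1 / \<nu>) * \<delta> * e > 0" using theta delta_pos e by simp
        fix t assume t: "t \<ge> T" "e \<le> \<bar>\<xi> t - 1\<bar>"
        then have "(1 - 1 / \<nu>) * \<delta> * e \<le> (1 - 1 / \<nu>) * \<delta> * (1 - \<xi> t)"
          using theta delta_pos xi[OF t(1)] by (intro mult_left_mono) auto
        then show "L' t \<le> - ((1 - 1 / \<nu>) * \<delta> * e)" using L'_le[OF t(1)] by simp
      qed
    qed
    then have lim: "(\<xi> \<longlongrightarrow> 1) at_top" by (rule LIM_zero_cancel)
    \<comment> \<open>A constant plays the role of the slowly varying function: the limit of
      \<open>\<xi>'\<close> has to be zero.\<close>
    have "((\<lambda>t::real. - \<nu> * n) \<longlongrightarrow> 0) at_top"
    proof (rule tendsto_0_of_slow_derivative[where T = T and f = \<xi> and g' = "\<lambda>_. 0"])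
      show "(\<xi> \<longlongrightarrow> 1) at_top" by (fact lim)
      show "(\<xi> has_real_derivative \<xi> t * (A t * \<xi> t - (\<delta> + \<nu> * n))
        + \<nu> * \<xi> t powr (1 - 1 / \<nu>) * u t * (1 - \<xi> t)) (at t)" if "t \<ge> T" for t
        using xi_deriv[OF that] .
      have "eventually (\<lambda>t. norm (\<nu> * \<xi> t powr (1 - 1 / \<nu>) * u t) \<le> \<nu> * M) at_top"
        using eventually_ge_at_top[of T] by eventually_elim (use bound in simp)
      then have "((\<lambda>t. \<nu> * \<xi> t powr (1 - 1 / \<nu>) * u t * (1 - \<xi> t)) \<longlongrightarrow> 0) at_top"
        by (rule lim_null_mult_left_bounded) (auto intro!: tendsto_eq_intros lim)
      moreover have "((\<lambda>t. \<xi> t * (A t * \<xi> t - (\<delta> + \<nu> * n)) - (- \<nu> * n)) \<longlongrightarrow> 0) at_top"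
        by (auto intro!: tendsto_eq_intros lim A_lim simp: alpha_eq)
      ultimately have "((\<lambda>t. \<nu> * \<xi> t powr (1 - 1 / \<nu>) * u t * (1 - \<xi> t)
         + (\<xi> t * (A t * \<xi> t - (\<delta> + \<nu> * n)) - (- \<nu> * n))) \<longlongrightarrow> 0 + 0) at_top" by (rule tendsto_add)
      then show "((\<lambda>t. \<xi> t * (A t * \<xi> t - (\<delta> + \<nu> * n)) + \<nu> * \<xi> t powr (1 - 1 / \<nu>) * u t * (1 - \<xi> t)
          - - \<nu> * n) \<longlongrightarrow> 0) at_top"
        by (simp add: algebra_simps)
    qed auto
    then show False using nu n_pos by (simp add: tendsto_const_iff)
  qed
  show ?thesis
    unfolding filterlim_at_top
  proof
    fix Z :: real
    obtain s where s: "s \<ge> T" "L s < - Z" using unbounded by blast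
    have "Z \<le> u t" if "t \<ge> s" for t
    proof -
      have t: "t \<ge> T" using s that by simp
      have "0 \<le> c * A t" using c(1) A_gt[OF t] alpha_pos by simp
      then have "Z \<le> ln (u t)" using dec[OF s(1) that] s(2) by (simp add: L_def)
      also have "\<dots> \<le> u t" using ln_le_minus_one[OF u_pos[OF t]] by simp
      finally show ?thesis .
    qed
    then show "eventually (\<lambda>t. Z \<le> u t) at_top" using eventually_at_top_linorder by blast
  qed
qed

text \<open>On \<open>\<xi> \<le> b < 1\<close> the isocline is bounded while \<open>u\<close> tends
  to infinity, so \<open>\<xi>\<close> is driven upwards. Passing to
  \<open>\<xi> powr (1 / \<nu>)\<close> removes the factor \<open>\<xi> powr (1 - 1 / \<nu>)\<close>
  from the derivative, so the drift does not degenerate near \<open>\<xi> = 0\<close>.\<close>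

lemma xi_tendsto_1: "(\<xi> \<longlongrightarrow> 1) at_top"
proof (rule order_tendstoI)
  fix a :: real assume "1 < a"
  show "eventually (\<lambda>t. \<xi> t < a) at_top"
    using eventually_ge_at_top[of T] by eventually_elim (use xi \<open>1 < a\<close> in force)
next
  fix a :: real assume a: "a < 1"
  define b where "b = max a (1 / 2)"
  have b: "a \<le> b" "0 < b" "b < 1" using a by (auto simp: b_def)
  define \<eta> where "\<eta> = \<delta> + \<nu> * n"
  have eta: "0 < \<eta>" using delta_pos nu n_pos by (simp add: \<eta>_def add_pos_pos)
  obtain S where S: "S \<ge> T" "\<And>t. t \<ge> S \<Longrightarrow> \<eta> / (1 - b) + 1 \<le> \<nu> * u t"
  proof -
    have "eventually (\<lambda>t. t \<ge> T \<and> (\<eta> / (1 - b) + 1) / \<nu> \<le> u t) at_top"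
      using u_at_top by (intro eventually_conj eventually_ge_at_top) (auto simp: filterlim_at_top)
    then show thesis using that nu unfolding eventually_at_top_linorder
      by (auto simp: field_simps)
  qed
  have ev: "eventually (\<lambda>t. - (\<xi> t powr (1 / \<nu>)) < - (b powr (1 / \<nu>))) at_top"
  proof (rule eventually_below_barrier)
    fix t assume "t \<ge> S"
    then have t: "t \<ge> T" using S(1) by simp
    have "((\<lambda>t. - (\<xi> t powr (1 / \<nu>))) has_real_derivative - (1 / \<nu> * \<xi> t powr (1 / \<nu> - 1) *
       (\<xi> t powr (1 - 1 / \<nu>) * (1 - \<xi> t) * (\<nu> * u t - isocline (A t) (\<xi> t))))) (at t)"
      using DERIV_minus[OF DERIV_fun_powr[OF xi_deriv'[OF t] xi(1)[OF t], of "1 / \<nu>"]] by simp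
    moreover have "\<xi> t powr (1 / \<nu> - 1) * (\<xi> t powr (1 - 1 / \<nu>)) = 1"
      using xi[OF t] by (simp flip: powr_add)
    then have "- (1 / \<nu> * \<xi> t powr (1 / \<nu> - 1) *
       (\<xi> t powr (1 - 1 / \<nu>) * (1 - \<xi> t) * (\<nu> * u t - isocline (A t) (\<xi> t))))
      = - ((1 - \<xi> t) * (\<nu> * u t - isocline (A t) (\<xi> t)) / \<nu>)"
      using xi[OF t] nu by (simp add: field_simps)
    ultimately show "((\<lambda>t. - (\<xi> t powr (1 / \<nu>))) has_real_derivative
        - ((1 - \<xi> t) * (\<nu> * u t - isocline (A t) (\<xi> t)) / \<nu>)) (at t)" by (simp only:)
  next
    show "0 < (1 - b) * 1 / \<nu>" using b nu by simp
  next
    fix t assume t': "t \<ge> S" and "- (b powr (1 / \<nu>)) \<le> - (\<xi> t powr (1 / \<nu>))"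
    then have t: "t \<ge> T" using S(1) by simp
    have le: "\<xi> t \<le> b"
    proof (rule ccontr)
      assume "\<not> ?thesis"
      then have "b powr (1 / \<nu>) < \<xi> t powr (1 / \<nu>)" using b nu by (intro powr_less_mono2) auto
      then show False using \<open>- (b powr (1 / \<nu>)) \<le> - (\<xi> t powr (1 / \<nu>))\<close> by simp
    qed
    have "isocline (A t) (\<xi> t) \<le> 1 * (\<eta> / (1 - b))"
    proof -
      have "0 \<le> A t * \<xi> t" using A_gt[OF t] alpha_pos xi(1)[OF t] by simp
      moreover have "A t * \<xi> t \<le> \<eta> * 1"
        using A_less[OF t] A_gt[OF t] alpha_pos xi[OF t] eta by (intro mult_mono) (auto simp: \<eta>_def)
      ultimately show ?thesis unfolding isocline_def \<eta>_def[symmetric]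
        using xi[OF t] le b nu eta by (intro mult_mono frac_le powr_le1) auto
    qed
    then have "1 \<le> \<nu> * u t - isocline (A t) (\<xi> t)" using S(2)[OF t'] by simp
    then have "(1 - b) * 1 \<le> (1 - \<xi> t) * (\<nu> * u t - isocline (A t) (\<xi> t))"
      using le b by (intro mult_mono) auto
    then show "- ((1 - \<xi> t) * (\<nu> * u t - isocline (A t) (\<xi> t)) / \<nu>) \<le> - ((1 - b) * 1 / \<nu>)"
      using nu by (simp add: divide_right_mono)
  qed
  have imp: "a < \<xi> t" if "- (\<xi> t powr (1 / \<nu>)) < - (b powr (1 / \<nu>))" "t \<ge> T" for t
  proof (rule ccontr)
    assume "\<not> ?thesis"
    then have "\<xi> t powr (1 / \<nu>) \<le> b powr (1 / \<nu>)"
      using b nu xi[OF that(2)] by (intro powr_mono2) auto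
    then show False using that by simp
  qed
  show "eventually (\<lambda>t. a < \<xi> t) at_top"
    using ev eventually_ge_at_top[of T] by eventually_elim (rule imp)
qed

text \<open>The width \<open>1 - \<xi>\<close> of the boundary layer is asymptotically
  \<open>n / u\<close>. The product \<open>g\<close> satisfies
  \<open>g' = u * (P - \<nu> * \<xi> powr (1 - 1 / \<nu>) * g)\<close> with \<open>P\<close> tending
  to \<open>\<nu> * n\<close>; the large factor \<open>u\<close> makes it relax to
  \<open>n\<close>.\<close>

lemma flux_tendsto: "((\<lambda>t. u t * (1 - \<xi> t)) \<longlongrightarrow> n) at_top"
proof -
  define P where "P = (\<lambda>t. \<xi> t * (\<delta> + \<nu> * n - A t * \<xi> t) + (1 - 1 / \<nu>) * (1 - \<xi> t) * (\<delta> - A t * \<xi> t))"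
  define g where "g = (\<lambda>t. u t * (1 - \<xi> t))"
  define g' where "g' = (\<lambda>t. u t * (P t - \<nu> * \<xi> t powr (1 - 1 / \<nu>) * g t))"
  have dg: "(g has_real_derivative g' t) (at t)" if "t \<ge> T" for t
  proof -
    obtain \<theta> where \<theta>: "1 - 1 / \<nu> = \<theta>" by blast
    show ?thesis
      unfolding g_def g'_def P_def \<theta>
      by (rule derivative_eq_intros refl xi_deriv[OF that, unfolded \<theta>] u_deriv[OF that, unfolded \<theta>])+
         (simp add: algebra_simps)
  qed
  have Plim: "(P \<longlongrightarrow> \<nu> * n) at_top"
  proof -
    have "(P \<longlongrightarrow> 1 * (\<delta> + \<nu> * n - \<alpha> * 1) + (1 - 1 / \<nu>) * (1 - 1) * (\<delta> - \<alpha> * 1)) at_top"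
      unfolding P_def by (intro tendsto_intros xi_tendsto_1 A_lim)
    then show ?thesis by (simp add: alpha_eq)
  qed
  have powr_lim: "((\<lambda>t. \<xi> t powr (1 - 1 / \<nu>)) \<longlongrightarrow> 1) at_top"
    using tendsto_powr[OF xi_tendsto_1 tendsto_const[of "1 - 1 / \<nu>"]] by simp
  have Qlim: "((\<lambda>t. P t - \<nu> * \<xi> t powr (1 - 1 / \<nu>) * b) \<longlongrightarrow> \<nu> * (n - b)) at_top" for b
  proof -
    have "((\<lambda>t. P t - \<nu> * \<xi> t powr (1 - 1 / \<nu>) * b) \<longlongrightarrow> \<nu> * n - \<nu> * 1 * b) at_top"
      by (intro tendsto_diff tendsto_mult tendsto_const Plim powr_lim)
    then show ?thesis by (simp add: algebra_simps)
  qed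
  have u1: "eventually (\<lambda>t. 1 \<le> u t) at_top" using u_at_top by (simp add: filterlim_at_top)
  have nonneg: "0 \<le> \<nu> * \<xi> t powr (1 - 1 / \<nu>)" for t using nu by simp
  have "(g \<longlongrightarrow> n) at_top"
  proof (rule order_tendstoI)
    fix b assume b: "n < b"
    have neg: "\<nu> * (n - b) < \<nu> * (n - b) / 2" using b nu by (simp add: mult_less_0_iff)
    have "eventually (\<lambda>t. t \<ge> T \<and> 1 \<le> u t \<and> P t - \<nu> * \<xi> t powr (1 - 1 / \<nu>) * b < \<nu> * (n - b) / 2) at_top"
      by (intro eventually_conj eventually_ge_at_top u1 order_tendstoD(2)[OF Qlim neg])
    then obtain S where S: "\<And>t. t \<ge> S \<Longrightarrow> t \<ge> T" "\<And>t. t \<ge> S \<Longrightarrow> 1 \<le> u t"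
      "\<And>t. t \<ge> S \<Longrightarrow> P t - \<nu> * \<xi> t powr (1 - 1 / \<nu>) * b < \<nu> * (n - b) / 2"
      unfolding eventually_at_top_linorder by blast
    show "eventually (\<lambda>t. g t < b) at_top"
    proof (rule eventually_below_barrier)
      show "(g has_real_derivative g' t) (at t)" if "t \<ge> S" for t using dg S(1)[OF that] by simp
      show "0 < \<nu> * (b - n) / 2" using b nu by simp
      fix t assume t: "t \<ge> S" "b \<le> g t"
      have "P t - \<nu> * \<xi> t powr (1 - 1 / \<nu>) * g t \<le> P t - \<nu> * \<xi> t powr (1 - 1 / \<nu>) * b"
        using mult_left_mono[OF t(2) nonneg] by simp
      also have "\<dots> \<le> \<nu> * (n - b) / 2" using S(3)[OF t(1)] by simp
      also have "\<dots> = - (\<nu> * (b - n) / 2)" by (simp add: field_simps)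
      finally have le: "P t - \<nu> * \<xi> t powr (1 - 1 / \<nu>) * g t \<le> - (\<nu> * (b - n) / 2)" .
      have "g' t \<le> u t * (- (\<nu> * (b - n) / 2))"
        unfolding g'_def using le S(2)[OF t(1)] by (intro mult_left_mono) auto
      also have "\<dots> \<le> 1 * (- (\<nu> * (b - n) / 2))"
        using S(2)[OF t(1)] b nu by (intro mult_right_mono_neg) auto
      finally show "g' t \<le> - (\<nu> * (b - n) / 2)" by simp
    qed
  next
    fix b assume b: "b < n"
    have pos: "\<nu> * (n - b) / 2 < \<nu> * (n - b)" using b nu by simp
    have "eventually (\<lambda>t. t \<ge> T \<and> 1 \<le> u t \<and> \<nu> * (n - b) / 2 < P t - \<nu> * \<xi> t powr (1 - 1 / \<nu>) * b) at_top"
      by (intro eventually_conj eventually_ge_at_top u1 order_tendstoD(1)[OF Qlim pos])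
    then obtain S where S: "\<And>t. t \<ge> S \<Longrightarrow> t \<ge> T" "\<And>t. t \<ge> S \<Longrightarrow> 1 \<le> u t"
      "\<And>t. t \<ge> S \<Longrightarrow> \<nu> * (n - b) / 2 < P t - \<nu> * \<xi> t powr (1 - 1 / \<nu>) * b"
      unfolding eventually_at_top_linorder by blast
    have "eventually (\<lambda>t. - g t < - b) at_top"
    proof (rule eventually_below_barrier)
      show "((\<lambda>t. - g t) has_real_derivative - g' t) (at t)" if "t \<ge> S" for t
        using dg S(1)[OF that] by (auto intro!: derivative_intros)
      show "0 < \<nu> * (n - b) / 2" using b nu by simp
      fix t assume t: "t \<ge> S" "- b \<le> - g t"
      have "P t - \<nu> * \<xi> t powr (1 - 1 / \<nu>) * b \<le> P t - \<nu> * \<xi> t powr (1 - 1 / \<nu>) * g t"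
        using mult_left_mono[of "g t" b, OF _ nonneg] t(2) by simp
      then have le: "\<nu> * (n - b) / 2 \<le> P t - \<nu> * \<xi> t powr (1 - 1 / \<nu>) * g t"
        using S(3)[OF t(1)] by simp
      have "1 * (\<nu> * (n - b) / 2) \<le> g' t"
        unfolding g'_def using le S(2)[OF t(1)] b nu by (intro mult_mono) auto
      then show "- g' t \<le> - (\<nu> * (n - b) / 2)" by simp
    qed
    then show "eventually (\<lambda>t. b < g t) at_top" by simp
  qed
  then show ?thesis unfolding g_def .
qed

text \<open>The logarithmic derivative of \<open>u\<close> tends to \<open>0\<close> and that of
  \<open>A - \<alpha>\<close> to \<open>- (q - 1) * \<delta>\<close>, so the perturbation decays
  faster than \<open>u\<close> grows.\<close>

lemma perturbation_tendsto_0: "((\<lambda>t. (A t - \<alpha>) * u t) \<longlongrightarrow> 0) at_top"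
proof -
  define z where "z = (\<lambda>t. (A t - \<alpha>) * u t)"
  define r where "r = (\<lambda>t. (1 - 1 / \<nu>) * (\<delta> - A t * \<xi> t) - (q - 1) * (\<alpha> + (A t - \<alpha>) / q) * \<xi> t)"
  have dz: "(z has_real_derivative z t * r t) (at t)" if "t \<ge> T" for t
  proof -
    obtain \<theta> where \<theta>: "1 - 1 / \<nu> = \<theta>" by blast
    obtain k where k: "\<alpha> + (A t - \<alpha>) / q = k" by blast
    show ?thesis
      unfolding z_def r_def \<theta> k
      by (rule derivative_eq_intros refl A_deriv[OF that, unfolded k] u_deriv[OF that, unfolded \<theta>])+
         (simp add: algebra_simps)
  qed
  have zpos: "0 < z t" if "t \<ge> T" for t using A_gt[OF that] u_pos[OF that] by (simp add: z_def)
  have "(r \<longlongrightarrow> (1 - 1 / \<nu>) * (\<delta> - \<alpha> * 1) - (q - 1) * (\<alpha> + (\<alpha> - \<alpha>) / q) * 1) at_top"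
    unfolding r_def using q by (intro tendsto_intros A_lim xi_tendsto_1) auto
  then have rlim: "(r \<longlongrightarrow> - ((q - 1) * \<delta>)) at_top" by (simp add: alpha_eq)
  define k where "k = (q - 1) * \<delta> / 2"
  have k: "0 < k" "- ((q - 1) * \<delta>) < - k" using q delta_pos by (auto simp: k_def)
  have "eventually (\<lambda>t. t \<ge> T \<and> r t < - k) at_top"
    by (intro eventually_conj eventually_ge_at_top order_tendstoD(2)[OF rlim k(2)])
  then obtain S where S: "\<And>t. t \<ge> S \<Longrightarrow> t \<ge> T" "\<And>t. t \<ge> S \<Longrightarrow> r t < - k"
    unfolding eventually_at_top_linorder by blast
  have "(z \<longlongrightarrow> 0) at_top"
  proof (rule order_tendstoI)
    fix a :: real assume "a < 0"
    show "eventually (\<lambda>t. a < z t) at_top"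
      using eventually_ge_at_top[of T] by eventually_elim (use zpos \<open>a < 0\<close> in force)
  next
    fix a :: real assume a: "0 < a"
    show "eventually (\<lambda>t. z t < a) at_top"
    proof (rule eventually_below_barrier[OF dz[OF S(1)]])
      show "0 < a * k" using a k by simp
      fix t assume t: "t \<ge> S" "a \<le> z t"
      have "a * k \<le> z t * (- r t)"
        using t(2) S(2)[OF t(1)] a k by (intro mult_mono) auto
      then show "z t * r t \<le> - (a * k)" by simp
    qed
  qed
  then show ?thesis unfolding z_def .
qed

text \<open>By the two preceding limits \<open>u'\<close> converges, and l'Hospital's rule applies.
  As \<open>t\<close> is \<open>ln r\<close> in the application, this growth is the origin of the
  logarithmic factor.\<close>

lemma u_linear_growth: "((\<lambda>t. u t / t) \<longlongrightarrow> (1 - 1 / \<nu>) * \<delta> * n) at_top"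
proof -
  have "((\<lambda>t. (1 - 1 / \<nu>) * (\<delta> * (u t * (1 - \<xi> t)) - ((A t - \<alpha>) * u t) * \<xi> t)) \<longlongrightarrow>
      (1 - 1 / \<nu>) * (\<delta> * n - 0 * 1)) at_top"
    by (intro tendsto_intros flux_tendsto perturbation_tendsto_0 xi_tendsto_1)
  moreover have "(1 - 1 / \<nu>) * (\<delta> * (u t * (1 - \<xi> t)) - ((A t - \<alpha>) * u t) * \<xi> t)
      = (1 - 1 / \<nu>) * u t * (\<delta> - A t * \<xi> t)" for t
    by (simp add: alpha_eq algebra_simps)
  ultimately have lim: "((\<lambda>t. (1 - 1 / \<nu>) * u t * (\<delta> - A t * \<xi> t) / 1) \<longlongrightarrow> (1 - 1 / \<nu>) * \<delta> * n) at_top"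
    by (simp only: div_by_1 mult_zero_left diff_zero mult.assoc)
  show ?thesis
  proof (rule lhospital_at_top_at_top[OF _ _ _ _ lim])
    show "filterlim (\<lambda>x::real. x) at_top at_top" by (rule filterlim_ident)
    show "eventually (\<lambda>x. (u has_real_derivative (1 - 1 / \<nu>) * u x * (\<delta> - A x * \<xi> x)) (at x)) at_top"
      using eventually_ge_at_top[of T] by eventually_elim (rule u_deriv)
  qed auto
qed

end

section \<open>The asymptotically autonomous system\<close>

text \<open>\<open>slow_decay\<close> carries over what the radial energy says:
  \<open>y Y + y^2\<close> is \<open>r^(2 \<delta>) (w |w'|^(p - 1) / r + w^2)\<close>, and
  \<open>l\<close> is \<open>\<mu> - 2 \<delta>\<close>.\<close>

locale emden_system =
  fixes \<nu> \<delta> n \<alpha> q l c :: real and y Y h :: "real \<Rightarrow> real"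
  assumes nu: "1 < \<nu>" and delta_pos: "0 < \<delta>" and n_pos: "0 < n" and alpha_ge: "\<delta> \<le> \<alpha>" and q: "1 < q"
    and y_pos: "\<And>t. 0 < y t" and Y_pos: "\<And>t. 0 < Y t" and h_pos: "\<And>t. 0 < h t"
    and h_lim: "(h \<longlongrightarrow> 0) at_top"
    and y_deriv: "\<And>t. (y has_real_derivative \<delta> * y t - Y t powr \<nu>) (at t)"
    and Y_deriv: "\<And>t. (Y has_real_derivative - n * Y t - Y t powr \<nu> + (\<alpha> + h t) * y t) (at t)"
    and h_deriv: "\<And>t. (h has_real_derivative - (q - 1) * h t * (Y t powr \<nu> / y t)) (at t)"
    and c_pos: "0 < c"
    and slow_decay: "\<And>t. t \<ge> 0 \<Longrightarrow> c * exp (- l * t) \<le> y t * Y t + (y t)\<^sup>2"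
begin

lemma alpha_pos: "0 < \<alpha>" using delta_pos alpha_ge by simp

lemma alpha_h_pos: "0 < \<alpha> + h t" using alpha_pos h_pos[of t] by simp

text \<open>In the application \<open>h = w^(q - 1)\<close>, so that \<open>\<xi> = r |w'| / (\<alpha> w + w^q)\<close>. With these variables the
  perturbation \<open>h\<close> enters only through the decreasing coefficient \<open>A\<close>.\<close>

definition "source t = (\<alpha> + h t) * y t"
definition "\<xi> t = Y t powr \<nu> / source t"
definition "u t = source t powr (1 - 1 / \<nu>)"
definition "A t = \<alpha> + q * h t"

lemma source_pos: "0 < source t" using alpha_h_pos y_pos by (simp add: source_def)

lemma xi_pos: "0 < \<xi> t" using source_pos[of t] Y_pos[of t] by (simp add: \<xi>_def)

lemma u_pos: "0 < u t" using source_pos[of t] by (simp add: u_def)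

lemma powr_nu_eq: "Y t powr \<nu> = \<xi> t * source t"
  using source_pos[of t] by (simp add: \<xi>_def)

lemma A_lim: "(A \<longlongrightarrow> \<alpha>) at_top"
proof -
  have "(A \<longlongrightarrow> \<alpha> + q * 0) at_top" unfolding A_def by (intro tendsto_intros h_lim)
  then show ?thesis by simp
qed

text \<open>The decrease of \<open>h\<close> contributes a further \<open>(q - 1) * h\<close> to the
  coefficient \<open>\<alpha> + h\<close> of \<open>Y powr \<nu>\<close>. This is the origin of the
  factor \<open>q\<close> in \<open>A\<close>.\<close>

lemma source_deriv: "(source has_real_derivative source t * (\<delta> - A t * \<xi> t)) (at t)"
proof -
  have eq: "- (q - 1) * h t * (Y t powr \<nu> / y t) * y t + (\<delta> * y t - Y t powr \<nu>) * (\<alpha> + h t)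
      = source t * (\<delta> - A t * \<xi> t)"
  proof -
    have "- (q - 1) * h t * (Y t powr \<nu> / y t) * y t = - (q - 1) * h t * Y t powr \<nu>"
      using y_pos[of t] by simp
    moreover have "source t * (\<delta> - A t * \<xi> t) = \<delta> * source t - A t * Y t powr \<nu>"
      unfolding powr_nu_eq by (simp add: algebra_simps)
    ultimately show ?thesis by (simp add: source_def A_def algebra_simps)
  qed
  show ?thesis
    unfolding source_def[abs_def] using eq[unfolded source_def]
    by (auto intro!: derivative_eq_intros h_deriv y_deriv)
qed

lemma u_deriv: "(u has_real_derivative (1 - 1 / \<nu>) * u t * (\<delta> - A t * \<xi> t)) (at t)"
proof -
  obtain \<theta> where \<theta>: "1 - 1 / \<nu> = \<theta>" by blast
  have "(u has_real_derivative \<theta> * source t powr (\<theta> - 1) * (source t * (\<delta> - A t * \<xi> t))) (at t)"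
    unfolding u_def[abs_def] \<theta> using DERIV_fun_powr[OF source_deriv source_pos, of \<theta> t] by simp
  then show ?thesis
    unfolding u_def \<theta> powr_minus_one_mult[OF source_pos, of t \<theta>, symmetric] by (simp add: mult_ac)
qed

lemma powr_nu_deriv:
  assumes "(Y has_real_derivative Z) (at t)"
  shows "((\<lambda>t. Y t powr \<nu>) has_real_derivative \<nu> * Y t powr (\<nu> - 1) * Z) (at t)"
  using DERIV_fun_powr[OF assms Y_pos, of \<nu>] by simp

lemma powr_nu_split: "Y t powr \<nu> = Y t powr (\<nu> - 1) * Y t"
  using Y_pos[of t] by (simp add: powr_diff)

lemma xi_deriv: "(\<xi> has_real_derivative
   \<xi> t * (A t * \<xi> t - (\<delta> + \<nu> * n)) + \<nu> * \<xi> t powr (1 - 1 / \<nu>) * u t * (1 - \<xi> t)) (at t)"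
proof -
  \<comment> \<open>The exponent defining \<open>u\<close> is chosen for this identity, which
    expresses the nonlinear rate \<open>Y powr (\<nu> - 1)\<close> in the new variables.\<close>
  have s: "\<xi> t powr (1 - 1 / \<nu>) * u t = Y t powr (\<nu> - 1)"
  proof -
    have "\<xi> t powr (1 - 1 / \<nu>) * u t = (Y t powr \<nu>) powr (1 - 1 / \<nu>)"
      unfolding u_def powr_nu_eq using xi_pos[of t] source_pos[of t] by (simp add: powr_mult)
    also have "\<dots> = Y t powr (\<nu> * (1 - 1 / \<nu>))" by (simp add: powr_powr)
    also have "\<nu> * (1 - 1 / \<nu>) = \<nu> - 1" using nu by (simp add: field_simps)
    finally show ?thesis .
  qed
  define Z where "Z = - n * Y t - Y t powr \<nu> + source t"
  have "(Y has_real_derivative Z) (at t)" using Y_deriv[of t] by (simp add: Z_def source_def)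
  note dX = powr_nu_deriv[OF this]
  have "(\<xi> has_real_derivative (\<nu> * Y t powr (\<nu> - 1) * Z * source t - Y t powr \<nu> * (source t * (\<delta> - A t * \<xi> t)))
      / (source t * source t)) (at t)"
    unfolding \<xi>_def[abs_def] using source_pos[of t] by (intro DERIV_divide dX source_deriv[unfolded \<xi>_def]) auto
  moreover have "(\<nu> * Y t powr (\<nu> - 1) * Z * source t - Y t powr \<nu> * (source t * (\<delta> - A t * \<xi> t))) / (source t * source t)
      = \<nu> * (Y t powr (\<nu> - 1) * Z / source t) - \<xi> t * (\<delta> - A t * \<xi> t)"
    using source_pos[of t] unfolding powr_nu_eq by (simp add: field_simps)
  moreover have "Y t powr (\<nu> - 1) * Z / source t = - n * \<xi> t + Y t powr (\<nu> - 1) * (1 - \<xi> t)"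
  proof -
    have "Y t powr (\<nu> - 1) * Z = - n * (\<xi> t * source t) + Y t powr (\<nu> - 1) * (source t - \<xi> t * source t)"
      unfolding Z_def powr_nu_eq[symmetric] by (simp add: powr_nu_split algebra_simps)
    then show ?thesis using source_pos[of t] by (simp add: field_simps)
  qed
  moreover have "\<nu> * (- n * \<xi> t + Y t powr (\<nu> - 1) * (1 - \<xi> t)) - \<xi> t * (\<delta> - A t * \<xi> t)
      = \<xi> t * (A t * \<xi> t - (\<delta> + \<nu> * n)) + \<nu> * \<xi> t powr (1 - 1 / \<nu>) * u t * (1 - \<xi> t)"
    unfolding s[symmetric] by (simp add: algebra_simps)
  ultimately show ?thesis by (simp only:)
qed

lemma A_deriv: "(A has_real_derivative - (q - 1) * (A t - \<alpha>) * (\<alpha> + (A t - \<alpha>) / q) * \<xi> t) (at t)"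
proof -
  have "(A has_real_derivative q * (- (q - 1) * h t * (Y t powr \<nu> / y t))) (at t)"
    unfolding A_def[abs_def] by (rule derivative_eq_intros refl h_deriv)+ simp
  moreover have "Y t powr \<nu> / y t = (\<alpha> + h t) * \<xi> t"
    unfolding powr_nu_eq using y_pos[of t] by (simp add: source_def)
  ultimately show ?thesis using q by (simp add: A_def mult_ac)
qed

text \<open>As long as \<open>\<xi> \<ge> 1\<close> the orbit decays as fast as the stable direction at the origin,
  which the lower bound \<open>slow_decay\<close> excludes.\<close>

lemma eventually_gause_region:
  assumes less: "\<alpha> < \<delta> + \<nu> * n" and l: "l < (1 + \<nu>) * n"
  obtains T where "gause_system \<nu> \<delta> n \<alpha> q T \<xi> u A"
proof -
  obtain T0 where T0: "\<And>t. t \<ge> T0 \<Longrightarrow> A t < \<delta> + \<nu> * n"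
    using order_tendstoD(2)[OF A_lim less] unfolding eventually_at_top_linorder by blast
  have "\<exists>T\<ge>max T0 0. \<xi> T < 1"
  proof (rule ccontr)
    assume "\<not> ?thesis"
    then have ge: "1 \<le> \<xi> t" if "t \<ge> max T0 0" for t using that by force
    define S where "S = max T0 0"
    define K where "K = Y S * exp (n * S)"
    have K: "K > 0" using Y_pos by (simp add: K_def)
    have YK: "Y t \<le> K * exp (- n * t)" if "t \<ge> S" for t
      unfolding K_def
    proof (rule exp_decay_bound[OF Y_deriv _ that])
      fix s assume "s \<ge> S"
      then have "1 * source s \<le> Y s powr \<nu>"
        unfolding powr_nu_eq using ge[of s] source_pos[of s] by (intro mult_right_mono) (auto simp: S_def)
      then show "- n * Y s - Y s powr \<nu> + (\<alpha> + h s) * y s \<le> - n * Y s" by (simp add: source_def)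
    qed
    \<comment> \<open>While \<open>\<xi> \<ge> 1\<close>,
      \<open>\<alpha> * y \<le> Y powr \<nu>\<close>. So the two terms bounded by
      \<open>slow_decay\<close> are at most \<open>Y^(1 + \<nu>) / \<alpha>\<close> and
      \<open>Y^(2 \<nu>) / \<alpha>^2\<close>, and the first has the slower exponential bound
      because \<open>\<nu> > 1\<close>.\<close>
    define C where "C = K powr (1 + \<nu>) / \<alpha> + K powr (2 * \<nu>) / \<alpha>\<^sup>2"
    show False
    proof (rule exp_not_dominated[OF c_pos l])
      fix t assume t: "t \<ge> S"
      have t0: "0 \<le> t" using t by (simp add: S_def)
      have "\<alpha> * y t \<le> source t" using h_pos[of t] y_pos[of t] by (simp add: source_def algebra_simps)
      also have "\<dots> \<le> Y t powr \<nu>"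
        unfolding powr_nu_eq using ge[of t] t source_pos[of t] by (simp add: S_def)
      finally have y: "y t \<le> Y t powr \<nu> / \<alpha>" using alpha_pos by (simp add: field_simps)
      have pw: "Y t powr a \<le> K powr a * exp (- (a * n) * t)" if "0 < a" for a
      proof -
        have "Y t powr a \<le> (K * exp (- n * t)) powr a"
          using YK[OF t] Y_pos[of t] that by (intro powr_mono2) auto
        also have "\<dots> = K powr a * exp (- (a * n) * t)"
          using K by (simp add: powr_mult exp_powr_real mult_ac)
        finally show ?thesis .
      qed
      have "y t * Y t \<le> Y t powr \<nu> / \<alpha> * Y t"
        using y Y_pos[of t] by (intro mult_right_mono) auto
      also have "\<dots> = Y t powr (1 + \<nu>) / \<alpha>"
        using Y_pos[of t] by (simp add: powr_add)
      also have "\<dots> \<le> K powr (1 + \<nu>) * exp (- ((1 + \<nu>) * n) * t) / \<alpha>"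
        using pw[of "1 + \<nu>"] nu alpha_pos by (intro divide_right_mono) auto
      finally have 1: "y t * Y t \<le> K powr (1 + \<nu>) / \<alpha> * exp (- ((1 + \<nu>) * n) * t)" by simp
      have "(y t)\<^sup>2 \<le> (Y t powr \<nu> / \<alpha>)\<^sup>2"
        using y y_pos[of t] by (intro power_mono) auto
      also have "\<dots> = Y t powr (2 * \<nu>) / \<alpha>\<^sup>2"
        by (simp add: power_divide power2_eq_square flip: powr_add)
      also have "\<dots> \<le> K powr (2 * \<nu>) * exp (- (2 * \<nu> * n) * t) / \<alpha>\<^sup>2"
        using pw[of "2 * \<nu>"] nu by (intro divide_right_mono) auto
      also have "\<dots> \<le> K powr (2 * \<nu>) * exp (- ((1 + \<nu>) * n) * t) / \<alpha>\<^sup>2"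
      proof -
        have "(1 + \<nu>) * n * t \<le> 2 * \<nu> * n * t"
          using nu n_pos t0 by (intro mult_right_mono) auto
        then show ?thesis by (intro divide_right_mono mult_left_mono) auto
      qed
      finally have 2: "(y t)\<^sup>2 \<le> K powr (2 * \<nu>) / \<alpha>\<^sup>2 * exp (- ((1 + \<nu>) * n) * t)" by simp
      show "c * exp (- l * t) \<le> C * exp (- ((1 + \<nu>) * n) * t)"
        using slow_decay[OF t0] 1 2 unfolding C_def distrib_right by linarith
    qed
  qed
  then obtain T where T: "T \<ge> T0" "\<xi> T < 1" by auto
  \<comment> \<open>The line \<open>\<xi> = 1\<close> can only be crossed downwards: there
    \<open>\<xi>'\<close> equals \<open>A - (\<delta> + \<nu> * n)\<close>.\<close>
  have "\<xi> t < 1" if "t \<ge> T" for t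
  proof (rule stays_below[OF xi_deriv T(2) _ that])
    fix t assume "T \<le> t" "\<xi> t = 1"
    then show "\<xi> t * (A t * \<xi> t - (\<delta> + \<nu> * n)) + \<nu> * \<xi> t powr (1 - 1 / \<nu>) * u t * (1 - \<xi> t) < 0"
      using T0[of t] T(1) by simp
  qed
  then have "gause_system \<nu> \<delta> n \<alpha> q T \<xi> u A"
    using nu delta_pos n_pos alpha_ge q xi_pos u_pos T0 T(1) A_lim xi_deriv u_deriv A_deriv h_pos
    by unfold_locales (auto simp: A_def)
  then show thesis by (rule that)
qed

lemma y_eq: "y t = u t powr (1 / (1 - 1 / \<nu>)) / (\<alpha> + h t)"
proof -
  define \<theta> where "\<theta> = 1 - 1 / \<nu>"
  have "\<theta> \<noteq> 0" using nu by (simp add: \<theta>_def field_simps)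
  then have "u t powr (1 / \<theta>) = source t"
    using source_pos[of t] by (simp add: u_def powr_powr flip: \<theta>_def)
  then show ?thesis using alpha_h_pos[of t] by (simp add: source_def flip: \<theta>_def)
qed

lemma tendsto_of_alpha_less:
  assumes "\<delta> < \<alpha>" "\<alpha> < \<delta> + \<nu> * n" "l < (1 + \<nu>) * n"
  shows "(y \<longlongrightarrow> (\<delta> powr (1 / \<nu>) * (n / (\<alpha> - \<delta>))) powr (1 / (1 - 1 / \<nu>))) at_top"
proof -
  obtain T where "gause_system \<nu> \<delta> n \<alpha> q T \<xi> u A" using eventually_gause_region[OF assms(2,3)] .
  then interpret G: gause_system \<nu> \<delta> n \<alpha> q T \<xi> u A .
  interpret G: gause_interior \<nu> \<delta> n \<alpha> q T \<xi> u A by unfold_locales (fact assms(1))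
  define \<theta> where "\<theta> = 1 - 1 / \<nu>"
  have \<theta>: "0 < \<theta>" using G.theta by (simp add: \<theta>_def)
  define g where "g = \<delta> powr (1 / \<nu>) * (n / (\<alpha> - \<delta>))"
  have g: "0 < g" using delta_pos n_pos assms(1) by (simp add: g_def)
  have u0: "G.u0 = \<alpha> powr \<theta> * g"
  proof -
    have "G.u0 = (\<delta> / \<alpha>) powr (1 / \<nu>) * (n / (1 - \<delta> / \<alpha>))"
      using nu alpha_pos by (simp add: G.u0_def G.isocline_def G.xi0(3)) (simp add: G.\<xi>0_def)
    also have "\<dots> = \<delta> powr (1 / \<nu>) / \<alpha> powr (1 / \<nu>) * (\<alpha> * (n / (\<alpha> - \<delta>)))"
      using alpha_pos delta_pos assms(1) by (simp add: powr_divide field_simps)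
    also have "\<dots> = (\<alpha> powr 1 / \<alpha> powr (1 / \<nu>)) * g"
      using alpha_pos by (simp add: g_def)
    finally show ?thesis unfolding \<theta>_def powr_diff .
  qed
  have "((\<lambda>t. u t powr (1 / \<theta>) / (\<alpha> + h t)) \<longlongrightarrow> G.u0 powr (1 / \<theta>) / (\<alpha> + 0)) at_top"
    using alpha_pos G.u0_pos by (intro tendsto_intros G.u_tendsto h_lim) auto
  moreover have "G.u0 powr (1 / \<theta>) / (\<alpha> + 0) = g powr (1 / \<theta>)"
    unfolding u0 using \<theta> alpha_pos g by (simp add: powr_mult powr_powr)
  ultimately show ?thesis
    unfolding g_def \<theta>_def y_eq[abs_def, symmetric] by simp
qed

lemma tendsto_of_alpha_eq:
  assumes "\<alpha> = \<delta>" "l < (1 + \<nu>) * n"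
  shows "((\<lambda>t. t powr (- 1 / (1 - 1 / \<nu>)) * y t) \<longlongrightarrow>
    ((1 - 1 / \<nu>) * \<delta> powr (1 / \<nu>) * n) powr (1 / (1 - 1 / \<nu>))) at_top"
proof -
  have less: "\<alpha> < \<delta> + \<nu> * n" using assms(1) nu n_pos by simp
  obtain T where "gause_system \<nu> \<delta> n \<alpha> q T \<xi> u A" using eventually_gause_region[OF less assms(2)] .
  then interpret G: gause_system \<nu> \<delta> n \<alpha> q T \<xi> u A .
  interpret G: gause_boundary \<nu> \<delta> n \<alpha> q T \<xi> u A by unfold_locales (fact assms(1))
  define \<theta> where "\<theta> = 1 - 1 / \<nu>"
  have \<theta>: "0 < \<theta>" using G.theta by (simp add: \<theta>_def)
  have "((\<lambda>t. (u t / t) powr (1 / \<theta>) / (\<alpha> + h t)) \<longlongrightarrow> (\<theta> * \<delta> * n) powr (1 / \<theta>) / (\<alpha> + 0)) at_top"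
    using alpha_pos \<theta> delta_pos n_pos
    by (intro tendsto_intros G.u_linear_growth[folded \<theta>_def] h_lim) auto
  moreover have "(\<theta> * \<delta> * n) powr (1 / \<theta>) / (\<alpha> + 0) = (\<theta> * \<delta> powr (1 / \<nu>) * n) powr (1 / \<theta>)"
  proof -
    have "\<delta> = \<delta> powr \<theta> * \<delta> powr (1 / \<nu>)"
      using delta_pos by (simp add: \<theta>_def flip: powr_add)
    then have "(\<theta> * \<delta> * n) powr (1 / \<theta>) = (\<delta> powr \<theta> * (\<theta> * \<delta> powr (1 / \<nu>) * n)) powr (1 / \<theta>)"
      by (simp add: mult_ac)
    also have "\<dots> = \<delta> * (\<theta> * \<delta> powr (1 / \<nu>) * n) powr (1 / \<theta>)"
      using \<theta> delta_pos n_pos by (subst powr_mult) (auto simp: powr_powr)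
    finally show ?thesis using assms(1) delta_pos by simp
  qed
  moreover have "eventually (\<lambda>t. (u t / t) powr (1 / \<theta>) / (\<alpha> + h t) = t powr (- 1 / \<theta>) * y t) at_top"
    using eventually_gt_at_top[of 0]
  proof eventually_elim
    case (elim t)
    have "(u t / t) powr (1 / \<theta>) = t powr (- 1 / \<theta>) * u t powr (1 / \<theta>)"
      using elim u_pos[of t] by (simp add: powr_divide powr_minus_divide)
    then show ?case using y_eq[of t] by (simp add: \<theta>_def)
  qed
  ultimately show ?thesis
    unfolding \<theta>_def[symmetric] by (simp add: tendsto_cong)
qed

end

section \<open>The Lienard equation for \<open>\<delta> \<le> n\<close>\<close>

locale emden_subcritical = emden_system +
  assumes alpha_gt: "\<delta> < \<alpha>" and delta_le: "\<delta> \<le> n" and l_eq: "l = n - \<delta>"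
begin

text \<open>\<open>Z = Y'\<close>, and \<open>Y\<close> solves the Lienard equation
  \<open>Y'' + (\<nu> Y^(\<nu> - 1) + n - \<delta>) Y' + (\<alpha> - \<delta> + q h) Y^\<nu> - \<delta> n Y = 0\<close>, whose friction
  coefficient is positive when \<open>\<delta> \<le> n\<close>; \<open>E\<close> is its energy.\<close>

definition "Z t = - n * Y t - Y t powr \<nu> + (\<alpha> + h t) * y t"

definition "Z' t = - (\<nu> * Y t powr (\<nu> - 1) + (n - \<delta>)) * Z t - (\<alpha> - \<delta> + q * h t) * Y t powr \<nu> + \<delta> * n * Y t"

definition "E t = (Z t)\<^sup>2 / 2 + (\<alpha> - \<delta> + q * h t) * Y t powr (\<nu> + 1) / (\<nu> + 1) - \<delta> * n * (Y t)\<^sup>2 / 2"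

definition "E' t = - (\<nu> * Y t powr (\<nu> - 1) + (n - \<delta>)) * (Z t)\<^sup>2
  - q * (q - 1) * h t * (Y t powr \<nu> / y t) * Y t powr (\<nu> + 1) / (\<nu> + 1)"

lemma dY: "(Y has_real_derivative Z t) (at t)"
  using Y_deriv[of t] by (simp add: Z_def)

lemma dZ: "(Z has_real_derivative Z' t) (at t)"
proof -
  have Zs: "Z = (\<lambda>t. - n * Y t - Y t powr \<nu> + source t)" by (simp add: Z_def source_def fun_eq_iff)
  have "(Z has_real_derivative - n * Z t - \<nu> * Y t powr (\<nu> - 1) * Z t + source t * (\<delta> - A t * \<xi> t)) (at t)"
    unfolding Zs by (rule derivative_eq_intros refl dY powr_nu_deriv source_deriv)+ (simp add: Zs)
  moreover have eq: "source t * (\<delta> - A t * \<xi> t) = \<delta> * (Z t + n * Y t + Y t powr \<nu>) - A t * Y t powr \<nu>"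
    unfolding Zs by (simp add: powr_nu_eq algebra_simps)
  have "- n * Z t - \<nu> * Y t powr (\<nu> - 1) * Z t + source t * (\<delta> - A t * \<xi> t) = Z' t"
    unfolding eq unfolding Z'_def A_def by (simp add: algebra_simps)
  ultimately show ?thesis by (simp only:)
qed

lemma dE: "(E has_real_derivative E' t) (at t)"
proof -
  define W where "W = (\<lambda>t. Y t powr (\<nu> + 1))"
  have dW: "(W has_real_derivative (\<nu> + 1) * Y t powr \<nu> * Z t) (at t)"
    using DERIV_fun_powr[OF dY Y_pos, of "\<nu> + 1" t] by (simp add: W_def)
  obtain H where H: "- (q - 1) * h t * (Y t powr \<nu> / y t) = H" by blast
  have dh: "(h has_real_derivative H) (at t)" using h_deriv[of t] unfolding H .
  have dS: "((\<lambda>t. (Z t)\<^sup>2 / 2) has_real_derivative Z t * Z' t) (at t)"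
    unfolding power2_eq_square by (rule derivative_eq_intros refl dZ)+ simp_all
  have dQ: "((\<lambda>t. \<delta> * n * (Y t)\<^sup>2 / 2) has_real_derivative \<delta> * n * Y t * Z t) (at t)"
    unfolding power2_eq_square by (rule derivative_eq_intros refl dY)+ simp_all
  have dP: "((\<lambda>t. (\<alpha> - \<delta> + q * h t) * W t / (\<nu> + 1)) has_real_derivative
      (q * H * W t + (\<nu> + 1) * Y t powr \<nu> * Z t * (\<alpha> - \<delta> + q * h t)) / (\<nu> + 1)) (at t)"
    using nu by (intro DERIV_cdivide) (rule derivative_eq_intros refl dW dh | simp)+
  have "(E has_real_derivative Z t * Z' t + (q * H * W t + (\<nu> + 1) * Y t powr \<nu> * Z t * (\<alpha> - \<delta> + q * h t)) / (\<nu> + 1)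
      - \<delta> * n * Y t * Z t) (at t)"
    unfolding E_def[abs_def] W_def by (intro DERIV_add DERIV_diff dS dQ dP[unfolded W_def])
  moreover have P: "(q * H * W t + (\<nu> + 1) * Y t powr \<nu> * Z t * (\<alpha> - \<delta> + q * h t)) / (\<nu> + 1)
      = q * H * W t / (\<nu> + 1) + Y t powr \<nu> * Z t * (\<alpha> - \<delta> + q * h t)"
    using nu by (simp add: add_divide_distrib)
  moreover have R: "q * H * W t / (\<nu> + 1) = - q * (q - 1) * h t * (Y t powr \<nu> / y t) * Y t powr (\<nu> + 1) / (\<nu> + 1)"
  proof -
    have "q * H * W t = - q * (q - 1) * h t * (Y t powr \<nu> / y t) * Y t powr (\<nu> + 1)"
      unfolding H[symmetric] W_def by (simp only: mult_minus_left mult_minus_right mult_ac)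
    then show ?thesis by (simp only:)
  qed
  moreover have Q: "Z t * Z' t + (q * H * W t / (\<nu> + 1) + Y t powr \<nu> * Z t * (\<alpha> - \<delta> + q * h t)) - \<delta> * n * Y t * Z t
      = - (\<nu> * Y t powr (\<nu> - 1) + (n - \<delta>)) * (Z t)\<^sup>2 + q * H * W t / (\<nu> + 1)"
    by (simp add: Z'_def algebra_simps power2_eq_square)
  moreover have "Z t * Z' t + (q * H * W t + (\<nu> + 1) * Y t powr \<nu> * Z t * (\<alpha> - \<delta> + q * h t)) / (\<nu> + 1)
      - \<delta> * n * Y t * Z t = E' t"
    unfolding P Q unfolding R E'_def by simp
  ultimately show ?thesis by (simp only:)
qed

text \<open>Since \<open>h\<close> decreases and enters \<open>E\<close> with a positive weight, the
  perturbation only adds to the dissipation.\<close>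

lemma E'_le: "E' t \<le> - (\<nu> * Y t powr (\<nu> - 1) + (n - \<delta>)) * (Z t)\<^sup>2"
proof -
  have "0 \<le> q * (q - 1) * h t * (Y t powr \<nu> / y t) * Y t powr (\<nu> + 1) / (\<nu> + 1)"
    using q h_pos[of t] y_pos[of t] nu by (intro divide_nonneg_pos mult_nonneg_nonneg) auto
  then show ?thesis by (simp add: E'_def)
qed

lemma E'_nonpos: "E' t \<le> 0"
proof -
  have "0 \<le> (\<nu> * Y t powr (\<nu> - 1) + (n - \<delta>)) * (Z t)\<^sup>2"
    using nu delta_le by (intro mult_nonneg_nonneg add_nonneg_nonneg) auto
  then show ?thesis using E'_le[of t] unfolding minus_mult_left[symmetric] by linarith
qed

lemma E_decreasing: "s \<le> t \<Longrightarrow> E t \<le> E s"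
  using dE E'_nonpos by (intro DERIV_nonpos_imp_nonincreasing[of s t E]) blast+

lemma E_ge: "(Z t)\<^sup>2 / 2 + (\<alpha> - \<delta>) / (\<nu> + 1) * Y t powr (\<nu> + 1) - \<delta> * n * (Y t)\<^sup>2 / 2 \<le> E t"
proof -
  have "0 \<le> q * h t * Y t powr (\<nu> + 1) / (\<nu> + 1)" using q h_pos[of t] nu by simp
  then show ?thesis by (simp add: E_def distrib_right add_divide_distrib)
qed

lemma powr_nu_1_split: "Y t powr (\<nu> + 1) = Y t powr (\<nu> - 1) * (Y t)\<^sup>2"
  using Y_pos[of t] by (simp add: powr_add powr_diff power2_eq_square)

text \<open>The energy is coercive: \<open>\<nu> + 1 > 2\<close> lets the power of \<open>Y\<close>
  dominate the negative quadratic term.\<close>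

lemma bounded:
  obtains M where "1 \<le> M" "\<And>t. t \<ge> 0 \<Longrightarrow> Y t \<le> M" "\<And>t. t \<ge> 0 \<Longrightarrow> \<bar>Z t\<bar> \<le> M"
proof -
  define \<beta> where "\<beta> = (\<alpha> - \<delta>) / (\<nu> + 1)"
  have \<beta>: "0 < \<beta>" using alpha_gt nu by (simp add: \<beta>_def)
  \<comment> \<open>As soon as \<open>Y > 1\<close> and \<open>Y powr (\<nu> - 1) > K\<close>, the
    potential part alone exceeds \<open>E 0\<close>.\<close>
  define K where "K = (\<delta> * n / 2 + \<bar>E 0\<bar> + 1) / \<beta>"
  have K: "0 < K" using \<beta> delta_pos n_pos by (simp add: K_def add_nonneg_pos)
  define M where "M = max 1 (K powr (1 / (\<nu> - 1)))"
  have Y: "Y t \<le> M" if t: "t \<ge> 0" for t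
  proof (rule ccontr)
    assume "\<not> ?thesis"
    then have gt: "1 < Y t" "K powr (1 / (\<nu> - 1)) < Y t" by (auto simp: M_def)
    have "K = (K powr (1 / (\<nu> - 1))) powr (\<nu> - 1)" using K nu by (simp add: powr_powr)
    also have "\<dots> < Y t powr (\<nu> - 1)" using gt nu K by (intro powr_less_mono2) auto
    finally have "\<delta> * n / 2 + \<bar>E 0\<bar> + 1 < \<beta> * Y t powr (\<nu> - 1)"
      using \<beta> by (simp add: K_def field_simps)
    then have "1 * (\<bar>E 0\<bar> + 1) \<le> (Y t)\<^sup>2 * (\<beta> * Y t powr (\<nu> - 1) - \<delta> * n / 2)"
      using gt by (intro mult_mono) (auto simp: one_le_power)
    also have "\<dots> = \<beta> * Y t powr (\<nu> + 1) - \<delta> * n * (Y t)\<^sup>2 / 2"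
      unfolding powr_nu_1_split by (simp add: algebra_simps)
    also have "\<dots> \<le> E t - (Z t)\<^sup>2 / 2" using E_ge[of t] by (simp add: \<beta>_def)
    also have "\<dots> \<le> E t" by simp
    also have "\<dots> \<le> E 0" using E_decreasing t by simp
    finally show False using abs_ge_self[of "E 0"] by simp
  qed
  define M2 where "M2 = 2 * \<bar>E 0\<bar> + \<delta> * n * M\<^sup>2 + 1"
  have M2: "1 \<le> M2" using delta_pos n_pos by (simp add: M2_def)
  have Z: "\<bar>Z t\<bar> \<le> M2" if t: "t \<ge> 0" for t
  proof -
    have "(Y t)\<^sup>2 \<le> M\<^sup>2" using Y[OF t] Y_pos[of t] by (intro power_mono) auto
    then have "\<delta> * n * (Y t)\<^sup>2 \<le> \<delta> * n * M\<^sup>2" using delta_pos n_pos by (intro mult_left_mono) auto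
    moreover have "0 \<le> (\<alpha> - \<delta>) / (\<nu> + 1) * Y t powr (\<nu> + 1)" using alpha_gt nu by simp
    ultimately have "(Z t)\<^sup>2 \<le> 2 * E t + \<delta> * n * M\<^sup>2" using E_ge[of t] by linarith
    also have "\<dots> \<le> M2" using E_decreasing[of 0 t] t unfolding M2_def by linarith
    also have "\<dots> \<le> M2\<^sup>2" using M2 by (simp add: power2_eq_square mult_le_cancel_left1)
    finally show ?thesis using M2 by (simp add: abs_le_square_iff[symmetric])
  qed
  show thesis
  proof (rule that[of "max M M2"])
    show "1 \<le> max M M2" using M2 by simp
    fix t :: real assume "t \<ge> 0"
    then show "Y t \<le> max M M2" "\<bar>Z t\<bar> \<le> max M M2" using Y[of t] Z[of t] by auto
  qed
qed

lemma h_decreasing: "s \<le> t \<Longrightarrow> h t \<le> h s"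
proof (rule DERIV_nonpos_imp_nonincreasing[of s t h])
  fix x
  have "0 \<le> (q - 1) * h x * (Y x powr \<nu> / y x)"
    using q h_pos[of x] y_pos[of x] by (intro mult_nonneg_nonneg) auto
  then have "- (q - 1) * h x * (Y x powr \<nu> / y x) \<le> 0"
    by (simp only: minus_mult_left[symmetric] neg_le_0_iff_le)
  then show "\<exists>d. (h has_real_derivative d) (at x) \<and> d \<le> 0"
    using h_deriv[of x] by blast
qed

text \<open>Only the borderline \<open>\<delta> = n\<close> is delicate, since the friction then
  degenerates as \<open>Y\<close> approaches zero. But there \<open>l = 0\<close>, so
  \<open>slow_decay\<close> together with the upper bounds keeps \<open>y\<close> away from zero,
  and the source \<open>\<alpha> * y\<close> pushes \<open>Y\<close> up.\<close>

lemma dissipation_bounded_below: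
  obtains d T where "d > 0" "T \<ge> 0" "\<And>t. t \<ge> T \<Longrightarrow> d \<le> \<nu> * Y t powr (\<nu> - 1) + (n - \<delta>)"
proof (cases "\<delta> < n")
  case True
  then show thesis using nu by (intro that[of "n - \<delta>" 0]) auto
next
  case False
  then have [simp]: "\<delta> = n" using delta_le by simp
  obtain M where M: "1 \<le> M" "\<And>t. t \<ge> 0 \<Longrightarrow> Y t \<le> M" "\<And>t. t \<ge> 0 \<Longrightarrow> \<bar>Z t\<bar> \<le> M"
    using bounded by blast
  define B where "B = (M + n * M + M powr \<nu>) / \<alpha>"
  have B: "0 < B" using M alpha_pos n_pos by (auto simp: B_def intro!: divide_pos_pos add_pos_nonneg)
  have yB: "y t \<le> B" if t: "t \<ge> 0" for t
  proof -
    have "\<alpha> * y t \<le> (\<alpha> + h t) * y t" using h_pos[of t] y_pos[of t] by simp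
    also have "\<dots> = Z t + n * Y t + Y t powr \<nu>" by (simp add: Z_def)
    also have "\<dots> \<le> M + n * M + M powr \<nu>"
      using M(2)[OF t] M(3)[OF t] Y_pos[of t] nu n_pos
      by (intro add_mono mult_left_mono powr_mono2) auto
    finally show ?thesis using alpha_pos by (simp add: B_def field_simps)
  qed
  define k where "k = c / (M + B)"
  have k: "0 < k" using c_pos M B by (simp add: k_def)
  have yk: "k \<le> y t" if t: "t \<ge> 0" for t
  proof -
    have "c \<le> y t * (Y t + y t)" using slow_decay[OF t] l_eq by (simp add: algebra_simps power2_eq_square)
    also have "\<dots> \<le> y t * (M + B)" using y_pos[of t] M(2)[OF t] yB[OF t] by (intro mult_left_mono) auto
    finally show ?thesis using M B by (simp add: k_def field_simps)
  qed
  \<comment> \<open>For \<open>Y \<le> b \<le> 1\<close> the losses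
    \<open>n * Y + Y powr \<nu>\<close> are at most \<open>(n + 1) * b\<close>, which is half of the
    guaranteed gain \<open>\<alpha> * k\<close> or less.\<close>
  define b where "b = min 1 (\<alpha> * k / (2 * (n + 1)))"
  have b: "0 < b" "b \<le> 1" "b \<le> \<alpha> * k / (2 * (n + 1))"
    using k alpha_pos n_pos by (auto simp: b_def)
  then have b': "(n + 1) * b \<le> \<alpha> * k / 2"
    using n_pos by (simp add: pos_le_divide_eq algebra_simps)
  have "eventually (\<lambda>t. - Y t < - b) at_top"
  proof (rule eventually_below_barrier)
    show "((\<lambda>t. - Y t) has_real_derivative - Z t) (at t)" for t by (intro DERIV_minus dY)
    show "0 < \<alpha> * k / 2" using alpha_pos k by simp
    fix t :: real assume t: "0 \<le> t" "- b \<le> - Y t"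
    have "Y t powr \<nu> \<le> Y t powr 1"
      using t(2) b(2) Y_pos[of t] nu by (intro powr_mono') auto
    then have "n * Y t + Y t powr \<nu> \<le> (n + 1) * Y t" using Y_pos[of t] by (simp add: algebra_simps)
    also have "\<dots> \<le> (n + 1) * b" using t(2) n_pos by (intro mult_left_mono) auto
    finally have "n * Y t + Y t powr \<nu> \<le> \<alpha> * k / 2" using b' by simp
    moreover have "\<alpha> * k \<le> (\<alpha> + h t) * y t"
      using yk[OF t(1)] k alpha_pos h_pos[of t] by (intro mult_mono) auto
    ultimately show "- Z t \<le> - (\<alpha> * k / 2)" by (simp add: Z_def)
  qed
  then obtain T where T: "\<And>t. t \<ge> T \<Longrightarrow> b < Y t" unfolding eventually_at_top_linorder by auto
  show thesis
  proof (rule that)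
    show "0 < \<nu> * b powr (\<nu> - 1)" using b nu by simp
    show "0 \<le> max T 0" by simp
    fix t assume "t \<ge> max T 0"
    then show "\<nu> * b powr (\<nu> - 1) \<le> \<nu> * Y t powr (\<nu> - 1) + (n - \<delta>)"
      using T[of t] b nu by (auto intro!: mult_left_mono powr_mono2)
  qed
qed

lemma Z_tendsto_0: "(Z \<longlongrightarrow> 0) at_top"
proof -
  obtain M where M: "1 \<le> M" "\<And>t. t \<ge> 0 \<Longrightarrow> Y t \<le> M" "\<And>t. t \<ge> 0 \<Longrightarrow> \<bar>Z t\<bar> \<le> M"
    using bounded by blast
  obtain d T where d: "d > 0" "T \<ge> 0" "\<And>t. t \<ge> T \<Longrightarrow> d \<le> \<nu> * Y t powr (\<nu> - 1) + (n - \<delta>)"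
    using dissipation_bounded_below by blast
  show ?thesis
  proof (rule lyapunov_tendsto_0[of T E E' _ Z Z', OF dE _ E'_nonpos dZ])
    fix t assume "t \<ge> T"
    then have t: "t \<ge> 0" using d(2) by simp
    have YM: "(Y t)\<^sup>2 \<le> M\<^sup>2" using M(2)[OF t] Y_pos[of t] by (intro power_mono) auto
    have "0 \<le> (\<alpha> - \<delta>) / (\<nu> + 1) * Y t powr (\<nu> + 1)" using alpha_gt nu by simp
    moreover have "\<delta> * n * (Y t)\<^sup>2 \<le> \<delta> * n * M\<^sup>2" using YM delta_pos n_pos by (intro mult_left_mono) auto
    moreover have "0 \<le> (Z t)\<^sup>2" by simp
    ultimately show "- (\<delta> * n * M\<^sup>2 / 2) \<le> E t" using E_ge[of t] by linarith
    have "\<bar>- (\<nu> * Y t powr (\<nu> - 1) + (n - \<delta>)) * Z t\<bar> \<le> (\<nu> * M powr (\<nu> - 1) + (n - \<delta>)) * M"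
    proof -
      define S where "S = \<nu> * Y t powr (\<nu> - 1) + (n - \<delta>)"
      have S: "0 \<le> S" using nu delta_le by (simp add: S_def)
      have "S \<le> \<nu> * M powr (\<nu> - 1) + (n - \<delta>)"
        unfolding S_def using M(2)[OF t] Y_pos[of t] nu by (auto intro!: powr_mono2)
      then have "S * \<bar>Z t\<bar> \<le> (\<nu> * M powr (\<nu> - 1) + (n - \<delta>)) * M"
        using S M(3)[OF t] by (intro mult_mono) auto
      then show ?thesis using S by (simp add: abs_mult flip: S_def)
    qed
    moreover have "\<bar>(\<alpha> - \<delta> + q * h t) * Y t powr \<nu>\<bar> \<le> (\<alpha> - \<delta> + q * h 0) * M powr \<nu>"
      unfolding abs_mult using M(2)[OF t] Y_pos[of t] nu q alpha_gt h_pos[of t] h_pos[of 0] h_decreasing[OF t]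
      by (intro mult_mono) (auto intro!: powr_mono2)
    moreover have "\<bar>\<delta> * n * Y t\<bar> \<le> \<delta> * n * M"
      using M(2)[OF t] Y_pos[of t] delta_pos n_pos by (simp add: abs_mult)
    ultimately show "\<bar>Z' t\<bar> \<le> (\<nu> * M powr (\<nu> - 1) + (n - \<delta>)) * M + (\<alpha> - \<delta> + q * h 0) * M powr \<nu> + \<delta> * n * M"
      unfolding Z'_def by linarith
  next
    fix e :: real assume e: "e > 0"
    show "\<exists>d>0. \<forall>t\<ge>T. e \<le> \<bar>Z t\<bar> \<longrightarrow> E' t \<le> - d"
    proof (intro exI conjI allI impI)
      show "0 < d * e\<^sup>2" using d(1) e by simp
      fix t assume t: "t \<ge> T" "e \<le> \<bar>Z t\<bar>"
      have "e\<^sup>2 \<le> (Z t)\<^sup>2" using t(2) e by (simp add: abs_le_square_iff[symmetric])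
      then have "d * e\<^sup>2 \<le> (\<nu> * Y t powr (\<nu> - 1) + (n - \<delta>)) * (Z t)\<^sup>2"
        using d(1) d(3)[OF t(1)] by (intro mult_mono) auto
      then show "E' t \<le> - (d * e\<^sup>2)" using E'_le[of t] unfolding minus_mult_left[symmetric] by linarith
    qed
  qed
qed

text \<open>Up to null terms \<open>Z'\<close> is this expression, whose derivative is a bounded
  multiple of \<open>Z\<close>. Convergence of \<open>Z\<close> therefore forces it to zero, leaving
  \<open>0\<close> and the positive equilibrium as the only candidates for limits of
  \<open>Y\<close>.\<close>

lemma equilibrium_residual: "((\<lambda>t. Y t * (\<delta> * n - (\<alpha> - \<delta>) * Y t powr (\<nu> - 1))) \<longlongrightarrow> 0) at_top"
proof -
  obtain M where M: "1 \<le> M" "\<And>t. t \<ge> 0 \<Longrightarrow> Y t \<le> M" "\<And>t. t \<ge> 0 \<Longrightarrow> \<bar>Z t\<bar> \<le> M"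
    using bounded by blast
  have pw: "Y t powr a \<le> M powr a" if "t \<ge> 0" "0 \<le> a" for t a
    using M(2)[OF that(1)] Y_pos[of t] that(2) by (intro powr_mono2) auto
  define g where "g = (\<lambda>t. \<delta> * n * Y t - (\<alpha> - \<delta>) * Y t powr \<nu>)"
  have "(g \<longlongrightarrow> 0) at_top"
  proof (rule tendsto_0_of_slow_derivative[OF dZ _ Z_tendsto_0])
    fix t
    show "(g has_real_derivative (\<delta> * n - (\<alpha> - \<delta>) * (\<nu> * Y t powr (\<nu> - 1))) * Z t) (at t)"
      unfolding g_def by (rule derivative_eq_intros refl dY powr_nu_deriv)+ (simp add: algebra_simps)
  next
    have "eventually (\<lambda>t. norm (\<nu> * Y t powr (\<nu> - 1) + (n - \<delta>)) \<le> \<nu> * M powr (\<nu> - 1) + (n - \<delta>)) at_top"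
      using eventually_ge_at_top[of 0]
      by eventually_elim (use pw[of _ "\<nu> - 1"] nu delta_le in \<open>auto intro!: mult_left_mono\<close>)
    then have 1: "((\<lambda>t. (\<nu> * Y t powr (\<nu> - 1) + (n - \<delta>)) * Z t) \<longlongrightarrow> 0) at_top"
      by (rule lim_null_mult_left_bounded) (rule Z_tendsto_0)
    have "eventually (\<lambda>t. norm (Y t powr \<nu>) \<le> M powr \<nu>) at_top"
      using eventually_ge_at_top[of 0] by eventually_elim (use pw[of _ \<nu>] nu in auto)
    moreover have "((\<lambda>t. q * h t) \<longlongrightarrow> q * 0) at_top" by (intro tendsto_intros h_lim)
    ultimately have 2: "((\<lambda>t. q * h t * Y t powr \<nu>) \<longlongrightarrow> 0) at_top"
      by (intro lim_null_mult_right_bounded[of "\<lambda>t. q * h t"]) auto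
    have "((\<lambda>t. - ((\<nu> * Y t powr (\<nu> - 1) + (n - \<delta>)) * Z t) - q * h t * Y t powr \<nu>) \<longlongrightarrow> - 0 - 0) at_top"
      by (intro tendsto_minus tendsto_diff 1 2)
    then show "((\<lambda>t. Z' t - g t) \<longlongrightarrow> 0) at_top"
      by (simp add: Z'_def g_def algebra_simps)
    have "eventually (\<lambda>t. norm (\<delta> * n - (\<alpha> - \<delta>) * (\<nu> * Y t powr (\<nu> - 1)))
        \<le> \<delta> * n + (\<alpha> - \<delta>) * (\<nu> * M powr (\<nu> - 1))) at_top"
      using eventually_ge_at_top[of 0]
    proof eventually_elim
      case (elim t)
      have "\<bar>(\<alpha> - \<delta>) * (\<nu> * Y t powr (\<nu> - 1))\<bar> \<le> (\<alpha> - \<delta>) * (\<nu> * M powr (\<nu> - 1))"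
        using pw[OF elim, of "\<nu> - 1"] nu alpha_gt by (auto simp: abs_mult)
      moreover have "\<bar>\<delta> * n\<bar> = \<delta> * n" using delta_pos n_pos by simp
      ultimately show ?case unfolding real_norm_def by linarith
    qed
    then show "((\<lambda>t. (\<delta> * n - (\<alpha> - \<delta>) * (\<nu> * Y t powr (\<nu> - 1))) * Z t) \<longlongrightarrow> 0) at_top"
      by (rule lim_null_mult_left_bounded) (rule Z_tendsto_0)
  qed
  then show ?thesis unfolding g_def powr_nu_split by (simp add: algebra_simps)
qed

text \<open>If \<open>Y\<close> tended to zero, the logarithmic slope \<open>\<rho> = - Y' / Y\<close> would satisfy a Riccati equation
  forcing \<open>\<rho>\<close> towards \<open>n\<close>, which is a decay too fast for \<open>slow_decay\<close>.\<close>

lemma not_tendsto_0: "\<not> (Y \<longlongrightarrow> 0) at_top"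
proof
  assume Y0: "(Y \<longlongrightarrow> 0) at_top"
  have pw0: "((\<lambda>t. Y t powr a) \<longlongrightarrow> 0) at_top" if "0 < a" for a
    using Y0 that Y_pos by (intro tendsto_zero_powrI[OF Y0 tendsto_const]) (auto intro: always_eventually less_imp_le)
  have E0: "(E \<longlongrightarrow> 0) at_top"
  proof -
    have "(E \<longlongrightarrow> 0\<^sup>2 / 2 + (\<alpha> - \<delta> + q * 0) * 0 / (\<nu> + 1) - \<delta> * n * 0\<^sup>2 / 2) at_top"
      unfolding E_def using nu by (intro tendsto_intros Z_tendsto_0 h_lim pw0 Y0) auto
    then show ?thesis by simp
  qed
  have E_nonneg: "0 \<le> E t" for t
  proof (rule tendsto_upperbound[OF E0])
    show "eventually (\<lambda>s. E s \<le> E t) at_top"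
      using eventually_ge_at_top[of t] by eventually_elim (rule E_decreasing)
  qed simp
  define k where "k = (\<lambda>t. (\<alpha> - \<delta> + q * h t) * Y t powr (\<nu> - 1))"
  have k0: "(k \<longlongrightarrow> 0) at_top"
  proof -
    have "(k \<longlongrightarrow> (\<alpha> - \<delta> + q * 0) * 0) at_top"
      unfolding k_def using nu by (intro tendsto_intros h_lim pw0) auto
    then show ?thesis by simp
  qed
  \<comment> \<open>The first bound rules out zeros of \<open>Z\<close>, where
    \<open>E \<ge> 0\<close> would require \<open>k \<ge> (\<nu> + 1) * \<delta> * n / 2\<close>;
    the second bounds the inhomogeneous term of the Riccati equation.\<close>
  define \<kappa> where "\<kappa> = min (\<delta> * n / 4) (\<delta>\<^sup>2 / 4)"
  have \<kappa>: "0 < \<kappa>" using delta_pos n_pos by (simp add: \<kappa>_def)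
  obtain T where T: "T \<ge> 0" "\<And>t. t \<ge> T \<Longrightarrow> k t < \<kappa>"
  proof -
    have "eventually (\<lambda>t. t \<ge> 0 \<and> k t < \<kappa>) at_top"
      by (intro eventually_conj eventually_ge_at_top order_tendstoD(2)[OF k0 \<kappa>])
    then show thesis using that unfolding eventually_at_top_linorder by blast
  qed
  have k_nonneg: "0 \<le> k t" for t using alpha_gt q h_pos[of t] by (simp add: k_def)
  have Z_nz: "Z t \<noteq> 0" if t: "t \<ge> T" for t
  proof
    assume "Z t = 0"
    then have "\<delta> * n / 2 * (Y t)\<^sup>2 \<le> k t / (\<nu> + 1) * (Y t)\<^sup>2"
      using E_nonneg[of t] by (simp add: E_def k_def powr_nu_1_split)
    then have "\<delta> * n / 2 \<le> k t / (\<nu> + 1)"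
      by (rule mult_right_le_imp_le) (use Y_pos[of t] in simp)
    also have "\<dots> \<le> k t / 1" using nu k_nonneg by (intro divide_left_mono) auto
    also have "\<dots> < \<delta> * n / 4" using T(2)[OF t] by (simp add: \<kappa>_def)
    finally show False using delta_pos n_pos by (simp add: field_simps)
  qed
  have Z_neg: "Z t < 0" if t: "t \<ge> T" for t
  proof (rule ccontr)
    assume "\<not> Z t < 0"
    then have pos: "0 < Z t" using Z_nz[OF t] by simp
    have "0 < Z s" if s: "s \<ge> t" for s
    proof (rule ccontr)
      assume "\<not> 0 < Z s"
      then have "\<exists>x. t \<le> x \<and> x \<le> s \<and> Z x = 0"
        using pos s dZ by (intro IVT2) (auto intro!: DERIV_isCont)
      then obtain x where "t \<le> x" "Z x = 0" by blast
      then show False using Z_nz[of x] t by simp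
    qed
    then have inc: "Y t \<le> Y s" if "s \<ge> t" for s
      using dY that by (intro DERIV_nonneg_imp_nondecreasing[of t s Y]) (auto intro: less_imp_le)
    have "Y t \<le> 0"
      by (rule tendsto_lowerbound[OF Y0]) (use inc in \<open>auto intro!: eventually_mono[OF eventually_ge_at_top[of t]]\<close>)
    then show False using Y_pos[of t] by simp
  qed
  define \<rho> where "\<rho> = (\<lambda>t. - Z t / Y t)"
  \<comment> \<open>Below \<open>n\<close>, so that
    \<open>(\<rho> - n) * (\<rho> + \<delta>)\<close> pushes \<open>\<rho>\<close> down at a
    definite rate whenever \<open>0 < \<rho> \<le> b\<close>, yet large enough for
    \<open>2 * b = 2 * n - \<delta>\<close> to exceed \<open>l = n - \<delta>\<close>.\<close>
  define b where "b = n - \<delta> / 2"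
  have b: "0 < b" using delta_le delta_pos by (simp add: b_def)
  define \<rho>' where "\<rho>' = (\<lambda>t. (\<rho> t - n) * (\<rho> t + \<delta>) - \<nu> * Y t powr (\<nu> - 1) * \<rho> t + k t)"
  have d\<rho>: "(\<rho> has_real_derivative \<rho>' t) (at t)" for t
  proof -
    have "(\<rho> has_real_derivative (- Z' t * Y t - (- Z t) * Z t) / (Y t * Y t)) (at t)"
      unfolding \<rho>_def using Y_pos[of t] by (intro DERIV_divide DERIV_minus dZ dY) auto
    moreover have "Z t = - \<rho> t * Y t" using Y_pos[of t] by (simp add: \<rho>_def)
    then have "(- Z' t * Y t - (- Z t) * Z t) / (Y t * Y t) = \<rho>' t"
      using Y_pos[of t] by (simp add: Z'_def \<rho>'_def k_def powr_nu_split field_simps)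
    ultimately show ?thesis by simp
  qed
  have \<rho>_pos: "0 < \<rho> t" if "t \<ge> T" for t using Z_neg[OF that] Y_pos[of t] by (simp add: \<rho>_def divide_neg_pos)
  have drift: "\<rho>' t \<le> - (\<delta>\<^sup>2 / 4)" if t: "t \<ge> T" and "\<rho> t \<le> b" for t
  proof -
    have "(\<rho> t - n) * (\<rho> t + \<delta>) \<le> (- \<delta> / 2) * (\<rho> t + \<delta>)"
      using \<open>\<rho> t \<le> b\<close> \<rho>_pos[OF t] delta_pos by (intro mult_right_mono) (auto simp: b_def)
    also have "\<dots> \<le> (- \<delta> / 2) * \<delta>"
      using \<rho>_pos[OF t] delta_pos by (intro mult_left_mono_neg) auto
    finally have "(\<rho> t - n) * (\<rho> t + \<delta>) \<le> - (\<delta>\<^sup>2 / 2)" by (simp add: power2_eq_square)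
    moreover have "0 \<le> \<nu> * Y t powr (\<nu> - 1) * \<rho> t" using nu \<rho>_pos[OF t] by simp
    moreover have "k t \<le> \<delta>\<^sup>2 / 4" using T(2)[OF t] by (simp add: \<kappa>_def)
    ultimately show ?thesis unfolding \<rho>'_def by linarith
  qed
  have \<rho>_ge: "b \<le> \<rho> t" if t: "t \<ge> T" for t
  proof (rule ccontr)
    assume "\<not> b \<le> \<rho> t"
    then have init: "\<rho> t < b" by simp
    have dd: "0 < \<delta>\<^sup>2 / 4" using delta_pos by simp
    have less: "\<rho> s < b" if "s \<ge> t" for s
    proof (rule stays_below[OF d\<rho> init _ that])
      fix x assume "t \<le> x" "\<rho> x = b"
      then have "\<rho>' x \<le> - (\<delta>\<^sup>2 / 4)" using drift[of x] t by simp
      then show "\<rho>' x < 0" using dd by linarith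
    qed
    \<comment> \<open>By this time the drift has lowered \<open>\<rho>\<close> by at least
      \<open>b\<close>, making it negative, although \<open>Y\<close> decreases.\<close>
    define s where "s = t + b / (\<delta>\<^sup>2 / 4)"
    have s: "s \<ge> t" using b dd by (simp add: s_def)
    have "\<rho> s \<le> \<rho> t + (- (\<delta>\<^sup>2 / 4)) * (s - t)"
    proof (rule deriv_le_imp_linear_bound[OF d\<rho> _ s])
      fix x assume "t \<le> x"
      then show "\<rho>' x \<le> - (\<delta>\<^sup>2 / 4)" using less[of x] t by (intro drift) auto
    qed
    also have "(- (\<delta>\<^sup>2 / 4)) * (s - t) = - b" using dd by (simp add: s_def)
    finally show False using init \<rho>_pos[of s] s t by simp
  qed
  obtain M where M: "1 \<le> M" "\<And>t. t \<ge> 0 \<Longrightarrow> Y t \<le> M" "\<And>t. t \<ge> 0 \<Longrightarrow> \<bar>Z t\<bar> \<le> M"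
    using bounded by blast
  define K where "K = Y T * exp (b * T)"
  define C where "C = (n + M powr (\<nu> - 1)) / \<alpha>"
  have C: "0 \<le> C" using n_pos alpha_pos by (simp add: C_def)
  show False
  proof (rule exp_not_dominated[OF c_pos])
    show "l < 2 * b" using n_pos by (simp add: l_eq b_def)
    fix t assume t: "t \<ge> T"
    then have t0: "t \<ge> 0" using T(1) by simp
    have "Y t \<le> K * exp (- b * t)"
      unfolding K_def
    proof (rule exp_decay_bound[OF dY _ t])
      fix s assume "s \<ge> T"
      then show "Z s \<le> - b * Y s" using \<rho>_ge[of s] Y_pos[of s] by (simp add: \<rho>_def field_simps)
    qed
    then have "(Y t)\<^sup>2 \<le> (K * exp (- b * t))\<^sup>2" using Y_pos[of t] by (intro power_mono) auto
    also have "\<dots> = K\<^sup>2 * exp (- (2 * b) * t)"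
      by (simp add: power_mult_distrib power2_eq_square flip: exp_add)
    finally have Y2: "(Y t)\<^sup>2 \<le> K\<^sup>2 * exp (- (2 * b) * t)" .
    have "\<alpha> * y t \<le> (\<alpha> + h t) * y t" using h_pos[of t] y_pos[of t] by simp
    also have "\<dots> = Z t + n * Y t + Y t powr \<nu>" by (simp add: Z_def)
    also have "\<dots> \<le> n * Y t + Y t powr (\<nu> - 1) * Y t" using Z_neg[OF t] by (simp add: powr_nu_split)
    also have "\<dots> \<le> n * Y t + M powr (\<nu> - 1) * Y t"
      using M(2)[OF t0] Y_pos[of t] nu by (intro add_left_mono mult_right_mono powr_mono2) auto
    finally have yY: "y t \<le> C * Y t" using alpha_pos by (simp add: C_def field_simps)
    have "y t * Y t + (y t)\<^sup>2 \<le> C * Y t * Y t + (C * Y t)\<^sup>2"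
      using yY Y_pos[of t] y_pos[of t] by (intro add_mono mult_right_mono power_mono) auto
    also have "\<dots> = (C + C\<^sup>2) * (Y t)\<^sup>2" by (simp add: algebra_simps power2_eq_square)
    also have "\<dots> \<le> (C + C\<^sup>2) * (K\<^sup>2 * exp (- (2 * b) * t))"
      using Y2 C by (intro mult_left_mono) auto
    finally show "c * exp (- l * t) \<le> ((C + C\<^sup>2) * K\<^sup>2) * exp (- (2 * b) * t)"
      using slow_decay[OF t0] by (simp only: mult.assoc)
  qed
qed

text \<open>The residual vanishes at \<open>Y = 0\<close> and \<open>Y = Y0\<close> and is positive
  at \<open>b = Y0 / 2\<close>, so from some time on the orbit cannot cross \<open>b\<close>. The
  lower side would mean that \<open>Y\<close> tends to zero, which is excluded; on the upper side
  one may divide by \<open>Y\<close>. The limit of \<open>y\<close> is then read off from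
  \<open>Z\<close>.\<close>

lemma subcritical_tendsto:
  "(y \<longlongrightarrow> (\<delta> powr (1 / \<nu>) * (n / (\<alpha> - \<delta>))) powr (1 / (1 - 1 / \<nu>))) at_top"
proof -
  define \<beta> where "\<beta> = \<alpha> - \<delta>"
  have \<beta>: "0 < \<beta>" using alpha_gt by (simp add: \<beta>_def)
  define s0 where "s0 = \<delta> * n / \<beta>"
  have s0: "0 < s0" using delta_pos n_pos \<beta> by (simp add: s0_def)
  define Y0 where "Y0 = s0 powr (1 / (\<nu> - 1))"
  have Y0: "0 < Y0" "Y0 powr (\<nu> - 1) = s0" using s0 nu by (auto simp: Y0_def powr_powr)
  define b where "b = Y0 / 2"
  have b: "0 < b" "b < Y0" using Y0 by (auto simp: b_def)
  define r where "r = \<delta> * n - \<beta> * b powr (\<nu> - 1)"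
  have r: "0 < r"
  proof -
    have "b powr (\<nu> - 1) < Y0 powr (\<nu> - 1)" using b nu by (intro powr_less_mono2) auto
    then show ?thesis using \<beta> unfolding Y0(2) by (simp add: r_def s0_def field_simps)
  qed
  define g where "g = (\<lambda>t. Y t * (\<delta> * n - \<beta> * Y t powr (\<nu> - 1)))"
  have g0: "(g \<longlongrightarrow> 0) at_top" using equilibrium_residual by (simp add: g_def \<beta>_def)
  have "0 < b * r" using b r by simp
  then obtain T where T: "\<And>t. t \<ge> T \<Longrightarrow> g t < b * r"
    using order_tendstoD(2)[OF g0] unfolding eventually_at_top_linorder by blast
  have Y_nb: "Y t \<noteq> b" if "t \<ge> T" for t using T[OF that] by (auto simp: g_def r_def)
  have Y_gt: "b < Y t" if t: "t \<ge> T" for t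
  proof (rule ccontr)
    assume "\<not> b < Y t"
    then have init: "Y t < b" using Y_nb[OF t] by simp
    have less: "Y s < b" if s: "s \<ge> t" for s
    proof (rule ccontr)
      assume "\<not> Y s < b"
      then have "\<exists>x. t \<le> x \<and> x \<le> s \<and> Y x = b"
        using init s dY by (intro IVT) (auto intro!: DERIV_isCont)
      then obtain x where "t \<le> x" "Y x = b" by blast
      then show False using Y_nb[of x] t by simp
    qed
    have "((\<lambda>s. g s / r) \<longlongrightarrow> 0 / r) at_top" using r by (intro tendsto_intros g0) auto
    then have "((\<lambda>s. g s / r) \<longlongrightarrow> 0) at_top" by simp
    then have "(Y \<longlongrightarrow> 0) at_top"
    proof (rule tendsto_sandwich[rotated 2, OF tendsto_const])
      show "eventually (\<lambda>s. 0 \<le> Y s) at_top" using Y_pos by (auto intro: always_eventually less_imp_le)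
      show "eventually (\<lambda>s. Y s \<le> g s / r) at_top"
        using eventually_ge_at_top[of t]
      proof eventually_elim
        case (elim s)
        have "Y s powr (\<nu> - 1) \<le> b powr (\<nu> - 1)"
          using less[OF elim] Y_pos[of s] nu by (intro powr_mono2) auto
        then have "r \<le> \<delta> * n - \<beta> * Y s powr (\<nu> - 1)" using \<beta> by (simp add: r_def)
        then have "Y s * r \<le> g s" using Y_pos[of s] by (simp add: g_def)
        then show ?case using r by (simp add: field_simps)
      qed
    qed
    then show False using not_tendsto_0 by simp
  qed
  have "((\<lambda>t. Y t powr (\<nu> - 1)) \<longlongrightarrow> s0) at_top"
  proof -
    have "eventually (\<lambda>t. norm (1 / Y t) \<le> 1 / b) at_top"
      using eventually_ge_at_top[of T]
    proof eventually_elim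
      case (elim t)
      then have "1 / Y t \<le> 1 / b" using Y_gt[OF elim] b by (intro divide_left_mono) auto
      then show ?case using Y_pos[of t] by simp
    qed
    then have "((\<lambda>t. g t * (1 / Y t)) \<longlongrightarrow> 0) at_top"
      by (rule lim_null_mult_right_bounded[OF g0])
    moreover have "g t * (1 / Y t) = \<delta> * n - \<beta> * Y t powr (\<nu> - 1)" for t
      using Y_pos[of t] by (simp add: g_def)
    ultimately have "((\<lambda>t. \<delta> * n - \<beta> * Y t powr (\<nu> - 1)) \<longlongrightarrow> 0) at_top" by simp
    then have "((\<lambda>t. (\<delta> * n - (\<delta> * n - \<beta> * Y t powr (\<nu> - 1))) / \<beta>) \<longlongrightarrow> (\<delta> * n - 0) / \<beta>) at_top"
      using \<beta> by (intro tendsto_intros) auto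
    then show ?thesis using \<beta> by (simp add: s0_def)
  qed
  note s_lim = this
  have Y_lim: "(Y \<longlongrightarrow> Y0) at_top"
  proof -
    have "((\<lambda>t. (Y t powr (\<nu> - 1)) powr (1 / (\<nu> - 1))) \<longlongrightarrow> s0 powr (1 / (\<nu> - 1))) at_top"
      using s0 by (intro tendsto_intros s_lim) auto
    moreover have "(Y t powr (\<nu> - 1)) powr (1 / (\<nu> - 1)) = Y t" for t
      using Y_pos[of t] nu by (simp add: powr_powr)
    ultimately show ?thesis by (simp add: Y0_def)
  qed
  have "((\<lambda>t. (Z t + n * Y t + Y t powr (\<nu> - 1) * Y t) / (\<alpha> + h t)) \<longlongrightarrow> (0 + n * Y0 + s0 * Y0) / (\<alpha> + 0)) at_top"
    using alpha_pos by (intro tendsto_intros Z_tendsto_0 Y_lim s_lim h_lim) auto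
  moreover have "(Z t + n * Y t + Y t powr (\<nu> - 1) * Y t) / (\<alpha> + h t) = y t" for t
    using alpha_h_pos[of t] unfolding powr_nu_split[symmetric] by (simp add: Z_def)
  moreover have "(0 + n * Y0 + s0 * Y0) / (\<alpha> + 0) = Y0 * (n / \<beta>)"
  proof -
    have "n + s0 = n * \<alpha> / \<beta>" using \<beta> by (simp add: s0_def \<beta>_def field_simps)
    then have "(0 + n * Y0 + s0 * Y0) = Y0 * (n * \<alpha> / \<beta>)" by (metis add_0 distrib_right mult.commute)
    then show ?thesis using alpha_pos by simp
  qed
  moreover have "Y0 * (n / \<beta>) = (\<delta> powr (1 / \<nu>) * (n / \<beta>)) powr (1 / (1 - 1 / \<nu>))"
  proof -
    have e: "1 / (1 - 1 / \<nu>) = 1 + 1 / (\<nu> - 1)" "1 / (\<nu> * (1 - 1 / \<nu>)) = 1 / (\<nu> - 1)"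
      using nu by (auto simp: field_simps)
    have "(\<delta> powr (1 / \<nu>) * (n / \<beta>)) powr (1 / (1 - 1 / \<nu>))
        = \<delta> powr (1 / (\<nu> - 1)) * (n / \<beta>) powr (1 + 1 / (\<nu> - 1))"
      using delta_pos n_pos \<beta> by (subst powr_mult) (auto simp: powr_powr e(2) simp flip: e(1))
    also have "\<dots> = \<delta> powr (1 / (\<nu> - 1)) * ((n / \<beta>) * (n / \<beta>) powr (1 / (\<nu> - 1)))"
      using n_pos \<beta> by (simp add: powr_add)
    also have "\<dots> = (\<delta> * (n / \<beta>)) powr (1 / (\<nu> - 1)) * (n / \<beta>)"
      using delta_pos n_pos \<beta> by (subst powr_mult) auto
    finally show ?thesis by (simp add: Y0_def s0_def)
  qed
  ultimately show ?thesis unfolding \<beta>_def by simp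
qed

end

section \<open>Positivity and decay of radial solutions\<close>

lemma signed_pow_simps:
  shows signed_pow_neg: "t < 0 \<Longrightarrow> - signed_pow p t = (- t) powr (p - 1)"
    and signed_pow_nonneg: "0 \<le> t \<Longrightarrow> 0 \<le> signed_pow p t"
    and signed_pow_nonneg_imp: "0 \<le> signed_pow p t \<Longrightarrow> 0 \<le> t"
proof -
  show "- signed_pow p t = (- t) powr (p - 1)" if "t < 0"
    using that powr_minus_one_mult[of "- t" "p - 1"] by (simp add: signed_pow_def)
  show "0 \<le> signed_pow p t" if "0 \<le> t" using that by (simp add: signed_pow_def)
  show "0 \<le> t" if "0 \<le> signed_pow p t"
    using that by (cases "t = 0") (auto simp: signed_pow_def zero_le_mult_iff)
qed

locale radial_ivp =
  fixes N :: nat and p q \<alpha> a :: real and w w' F' :: "real \<Rightarrow> real"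
  assumes N: "1 \<le> N" and p: "1 < p" and q: "1 < q" and alpha_pos: "0 < \<alpha>" and a: "0 < a"
    and w_C1: "C1_halfline w w'" and flux_C1: "C1_halfline (\<lambda>r. signed_pow p (w' r)) F'"
    and ode: "\<And>r. 0 < r \<Longrightarrow> F' r + (real N - 1) / r * signed_pow p (w' r) + r * w' r + \<alpha> * w r
                 + \<bar>w r\<bar> powr (q - 1) * w r = 0"
    and w_0: "w 0 = a" and w'_0: "w' 0 = 0"
begin

definition "\<nu> = 1 / (p - 1)"

lemma nu_pos: "0 < \<nu>" using p by (simp add: \<nu>_def)

text \<open>The sign suits decreasing solutions: where \<open>w' < 0\<close>, \<open>\<psi>\<close>
  is \<open>|w'|^(p - 1)\<close>. Since \<open>1 + \<nu>\<close> is the conjugate exponent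
  \<open>p'\<close>, the power \<open>\<psi>^(1 + \<nu>)\<close> is then
  \<open>|w'|^p\<close>.\<close>

definition "\<psi> r = - signed_pow p (w' r)"

lemma at_within_halfline: "0 < r \<Longrightarrow> at r within {0..} = at (r::real)"
  by (rule at_within_open_subset[of _ "{0<..}"]) auto

lemma w_cont: "continuous_on {0..} w"
  using w_C1 unfolding C1_halfline_def by (meson atLeast_iff DERIV_continuous_on)

lemma psi_cont: "continuous_on {0..} \<psi>"
proof -
  have "continuous_on {0..} (\<lambda>r. signed_pow p (w' r))"
    using flux_C1 unfolding C1_halfline_def by (meson atLeast_iff DERIV_continuous_on)
  then show ?thesis unfolding \<psi>_def[abs_def] by (rule continuous_on_minus)
qed

lemma psi_0: "\<psi> 0 = 0" by (simp add: \<psi>_def signed_pow_def w'_0)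

lemma w_deriv: "0 < r \<Longrightarrow> (w has_real_derivative w' r) (at r)"
  using w_C1 at_within_halfline unfolding C1_halfline_def by (metis less_imp_le)

lemma flux_deriv: "0 < r \<Longrightarrow> ((\<lambda>r. signed_pow p (w' r)) has_real_derivative F' r) (at r)"
  using flux_C1 at_within_halfline unfolding C1_halfline_def by (metis less_imp_le)

text \<open>At a maximum of the flux on \<open>[0, r]\<close> where the flux is nonnegative the equation forces its
  derivative to be negative.\<close>

lemma w'_neg:
  assumes "0 < r" and w_pos: "\<And>s. 0 < s \<Longrightarrow> s \<le> r \<Longrightarrow> 0 < w s"
  shows "w' r < 0"
proof (rule ccontr)
  assume "\<not> w' r < 0"
  then have flux_r: "0 \<le> signed_pow p (w' r)" by (intro signed_pow_nonneg) simp
  define \<phi> where "\<phi> = (\<lambda>r. signed_pow p (w' r))"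
  have "continuous_on {0..r} \<phi>"
    using continuous_on_subset[OF continuous_on_minus[OF psi_cont], of "{0..r}"] by (simp add: \<psi>_def[abs_def] \<phi>_def)
  then obtain m where m: "m \<in> {0..r}" "\<And>s. s \<in> {0..r} \<Longrightarrow> \<phi> s \<le> \<phi> m"
    using continuous_attains_sup[of "{0..r}" \<phi>] \<open>0 < r\<close> by auto
  \<comment> \<open>A maximum at \<open>0\<close> can be moved to \<open>r\<close>, because the flux
    vanishes at \<open>0\<close> and is nonnegative at \<open>r\<close>; the equation is available
    only at positive radii.\<close>
  have "\<exists>x. 0 < x \<and> x \<le> r \<and> (\<forall>s\<in>{0..r}. \<phi> s \<le> \<phi> x)"
  proof (cases "m = 0")
    case True
    then have "\<phi> m \<le> \<phi> r" using flux_r psi_0 by (simp add: \<phi>_def \<psi>_def)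
    then have "\<phi> s \<le> \<phi> r" if "s \<in> {0..r}" for s using m(2)[OF that] by simp
    then show ?thesis using \<open>0 < r\<close> by (intro exI[of _ r]) auto
  next
    case False
    then show ?thesis using m by (intro exI[of _ m]) auto
  qed
  then obtain x where x: "0 < x" "x \<le> r" "\<And>s. s \<in> {0..r} \<Longrightarrow> \<phi> s \<le> \<phi> x" by blast
  have "0 \<le> \<phi> x" using x(3)[of r] flux_r \<open>0 < r\<close> by (simp add: \<phi>_def)
  then have "0 \<le> w' x" unfolding \<phi>_def by (rule signed_pow_nonneg_imp)
  have "0 \<le> (real N - 1) / x * \<phi> x" using N x(1) \<open>0 \<le> \<phi> x\<close> by simp
  moreover have "0 \<le> x * w' x" using x(1) \<open>0 \<le> w' x\<close> by simp
  moreover have "0 < \<alpha> * w x" "0 \<le> \<bar>w x\<bar> powr (q - 1) * w x"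
    using w_pos[OF x(1,2)] alpha_pos by auto
  ultimately have "F' x < 0" using ode[OF x(1)] unfolding \<phi>_def by linarith
  from DERIV_neg_dec_left[OF flux_deriv[OF x(1)] this]
  obtain d where d: "d > 0" "\<And>k. 0 < k \<Longrightarrow> k < d \<Longrightarrow> \<phi> x < \<phi> (x - k)" unfolding \<phi>_def by blast
  define k where "k = min (d / 2) (x / 2)"
  have "0 < k" "k < d" "k \<le> x" using d(1) x(1) by (auto simp: k_def)
  then show False using d(2)[of k] x(2) x(3)[of "x - k"] by auto
qed

lemma psi_pos:
  assumes "w' r < 0"
  shows "0 < \<psi> r" "\<psi> r powr \<nu> = - w' r"
  using signed_pow_neg[OF assms, of p] assms p by (auto simp: \<psi>_def \<nu>_def powr_powr)

lemma psi_deriv: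
  assumes "0 < r" "0 < w r" "w' r < 0"
  shows "(\<psi> has_real_derivative - (real N - 1) / r * \<psi> r - r * \<psi> r powr \<nu> + \<alpha> * w r + w r powr q) (at r)"
proof -
  have "w r powr (q - 1) * w r = w r powr q" by (rule powr_minus_one_mult[OF assms(2)])
  then have "- F' r = - (real N - 1) / r * \<psi> r - r * \<psi> r powr \<nu> + \<alpha> * w r + w r powr q"
    using ode[OF assms(1)] assms(2) psi_pos(2)[OF assms(3)]
    by (simp add: \<psi>_def left_diff_distrib diff_divide_distrib)
  then show ?thesis using DERIV_minus[OF flux_deriv[OF assms(1)]] by (simp add: \<psi>_def[abs_def])
qed

lemma w_deriv_psi:
  assumes "0 < r" "w' r < 0"
  shows "(w has_real_derivative - (\<psi> r powr \<nu>)) (at r)"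
  using w_deriv[OF assms(1)] psi_pos(2)[OF assms(2)] by simp

text \<open>An energy of Pohozaev type; \<open>\<mu>\<close> and \<open>\<sigma>\<close> are chosen separately in the two cases.\<close>

definition energy_bracket :: "real \<Rightarrow> real \<Rightarrow> real \<Rightarrow> real" where
  "energy_bracket \<mu> \<sigma> r = \<psi> r powr (1 + \<nu>) / (1 + \<nu>) + w r powr (q + 1) / (q + 1) + (\<alpha> + \<sigma> - \<mu>) * (w r)\<^sup>2 / 2
      - \<sigma> * (w r * \<psi> r / r)"

definition energy :: "real \<Rightarrow> real \<Rightarrow> real \<Rightarrow> real" where
  "energy \<mu> \<sigma> r = r powr \<mu> * energy_bracket \<mu> \<sigma> r"

text \<open>The identity comes from testing the equation with \<open>r^\<mu> w'\<close> and
  \<open>\<sigma> r^(\<mu> - 1) w\<close>. The coefficient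
  \<open>\<alpha> + \<sigma> - \<mu>\<close> in the energy reduces the mixed term to
  \<open>\<mu> r |w'| w\<close>, and completing the square leaves a multiple of \<open>w^2\<close>
  that factors.\<close>

lemma energy_deriv:
  assumes r: "0 < r" and w: "0 < w r" and w': "w' r < 0"
  shows "(energy \<mu> \<sigma> has_real_derivative r powr (\<mu> - 1) *
     ((\<mu> / (1 + \<nu>) - (real N - 1) + \<sigma>) * \<psi> r powr (1 + \<nu>) + (\<mu> / (q + 1) - \<sigma>) * w r powr (q + 1)
      - \<sigma> * (\<mu> - real N) * (w r * \<psi> r / r) - (r * \<psi> r powr \<nu> - \<mu> * w r / 2)\<^sup>2
      - (\<alpha> - \<mu> / 2) * (\<sigma> - \<mu> / 2) * (w r)\<^sup>2)) (at r)"
proof -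
  note psi = psi_pos[OF w'] and dw = w_deriv_psi[OF r w'] and dpsi = psi_deriv[OF r w w']
  define X where "X = \<psi> r powr \<nu>"
  define P where "P = - (real N - 1) / r * \<psi> r - r * X + \<alpha> * w r + w r powr q"
  have dw: "(w has_real_derivative - X) (at r)" using dw by (simp add: X_def)
  have dpsi: "(\<psi> has_real_derivative P) (at r)" using dpsi by (simp add: X_def P_def)
  have d1: "((\<lambda>r. \<psi> r powr (1 + \<nu>) / (1 + \<nu>)) has_real_derivative X * P) (at r)"
    using DERIV_cdivide[OF DERIV_fun_powr[OF dpsi psi(1), of "1 + \<nu>"], of "1 + \<nu>"] nu_pos by (simp add: X_def)
  have d2: "((\<lambda>r. w r powr (q + 1) / (q + 1)) has_real_derivative w r powr q * (- X)) (at r)"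
    using DERIV_cdivide[OF DERIV_fun_powr[OF dw w, of "q + 1"], of "q + 1"] q by simp
  have d3: "((\<lambda>r. (\<alpha> + \<sigma> - \<mu>) * (w r)\<^sup>2 / 2) has_real_derivative (\<alpha> + \<sigma> - \<mu>) * w r * (- X)) (at r)"
    unfolding power2_eq_square by (rule derivative_eq_intros refl dw)+ simp_all
  have d4: "((\<lambda>r. \<sigma> * (w r * \<psi> r / r)) has_real_derivative
      \<sigma> * (((- X) * \<psi> r + w r * P) / r - w r * \<psi> r / r\<^sup>2)) (at r)"
    using r by (auto intro!: derivative_eq_intros dw dpsi simp: field_simps power2_eq_square)
  have db: "(energy_bracket \<mu> \<sigma> has_real_derivative X * P + w r powr q * (- X) + (\<alpha> + \<sigma> - \<mu>) * w r * (- X)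
      - \<sigma> * (((- X) * \<psi> r + w r * P) / r - w r * \<psi> r / r\<^sup>2)) (at r)" (is "(_ has_real_derivative ?B) _")
    unfolding energy_bracket_def[abs_def] by (intro DERIV_add DERIV_diff d1 d2 d3 d4)
  have dr: "((\<lambda>r. r powr \<mu>) has_real_derivative \<mu> * r powr (\<mu> - 1)) (at r)"
    by (rule has_real_derivative_powr[OF r])
  have "(energy \<mu> \<sigma> has_real_derivative \<mu> * r powr (\<mu> - 1) * energy_bracket \<mu> \<sigma> r + ?B * r powr \<mu>) (at r)"
    unfolding energy_def[abs_def] by (rule DERIV_mult[OF dr db])
  moreover have "\<mu> * r powr (\<mu> - 1) * energy_bracket \<mu> \<sigma> r + ?B * r powr \<mu>
     = r powr (\<mu> - 1) * (\<mu> * energy_bracket \<mu> \<sigma> r + r * ?B)"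
  proof -
    obtain B where B: "?B = B" by blast
    show ?thesis
      unfolding B powr_minus_one_mult[OF r, of \<mu>, symmetric] by (simp add: algebra_simps)
  qed
  moreover have "\<mu> * energy_bracket \<mu> \<sigma> r + r * ?B =
      (\<mu> / (1 + \<nu>) - (real N - 1) + \<sigma>) * \<psi> r powr (1 + \<nu>) + (\<mu> / (q + 1) - \<sigma>) * w r powr (q + 1)
      - \<sigma> * (\<mu> - real N) * (w r * \<psi> r / r) - (r * \<psi> r powr \<nu> - \<mu> * w r / 2)\<^sup>2
      - (\<alpha> - \<mu> / 2) * (\<sigma> - \<mu> / 2) * (w r)\<^sup>2"
  proof -
    define W where "W = w r powr q"
    define s where "s = \<psi> r"
    define u where "u = w r"
    \<comment> \<open>Reciprocals become atoms so that a polynomial identity remains, with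
      \<open>r * k = 1\<close> applied by hand.\<close>
    obtain i where i: "1 / (1 + \<nu>) = i" by blast
    obtain j where j: "1 / (q + 1) = j" by blast
    obtain k where k: "1 / r = k" by blast
    have rk: "r * k = 1" using r k by auto
    have e1: "\<psi> r powr (1 + \<nu>) = X * s" using psi by (simp add: X_def s_def powr_add)
    have e2: "w r powr (q + 1) = W * u" using w by (simp add: W_def u_def powr_add)
    have ei: "x / (1 + \<nu>) = x * i" "x / (q + 1) = x * j" "x / r = x * k" "x / r\<^sup>2 = x * (k * k)" for x
      unfolding i[symmetric] j[symmetric] k[symmetric] by (auto simp: power2_eq_square)
    have "r * ?B = r * (X * P - W * X - (\<alpha> + \<sigma> - \<mu>) * u * X) + \<sigma> * X * s * (r * k) - \<sigma> * u * P * (r * k)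
        + \<sigma> * u * s * k * (r * k)"
      unfolding ei W_def u_def s_def by (simp add: algebra_simps)
    also have "\<dots> = r * (X * P - W * X - (\<alpha> + \<sigma> - \<mu>) * u * X) + \<sigma> * X * s - \<sigma> * u * P + \<sigma> * u * s * k"
      unfolding rk by simp
    finally have B: "r * ?B = r * (X * P - W * X - (\<alpha> + \<sigma> - \<mu>) * u * X) + \<sigma> * X * s - \<sigma> * u * P + \<sigma> * u * s * k" .
    have "r * (X * P) = X * (- (real N - 1) * s * (r * k) - r * r * X + r * \<alpha> * u + r * W)"
      unfolding P_def ei W_def u_def s_def by (simp add: algebra_simps)
    then have XP: "r * (X * P) = X * (- (real N - 1) * s - r * r * X + r * \<alpha> * u + r * W)" unfolding rk by simp
    have uP: "\<sigma> * u * P = \<sigma> * u * (- (real N - 1) * s * k - r * X + \<alpha> * u + W)"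
      unfolding P_def ei W_def u_def s_def by (simp add: algebra_simps)
    show ?thesis
      unfolding B energy_bracket_def e1 e2 X_def[symmetric]
      unfolding ei u_def[symmetric] s_def[symmetric] right_diff_distrib[of r] XP uP
      by (simp add: algebra_simps power2_eq_square add_divide_distrib diff_divide_distrib)
  qed
  ultimately show ?thesis by (simp only:)
qed

end

text \<open>The condition \<open>square\<close> makes the quadratic form in \<open>r w'\<close> and \<open>w\<close> that appears in the derivative of
  the energy a negative perfect square.\<close>

locale radial_energy = radial_ivp +
  fixes \<mu> \<sigma> :: real
  assumes mu: "real N \<le> \<mu>" and sigma: "0 < \<sigma>"
    and flux_coeff: "\<mu> / (1 + \<nu>) - (real N - 1) + \<sigma> \<le> 0"
    and power_coeff: "\<mu> / (q + 1) \<le> \<sigma>"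
    and square: "(\<alpha> - \<mu> / 2) * (\<sigma> - \<mu> / 2) = 0"
    and strict: "\<mu> / (q + 1) < \<sigma> \<or> real N < \<mu>"
begin

lemma energy_deriv_neg:
  assumes r: "0 < r" and w: "0 < w r" and w': "w' r < 0"
  shows "\<exists>d<0. (energy \<mu> \<sigma> has_real_derivative d) (at r)"
proof -
  note psi = psi_pos(1)[OF w']
  have 1: "(\<mu> / (1 + \<nu>) - (real N - 1) + \<sigma>) * \<psi> r powr (1 + \<nu>) \<le> 0"
    using flux_coeff by (intro mult_nonpos_nonneg) auto
  have 2: "(\<mu> / (q + 1) - \<sigma>) * w r powr (q + 1) \<le> 0"
    using power_coeff by (intro mult_nonpos_nonneg) auto
  have 3: "0 \<le> \<sigma> * (\<mu> - real N) * (w r * \<psi> r / r)"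
    using sigma mu w psi r by simp
  have "(\<mu> / (q + 1) - \<sigma>) * w r powr (q + 1) < 0 \<or> 0 < \<sigma> * (\<mu> - real N) * (w r * \<psi> r / r)"
    using strict
  proof
    assume "\<mu> / (q + 1) < \<sigma>"
    then show ?thesis using w by (intro disjI1 mult_neg_pos) auto
  next
    assume "real N < \<mu>"
    then show ?thesis using sigma w psi r by (intro disjI2 mult_pos_pos divide_pos_pos) auto
  qed
  moreover have "0 \<le> (r * \<psi> r powr \<nu> - \<mu> * w r / 2)\<^sup>2" by simp
  ultimately have "(\<mu> / (1 + \<nu>) - (real N - 1) + \<sigma>) * \<psi> r powr (1 + \<nu>) + (\<mu> / (q + 1) - \<sigma>) * w r powr (q + 1)
      - \<sigma> * (\<mu> - real N) * (w r * \<psi> r / r) - (r * \<psi> r powr \<nu> - \<mu> * w r / 2)\<^sup>2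
      - (\<alpha> - \<mu> / 2) * (\<sigma> - \<mu> / 2) * (w r)\<^sup>2 < 0"
    unfolding square using 1 2 3 by linarith
  then show ?thesis using energy_deriv[OF assms] r by (intro exI conjI) (auto intro: mult_pos_neg)
qed

text \<open>The term with \<open>\<psi> / r\<close> forces a factor \<open>r\<close> into the
  bracket. The remaining weight \<open>r^(\<mu> - 1)\<close> stays bounded because
  \<open>\<mu> \<ge> N \<ge> 1\<close>, and the rest vanishes because \<open>\<psi>\<close> does at
  \<open>0\<close>.\<close>

lemma energy_tendsto_0: "(energy \<mu> \<sigma> \<longlongrightarrow> 0) (at_right 0)"
  if nonneg: "eventually (\<lambda>r. 0 \<le> \<psi> r \<and> 0 \<le> w r) (at_right 0)"
proof -
  have at0: "(f \<longlongrightarrow> f 0) (at_right 0)" if "continuous_on {0..} f" for f :: "real \<Rightarrow> real"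
  proof -
    have "(f \<longlongrightarrow> f 0) (at 0 within {0..})" using that by (simp add: continuous_on)
    then show ?thesis by (rule tendsto_within_subset) auto
  qed
  have w: "(w \<longlongrightarrow> a) (at_right 0)" using at0[OF w_cont] by (simp add: w_0)
  have psi: "(\<psi> \<longlongrightarrow> 0) (at_right 0)" using at0[OF psi_cont] by (simp add: psi_0)
  have psi_pw: "((\<lambda>r. \<psi> r powr (1 + \<nu>)) \<longlongrightarrow> 0) (at_right 0)"
    using nonneg nu_pos by (intro tendsto_zero_powrI[OF psi tendsto_const]) (auto elim: eventually_mono)
  define B where "B = (\<lambda>r. r * (\<psi> r powr (1 + \<nu>) / (1 + \<nu>) + w r powr (q + 1) / (q + 1) + (\<alpha> + \<sigma> - \<mu>) * (w r)\<^sup>2 / 2)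
      - \<sigma> * (w r * \<psi> r))"
  have "(B \<longlongrightarrow> 0 * (0 / (1 + \<nu>) + a powr (q + 1) / (q + 1) + (\<alpha> + \<sigma> - \<mu>) * a\<^sup>2 / 2) - \<sigma> * (a * 0)) (at_right 0)"
    unfolding B_def using nu_pos q a by (intro tendsto_intros psi_pw w psi) auto
  then have "(B \<longlongrightarrow> 0) (at_right 0)" by simp
  moreover have "eventually (\<lambda>r. norm (r powr (\<mu> - 1)) \<le> 1) (at_right 0)"
    using eventually_at_right_less[of 0] eventually_at_right_real[of 0 1, simplified]
  proof eventually_elim
    case (elim r)
    then show ?case using mu N by (auto intro!: powr_le1)
  qed
  ultimately have "((\<lambda>r. r powr (\<mu> - 1) * B r) \<longlongrightarrow> 0) (at_right 0)"
    by (intro lim_null_mult_left_bounded)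
  moreover have "eventually (\<lambda>r. r powr (\<mu> - 1) * B r = energy \<mu> \<sigma> r) (at_right 0)"
    using eventually_at_right_less[of 0]
  proof eventually_elim
    case (elim r)
    have "r * energy_bracket \<mu> \<sigma> r = B r"
      using elim by (simp add: energy_bracket_def B_def right_diff_distrib)
    then show ?case
      unfolding energy_def powr_minus_one_mult[OF elim, of \<mu>, symmetric] by (simp add: mult.assoc)
  qed
  ultimately show ?thesis by (rule Lim_transform_eventually)
qed

lemma energy_cont:
  assumes "0 < s" "\<And>r. s \<le> r \<Longrightarrow> r \<le> t \<Longrightarrow> 0 \<le> \<psi> r \<and> 0 \<le> w r"
  shows "continuous_on {s..t} (energy \<mu> \<sigma>)"
proof -
  have c: "continuous_on {s..t} w" "continuous_on {s..t} \<psi>"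
    using assms(1) by (auto intro: continuous_on_subset[OF w_cont] continuous_on_subset[OF psi_cont])
  show ?thesis
    unfolding energy_def[abs_def] energy_bracket_def
    using assms nu_pos q by (intro continuous_intros continuous_on_powr' c) auto
qed

lemma energy_decreasing:
  assumes "0 < R" and w_pos: "\<And>r. 0 < r \<Longrightarrow> r < R \<Longrightarrow> 0 < w r" and "0 < s" "s < t" "t \<le> R"
  shows "energy \<mu> \<sigma> t < energy \<mu> \<sigma> s"
proof -
  have w'n: "w' r < 0" if "0 < r" "r < R" for r
    using that by (intro w'_neg w_pos) auto
  \<comment> \<open>The endpoint \<open>R\<close> is included, since it will be a first zero of
    \<open>w\<close>; there the signs are inherited as limits from the left.\<close>
  have nonneg: "0 \<le> \<psi> r \<and> 0 \<le> w r" if r: "s \<le> r" "r \<le> t" for r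
  proof -
    have lim: "((\<lambda>x. f x) \<longlongrightarrow> f r) (at_left r)" if "continuous_on {0..} f" for f :: "real \<Rightarrow> real"
    proof -
      have "isCont f r"
        using that assms(3) r by (intro continuous_on_interior[of "{0..}"]) auto
      then show ?thesis by (simp add: isCont_def filterlim_at_split)
    qed
    have ev: "eventually (\<lambda>x. 0 < x \<and> x < R) (at_left r)"
      using eventually_at_left_real[of 0 r] assms r by (auto elim!: eventually_mono)
    have "0 \<le> \<psi> r"
      by (rule tendsto_lowerbound[OF lim[OF psi_cont]])
         (use ev in \<open>auto elim!: eventually_mono intro!: less_imp_le psi_pos(1) w'n\<close>)
    moreover have "0 \<le> w r"
      by (rule tendsto_lowerbound[OF lim[OF w_cont]])
         (use ev in \<open>auto elim!: eventually_mono intro!: less_imp_le w_pos\<close>)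
    ultimately show ?thesis by blast
  qed
  show ?thesis
  proof (rule DERIV_neg_imp_decreasing_open[OF \<open>s < t\<close>])
    show "continuous_on {s..t} (energy \<mu> \<sigma>)" by (rule energy_cont[OF \<open>0 < s\<close> nonneg])
    fix x assume "s < x" "x < t"
    then show "\<exists>y. (energy \<mu> \<sigma> has_real_derivative y) (at x) \<and> y < 0"
      using energy_deriv_neg[of x] w_pos[of x] w'n[of x] assms by auto
  qed
qed

lemma energy_neg:
  assumes "0 < R" and w_pos: "\<And>r. 0 < r \<Longrightarrow> r < R \<Longrightarrow> 0 < w r" and "0 < t" "t \<le> R"
  shows "energy \<mu> \<sigma> t < 0"
proof -
  have w'n: "w' r < 0" if "0 < r" "r < R" for r
    using that by (intro w'_neg w_pos) auto
  have "eventually (\<lambda>r. 0 \<le> \<psi> r \<and> 0 \<le> w r) (at_right 0)"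
    using eventually_at_right_real[OF \<open>0 < R\<close>]
    by eventually_elim (use psi_pos(1) w'n w_pos in \<open>auto intro: less_imp_le\<close>)
  note lim = energy_tendsto_0[OF this]
  \<comment> \<open>The limit at \<open>0\<close> gives only a weak inequality; strictness comes
    from the decrease between \<open>t / 2\<close> and \<open>t\<close>.\<close>
  have "energy \<mu> \<sigma> (t / 2) \<le> 0"
  proof (rule tendsto_lowerbound[OF lim])
    show "eventually (\<lambda>r. energy \<mu> \<sigma> (t / 2) \<le> energy \<mu> \<sigma> r) (at_right 0)"
      using eventually_at_right_real[of 0 "t / 2"] assms
      by (auto elim!: eventually_mono intro!: less_imp_le energy_decreasing[of R])
  qed simp
  then show ?thesis using energy_decreasing[OF assms(1) w_pos, of "t / 2" t] assms by auto
qed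

lemma w_pos: "0 \<le> r \<Longrightarrow> 0 < w r"
proof (rule ccontr)
  assume r: "0 \<le> r" and "\<not> 0 < w r"
  define S where "S = {s \<in> {0..r}. w s = 0}"
  have cont: "continuous_on {0..s} w" for s by (rule continuous_on_subset[OF w_cont]) auto
  have "S = {0..r} \<inter> w -` {0}" by (auto simp: S_def)
  then have "closed S"
    using continuous_on_closed_vimage[of "{0..r}" w] cont[of r] by (metis closed_real_atLeastAtMost closed_singleton inf_commute)
  moreover have bb: "bdd_below S" by (rule bdd_belowI[of _ 0]) (auto simp: S_def)
  moreover have "S \<noteq> {}"
    using IVT2'[of w r 0 0] \<open>\<not> 0 < w r\<close> a r cont[of r] by (auto simp: S_def w_0)
  ultimately have inS: "Inf S \<in> S" using closed_contains_Inf by blast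
  define R where "R = Inf S"
  have R: "0 \<le> R" "R \<le> r" "w R = 0" using inS by (auto simp: S_def R_def)
  then have R_pos: "0 < R" using a w_0 by (cases "R = 0") auto
  have pos: "0 < w s" if s: "0 < s" "s < R" for s
  proof (rule ccontr)
    assume "\<not> 0 < w s"
    then obtain x where "0 \<le> x" "x \<le> s" "w x = 0"
      using IVT2'[of w s 0 0] a s(1) cont[of s] by (auto simp: w_0 not_less)
    then have "R \<le> x" unfolding R_def using that R by (intro cInf_lower bb) (auto simp: S_def)
    then show False using \<open>x \<le> s\<close> that by simp
  qed
  have "energy \<mu> \<sigma> R = R powr \<mu> * (\<psi> R powr (1 + \<nu>) / (1 + \<nu>))"
    using q by (simp add: energy_def energy_bracket_def R(3))
  moreover have "0 \<le> R powr \<mu> * (\<psi> R powr (1 + \<nu>) / (1 + \<nu>))" using nu_pos by simp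
  ultimately show False using energy_neg[OF R_pos pos R_pos] by simp
qed

lemma w'_less_0: "0 < r \<Longrightarrow> w' r < 0"
  by (intro w'_neg w_pos) auto

lemma w_decreasing:
  assumes "0 < r" "r \<le> s"
  shows "w s \<le> w r"
proof (rule DERIV_nonpos_imp_nonincreasing[OF assms(2)])
  fix x assume "r \<le> x"
  then have "0 < x" using assms(1) by simp
  then show "\<exists>y. (w has_real_derivative y) (at x) \<and> y \<le> 0"
    using w_deriv w'_less_0 less_imp_le by blast
qed

text \<open>The unweighted mechanical energy decreases, because both first-order terms of the
  equation act as friction.\<close>

lemma psi_bounded: "\<exists>C. \<forall>r\<ge>1. \<psi> r \<le> C"
proof -
  define E where "E = (\<lambda>r. \<psi> r powr (1 + \<nu>) / (1 + \<nu>) + \<alpha> * (w r)\<^sup>2 / 2 + w r powr (q + 1) / (q + 1))"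
  have dec: "E r \<le> E 1" if "1 \<le> r" for r
  proof (rule DERIV_nonpos_imp_nonincreasing[OF that])
    fix x :: real assume x: "1 \<le> x" "x \<le> r"
    then have x0: "0 < x" by simp
    note w = w_pos[OF less_imp_le[OF x0]] and w' = w'_less_0[OF x0]
    note psi = psi_pos(1)[OF w'] and dw = w_deriv_psi[OF x0 w'] and dpsi = psi_deriv[OF x0 w w']
    have d1: "((\<lambda>r. \<psi> r powr (1 + \<nu>) / (1 + \<nu>)) has_real_derivative \<psi> x powr \<nu> *
        (- (real N - 1) / x * \<psi> x - x * \<psi> x powr \<nu> + \<alpha> * w x + w x powr q)) (at x)"
      using DERIV_cdivide[OF DERIV_fun_powr[OF dpsi psi, of "1 + \<nu>"], of "1 + \<nu>"] nu_pos by simp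
    have d2: "((\<lambda>r. w r powr (q + 1) / (q + 1)) has_real_derivative w x powr q * (- (\<psi> x powr \<nu>))) (at x)"
      using DERIV_cdivide[OF DERIV_fun_powr[OF dw w, of "q + 1"], of "q + 1"] q by simp
    have d3: "((\<lambda>r. \<alpha> * (w r)\<^sup>2 / 2) has_real_derivative \<alpha> * w x * (- (\<psi> x powr \<nu>))) (at x)"
      unfolding power2_eq_square by (rule derivative_eq_intros refl dw)+ simp_all
    have "(E has_real_derivative \<psi> x powr \<nu> * (- (real N - 1) / x * \<psi> x - x * \<psi> x powr \<nu> + \<alpha> * w x + w x powr q)
       + \<alpha> * w x * (- (\<psi> x powr \<nu>)) + w x powr q * (- (\<psi> x powr \<nu>))) (at x)" (is "(_ has_real_derivative ?D) _")
      unfolding E_def by (intro DERIV_add d1 d2 d3)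
    moreover have "?D = - (\<psi> x powr \<nu> * ((real N - 1) / x * \<psi> x + x * \<psi> x powr \<nu>))"
    proof -
      obtain k where k: "(real N - 1) / x = k" by blast
      then have "- (real N - 1) / x = - k" by (simp only: minus_divide_left)
      then show ?thesis unfolding k by (simp add: algebra_simps)
    qed
    moreover have "0 \<le> \<psi> x powr \<nu> * ((real N - 1) / x * \<psi> x + x * \<psi> x powr \<nu>)"
      using N x0 psi by (intro mult_nonneg_nonneg add_nonneg_nonneg) auto
    ultimately show "\<exists>y. (E has_real_derivative y) (at x) \<and> y \<le> 0" by (intro exI[of _ ?D]) auto
  qed
  have "\<psi> r \<le> max 1 ((1 + \<nu>) * E 1)" if r: "1 \<le> r" for r
  proof (cases "\<psi> r \<le> 1")
    case False
    have "\<psi> r powr 1 \<le> \<psi> r powr (1 + \<nu>)" using False nu_pos by (intro powr_mono) auto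
    moreover have "\<psi> r powr (1 + \<nu>) / (1 + \<nu>) \<le> E r"
      using alpha_pos w_pos[of r] r q by (simp add: E_def)
    then have "\<psi> r powr (1 + \<nu>) \<le> (1 + \<nu>) * E 1"
    proof -
      have "\<psi> r powr (1 + \<nu>) / (1 + \<nu>) \<le> E 1"
        using \<open>\<psi> r powr (1 + \<nu>) / (1 + \<nu>) \<le> E r\<close> dec[OF r] by simp
      then show ?thesis using nu_pos by (simp add: field_simps)
    qed
    ultimately show ?thesis using False by simp
  qed simp
  then show ?thesis by blast
qed

text \<open>The derivative of \<open>\<psi> / r - w\<close> is
  \<open>(\<alpha> w + w^q) / r - N \<psi> / r^2\<close>, since \<open>w'\<close> cancels the
  contribution of \<open>r w'\<close>. If \<open>w \<ge> e\<close> persisted, this function would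
  grow at least like \<open>\<alpha> e ln r\<close>, although \<open>\<psi>\<close> is bounded and
  \<open>w\<close> positive.\<close>

lemma w_tendsto_0: "(w \<longlongrightarrow> 0) at_top"
proof (rule tendstoI)
  fix e :: real assume e: "0 < e"
  have "\<exists>R\<ge>1. w R < e"
  proof (rule ccontr)
    assume "\<not> ?thesis"
    then have ge: "e \<le> w r" if "1 \<le> r" for r using that by force
    obtain C where C: "\<And>r. 1 \<le> r \<Longrightarrow> \<psi> r \<le> C" using psi_bounded by blast
    have "0 < C" using C[of 1] psi_pos(1)[OF w'_less_0[of 1]] by simp
    define G where "G = (\<lambda>r. \<psi> r / r - w r - \<alpha> * e * ln r - real N * C / r)"
    have G_inc: "G 1 \<le> G r" if "1 \<le> r" for r
    proof (rule DERIV_nonneg_imp_nondecreasing[OF that])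
      fix x :: real assume x: "1 \<le> x" "x \<le> r"
      then have x0: "0 < x" by simp
      note w = w_pos[OF less_imp_le[OF x0]] and w' = w'_less_0[OF x0]
      note psi = psi_pos(1)[OF w'] and dw = w_deriv_psi[OF x0 w'] and dpsi = psi_deriv[OF x0 w w']
      define D where "D = (real N * (C - \<psi> x) + x * (\<alpha> * (w x - e) + w x powr q)) / x\<^sup>2"
      obtain X where X: "\<psi> x powr \<nu> = X" by blast
      obtain W where W: "w x powr q = W" by blast
      have "(G has_real_derivative ((- (real N - 1) / x * \<psi> x - x * X + \<alpha> * w x + W) * x - \<psi> x * 1) / (x * x)
          - (- X) - \<alpha> * e * (1 / x) - (0 * x - real N * C * 1) / (x * x)) (at x)"
        unfolding G_def using x0 dw dpsi unfolding X W
        by (intro DERIV_diff DERIV_divide DERIV_cmult DERIV_ln_divide DERIV_const DERIV_ident) auto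
      moreover have "((- (real N - 1) / x * \<psi> x - x * X + \<alpha> * w x + W) * x - \<psi> x * 1) / (x * x)
          - (- X) - \<alpha> * e * (1 / x) - (0 * x - real N * C * 1) / (x * x) = D"
        unfolding D_def W using x0 by (simp add: field_simps power2_eq_square)
      ultimately have "(G has_real_derivative D) (at x)" by (simp only:)
      moreover have "0 \<le> D"
      proof -
        have "0 \<le> \<alpha> * (w x - e)" using ge[OF x(1)] alpha_pos by simp
        moreover have "0 \<le> real N * (C - \<psi> x)" using C[OF x(1)] by simp
        ultimately show ?thesis unfolding D_def using x0 by (intro divide_nonneg_pos add_nonneg_nonneg mult_nonneg_nonneg[of x]) auto
      qed
      ultimately show "\<exists>y. (G has_real_derivative y) (at x) \<and> 0 \<le> y" by blast
    qed
    \<comment> \<open>At \<open>r = exp L\<close> the upper bound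
      \<open>C - \<alpha> * e * ln r\<close> of \<open>G\<close> has fallen below
      \<open>G 1\<close>.\<close>
    define L where "L = max 0 ((C - G 1) / (\<alpha> * e)) + 1"
    have L: "0 \<le> L" "C - G 1 < \<alpha> * e * L"
    proof -
      have "C - G 1 = \<alpha> * e * ((C - G 1) / (\<alpha> * e))" using alpha_pos e by simp
      also have "\<dots> < \<alpha> * e * L" using alpha_pos e by (intro mult_strict_left_mono) (auto simp: L_def)
      finally show "C - G 1 < \<alpha> * e * L" .
    qed (simp add: L_def)
    have r: "1 \<le> exp L" using L(1) by simp
    have "\<psi> (exp L) / exp L \<le> C / 1" using C[OF r] \<open>0 < C\<close> r by (intro frac_le) auto
    moreover have "0 < w (exp L)" by (rule w_pos) simp
    moreover have "0 \<le> real N * C / exp L" using \<open>0 < C\<close> by simp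
    ultimately have "G (exp L) \<le> C - \<alpha> * e * L" by (simp add: G_def)
    then show False using G_inc[OF r] L(2) by simp
  qed
  then obtain R where R: "1 \<le> R" "w R < e" by blast
  have "dist (w r) 0 < e" if "R \<le> r" for r
    using w_decreasing[of R r] that R w_pos[of r] by (simp add: dist_real_def)
  then show "eventually (\<lambda>r. dist (w r) 0 < e) at_top" using eventually_at_top_linorder by blast
qed

end

section \<open>Asymptotic behaviour of radial solutions\<close>

context radial_energy
begin

text \<open>The Emden-Fowler change of variables \<open>t = ln r\<close>, \<open>y = r^\<delta> w\<close>, \<open>Y = r^(\<delta> - 1) |w'|^(p - 1)\<close>.\<close>

lemma emden_system_exists:
  assumes p2: "p < 2" and N_gt: "delta p < real N" and alpha_ge: "delta p \<le> \<alpha>"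
  obtains c where "emden_system \<nu> (delta p) (real N - delta p) \<alpha> q (\<mu> - 2 * delta p) c
    (\<lambda>t. exp (delta p * t) * w (exp t)) (\<lambda>t. exp ((delta p - 1) * t) * \<psi> (exp t)) (\<lambda>t. w (exp t) powr (q - 1))"
proof -
  define \<delta> where "\<delta> = delta p"
  have delta: "0 < \<delta>" using p p2 by (simp add: \<delta>_def delta_def)
  have nu: "1 < \<nu>" using p p2 by (simp add: \<nu>_def)
  \<comment> \<open>This relation determines \<open>\<delta>\<close>: it makes
    \<open>r^(\<delta> + 1) |w'|\<close> equal to \<open>Y^\<nu>\<close>, so that the powers of
    \<open>r\<close> disappear.\<close>
  have dn: "(\<delta> - 1) * \<nu> = \<delta> + 1"
  proof -
    have "\<delta> - 1 = 2 * (p - 1) / (2 - p)" "\<delta> + 1 = 2 / (2 - p)"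
      using p2 by (auto simp: \<delta>_def delta_def field_simps)
    moreover obtain k where k: "p - 1 = k" by blast
    moreover have "k \<noteq> 0" using p k by simp
    ultimately show ?thesis unfolding \<nu>_def k by simp
  qed
  define y where "y = (\<lambda>t. exp (\<delta> * t) * w (exp t))"
  define Y where "Y = (\<lambda>t. exp ((\<delta> - 1) * t) * \<psi> (exp t))"
  define h where "h = (\<lambda>t. w (exp t) powr (q - 1))"
  note wp = w_pos[OF less_imp_le[OF exp_gt_zero]] and w'n = w'_less_0[OF exp_gt_zero]
  note psip = psi_pos(1)[OF w'n]
  have Y_powr: "Y t powr a = exp ((\<delta> - 1) * a * t) * \<psi> (exp t) powr a" for t a
    using psip[of t] by (simp add: Y_def powr_mult exp_powr_real mult_ac)
  have Y_nu: "Y t powr \<nu> = exp (\<delta> * t) * (exp t * \<psi> (exp t) powr \<nu>)" for t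
    unfolding Y_powr dn by (simp add: distrib_right exp_add)
  have y_deriv: "(y has_real_derivative \<delta> * y t - Y t powr \<nu>) (at t)" for t
  proof -
    have "((\<lambda>t. w (exp t)) has_real_derivative - (\<psi> (exp t) powr \<nu>) * exp t) (at t)"
      by (rule DERIV_chain2[OF w_deriv_psi[OF exp_gt_zero w'n] DERIV_exp])
    then have "(y has_real_derivative exp (\<delta> * t) * \<delta> * w (exp t) + - (\<psi> (exp t) powr \<nu>) * exp t * exp (\<delta> * t)) (at t)"
      unfolding y_def by (auto intro!: derivative_eq_intros)
    then show ?thesis unfolding Y_nu y_def by (simp add: algebra_simps)
  qed
  have source_eq: "(\<alpha> + h t) * y t = exp (\<delta> * t) * (\<alpha> * w (exp t) + w (exp t) powr q)" for t
    using powr_minus_one_mult[OF wp[of t], of q] by (simp add: h_def y_def algebra_simps)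
  have Y_deriv: "(Y has_real_derivative - (real N - \<delta>) * Y t - Y t powr \<nu> + (\<alpha> + h t) * y t) (at t)" for t
  proof -
    define P where "P = - (real N - 1) / exp t * \<psi> (exp t) - exp t * \<psi> (exp t) powr \<nu> + \<alpha> * w (exp t) + w (exp t) powr q"
    have "((\<lambda>t. \<psi> (exp t)) has_real_derivative P * exp t) (at t)"
      unfolding P_def by (rule DERIV_chain2[OF psi_deriv[OF exp_gt_zero wp w'n] DERIV_exp])
    then have "(Y has_real_derivative exp ((\<delta> - 1) * t) * (\<delta> - 1) * \<psi> (exp t) + P * exp t * exp ((\<delta> - 1) * t)) (at t)"
      unfolding Y_def by (auto intro!: derivative_eq_intros)
    moreover have e1: "exp t * exp ((\<delta> - 1) * t) = exp (\<delta> * t)"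
      by (simp add: left_diff_distrib flip: exp_add)
    moreover have e2: "P * exp t = - (real N - 1) * \<psi> (exp t)
        + exp t * (\<alpha> * w (exp t) + w (exp t) powr q - exp t * \<psi> (exp t) powr \<nu>)"
    proof -
      have "- (real N - 1) / exp t * \<psi> (exp t) * exp t = - (real N - 1) * \<psi> (exp t)" by simp
      then show ?thesis
        unfolding P_def distrib_right left_diff_distrib[of _ _ "exp t"] by (simp only:) (simp add: algebra_simps)
    qed
    have "exp ((\<delta> - 1) * t) * (\<delta> - 1) * \<psi> (exp t) + P * exp t * exp ((\<delta> - 1) * t)
        = - (real N - \<delta>) * Y t - Y t powr \<nu> + (\<alpha> + h t) * y t"
    proof -
      obtain G where G: "exp ((\<delta> - 1) * t) = G" by blast
      show ?thesis
        unfolding source_eq Y_nu e2 e1[symmetric] unfolding Y_def G by (simp add: algebra_simps)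
    qed
    ultimately show ?thesis by (simp only:)
  qed
  have h_deriv: "(h has_real_derivative - (q - 1) * h t * (Y t powr \<nu> / y t)) (at t)" for t
  proof -
    have "((\<lambda>t. w (exp t)) has_real_derivative - (\<psi> (exp t) powr \<nu>) * exp t) (at t)"
      by (rule DERIV_chain2[OF w_deriv_psi[OF exp_gt_zero w'n] DERIV_exp])
    from DERIV_fun_powr[OF this wp, of "q - 1"]
    have "(h has_real_derivative (q - 1) * w (exp t) powr (q - 1 - 1) * (- (\<psi> (exp t) powr \<nu>) * exp t)) (at t)"
      by (simp add: h_def)
    moreover have e1: "Y t powr \<nu> / y t = exp t * \<psi> (exp t) powr \<nu> / w (exp t)"
      unfolding Y_nu y_def by simp
    moreover have e2: "w (exp t) powr (q - 1 - 1) = h t / w (exp t)"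
      using powr_minus_one_mult[OF wp[of t], of "q - 1"] wp[of t] by (simp add: h_def field_simps)
    have "(q - 1) * w (exp t) powr (q - 1 - 1) * (- (\<psi> (exp t) powr \<nu>) * exp t)
        = - (q - 1) * h t * (Y t powr \<nu> / y t)"
      unfolding e1 e2 by (simp only: mult_minus_left mult_minus_right times_divide_eq_right times_divide_eq_left mult_ac)
    ultimately show ?thesis by (simp only:)
  qed
  have h_lim: "(h \<longlongrightarrow> 0) at_top"
  proof -
    have lim: "((\<lambda>t. w (exp t)) \<longlongrightarrow> 0) at_top"
      by (rule filterlim_compose[OF w_tendsto_0 exp_at_top])
    show ?thesis unfolding h_def
      by (rule tendsto_zero_powrI[OF lim tendsto_const]) (use wp q in \<open>auto intro: always_eventually less_imp_le\<close>)
  qed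
  define V where "V = - energy \<mu> \<sigma> 1"
  have V: "0 < V" using energy_neg[of 1 1] w_pos by (simp add: V_def)
  \<comment> \<open>Dropping the two nonnegative powers from the energy leaves
    \<open>\<psi> w / r\<close> and \<open>w^2\<close>; the absolute value allows for either sign of
    the coefficient of \<open>w^2\<close>.\<close>
  define K where "K = \<sigma> + \<bar>\<alpha> + \<sigma> - \<mu>\<bar>"
  have K: "0 < K" using sigma by (simp add: K_def)
  have slow: "V / K * exp (- (\<mu> - 2 * \<delta>) * t) \<le> y t * Y t + (y t)\<^sup>2" if t: "0 \<le> t" for t
  proof -
    define e where "e = \<alpha> + \<sigma> - \<mu>"
    define m where "m = w (exp t) * \<psi> (exp t) / exp t"
    have m: "0 < m" using wp[of t] psip[of t] by (simp add: m_def)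
    have E: "energy \<mu> \<sigma> (exp t) \<le> - V"
    proof (cases "t = 0")
      case False
      then have "energy \<mu> \<sigma> (exp t) < energy \<mu> \<sigma> 1"
        using t w_pos by (intro energy_decreasing[of "exp t"]) auto
      then show ?thesis by (simp add: V_def)
    qed (simp add: V_def)
    have "energy_bracket \<mu> \<sigma> (exp t) \<ge> e * (w (exp t))\<^sup>2 / 2 - \<sigma> * m"
      using nu_pos q unfolding energy_bracket_def e_def m_def by simp
    moreover have "e * (w (exp t))\<^sup>2 / 2 \<ge> - (\<bar>e\<bar> * (w (exp t))\<^sup>2)"
    proof -
      have "\<bar>e * (w (exp t))\<^sup>2\<bar> = \<bar>e\<bar> * (w (exp t))\<^sup>2" by (simp add: abs_mult)
      then show ?thesis by linarith
    qed
    moreover have "\<sigma> * m \<le> K * m" "\<bar>e\<bar> * (w (exp t))\<^sup>2 \<le> K * (w (exp t))\<^sup>2"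
      using m sigma by (auto simp: K_def e_def intro!: mult_right_mono)
    ultimately have "- (K * (m + (w (exp t))\<^sup>2)) \<le> energy_bracket \<mu> \<sigma> (exp t)"
      unfolding distrib_left by linarith
    then have "exp t powr \<mu> * (- (K * (m + (w (exp t))\<^sup>2))) \<le> - V"
      using E unfolding energy_def by (meson mult_left_mono order_trans powr_ge_zero)
    then have "V \<le> K * (exp (\<mu> * t) * (m + (w (exp t))\<^sup>2))"
      by (simp add: exp_powr_real mult_ac)
    then have "V / K \<le> exp (\<mu> * t) * (m + (w (exp t))\<^sup>2)"
      using K by (simp add: field_simps)
    then have "V / K * exp (- (\<mu> - 2 * \<delta>) * t) \<le> exp (\<mu> * t) * (m + (w (exp t))\<^sup>2) * exp (- (\<mu> - 2 * \<delta>) * t)"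
      by (intro mult_right_mono) auto
    also have "\<dots> = exp (2 * \<delta> * t) * (m + (w (exp t))\<^sup>2)"
      by (simp add: algebra_simps flip: exp_add)
    also have "\<dots> = y t * Y t + (y t)\<^sup>2"
    proof -
      have "exp (2 * \<delta> * t) / exp t = exp (\<delta> * t) * exp ((\<delta> - 1) * t)"
        by (simp add: algebra_simps flip: exp_add exp_diff)
      then have "exp (2 * \<delta> * t) * m = y t * Y t"
        unfolding m_def y_def Y_def by (metis (no_types, lifting) mult.assoc mult.commute times_divide_eq_right)
      moreover have "exp (2 * \<delta> * t) * (w (exp t))\<^sup>2 = (y t)\<^sup>2"
        by (simp add: y_def power_mult_distrib exp_double[symmetric] mult.assoc)
      ultimately show ?thesis by (simp add: distrib_left)
    qed
    finally show ?thesis .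
  qed
  have "emden_system \<nu> \<delta> (real N - \<delta>) \<alpha> q (\<mu> - 2 * \<delta>) (V / K) y Y h"
    using nu delta N_gt alpha_ge q wp psip h_lim y_deriv Y_deriv h_deriv V K slow
    by unfold_locales (auto simp: \<delta>_def y_def Y_def h_def less_imp_neq[OF wp, symmetric])
  then show thesis unfolding y_def Y_def h_def \<delta>_def by (rule that)
qed

text \<open>\<open>rate\<close> excludes the stable direction in the predator-prey argument. The
  second alternative of \<open>range\<close> takes over when \<open>\<alpha>\<close> is not below
  \<open>\<eta>\<close>; there \<open>\<mu> = N\<close> makes the decay exponent
  \<open>n - \<delta>\<close>, as the Lienard argument assumes.\<close>

lemma asymptotics:
  assumes p2: "p < 2" and N_gt: "delta p < real N" and alpha_ge: "delta p \<le> \<alpha>"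
    and rate: "\<mu> - 2 * delta p < (1 + \<nu>) * (real N - delta p)"
    and range: "\<alpha> < delta p + \<nu> * (real N - delta p) \<or> \<mu> = real N \<and> 2 * delta p \<le> real N"
  shows "delta p < \<alpha> \<Longrightarrow> ((\<lambda>r. r powr delta p * w r) \<longlongrightarrow> ell N p \<alpha>) at_top"
    and "\<alpha> = delta p \<Longrightarrow> ((\<lambda>r. r powr delta p * ln r powr (- 1 / (2 - p)) * w r) \<longlongrightarrow>
           ((2 - p) * delta p powr (p - 1) * (real N - delta p)) powr (1 / (2 - p))) at_top"
proof -
  have inv: "1 / \<nu> = p - 1" by (simp add: \<nu>_def)
  obtain c where "emden_system \<nu> (delta p) (real N - delta p) \<alpha> q (\<mu> - 2 * delta p) c
    (\<lambda>t. exp (delta p * t) * w (exp t)) (\<lambda>t. exp ((delta p - 1) * t) * \<psi> (exp t)) (\<lambda>t. w (exp t) powr (q - 1))"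
    using emden_system_exists[OF p2 N_gt alpha_ge] .
  then interpret S: emden_system \<nu> "delta p" "real N - delta p" \<alpha> q "\<mu> - 2 * delta p" c
    "\<lambda>t. exp (delta p * t) * w (exp t)" "\<lambda>t. exp ((delta p - 1) * t) * \<psi> (exp t)" "\<lambda>t. w (exp t) powr (q - 1)" .
  have y_ln: "exp (delta p * ln r) * w (exp (ln r)) = r powr delta p * w r" if "0 < r" for r
    using that by (simp add: powr_def)
  show "((\<lambda>r. r powr delta p * w r) \<longlongrightarrow> ell N p \<alpha>) at_top" if gt: "delta p < \<alpha>"
  proof -
    have "((\<lambda>t. exp (delta p * t) * w (exp t)) \<longlongrightarrow>
        (delta p powr (1 / \<nu>) * ((real N - delta p) / (\<alpha> - delta p))) powr (1 / (1 - 1 / \<nu>))) at_top"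
    proof (cases "\<alpha> < delta p + \<nu> * (real N - delta p)")
      case True
      then show ?thesis by (rule S.tendsto_of_alpha_less[OF gt _ rate])
    next
      case False
      then have N2: "\<mu> = real N" "2 * delta p \<le> real N" using range by auto
      interpret S: emden_subcritical \<nu> "delta p" "real N - delta p" \<alpha> q "\<mu> - 2 * delta p" c
        "\<lambda>t. exp (delta p * t) * w (exp t)" "\<lambda>t. exp ((delta p - 1) * t) * \<psi> (exp t)" "\<lambda>t. w (exp t) powr (q - 1)"
        using gt N2 by unfold_locales auto
      show ?thesis by (rule S.subcritical_tendsto)
    qed
    moreover have "(real N - delta p) / (\<alpha> - delta p) = (delta p - real N) / (delta p - \<alpha>)"
      by (metis minus_diff_eq minus_divide_divide)
    ultimately have "((\<lambda>t. exp (delta p * t) * w (exp t)) \<longlongrightarrow> ell N p \<alpha>) at_top"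
      by (simp add: inv ell_def)
    from filterlim_compose[OF this ln_at_top] show ?thesis
    proof (rule Lim_transform_eventually)
      show "eventually (\<lambda>r. exp (delta p * ln r) * w (exp (ln r)) = r powr delta p * w r) at_top"
        using eventually_gt_at_top[of 0] by eventually_elim (rule y_ln)
    qed
  qed
  show "((\<lambda>r. r powr delta p * ln r powr (- 1 / (2 - p)) * w r) \<longlongrightarrow>
           ((2 - p) * delta p powr (p - 1) * (real N - delta p)) powr (1 / (2 - p))) at_top" if "\<alpha> = delta p"
  proof -
    have "((\<lambda>t. t powr (- 1 / (2 - p)) * (exp (delta p * t) * w (exp t))) \<longlongrightarrow>
        ((2 - p) * delta p powr (p - 1) * (real N - delta p)) powr (1 / (2 - p))) at_top"
      using S.tendsto_of_alpha_eq[OF that rate] by (simp add: inv)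
    from filterlim_compose[OF this ln_at_top] show ?thesis
    proof (rule Lim_transform_eventually)
      show "eventually (\<lambda>r. ln r powr (- 1 / (2 - p)) * (exp (delta p * ln r) * w (exp (ln r)))
          = r powr delta p * ln r powr (- 1 / (2 - p)) * w r) at_top"
        using eventually_gt_at_top[of 0] by eventually_elim (use y_ln in \<open>simp only: mult_ac\<close>)
    qed
  qed
qed

end

section \<open>Matching the exponents of the theorem with the energy parameters\<close>

lemma ivp_solution_radial:
  assumes "ivp_solution N p q \<alpha> a w" "1 \<le> N" "1 < p" "1 < q" "0 < \<alpha>" "0 < a"
  obtains w' F' where "radial_ivp N p q \<alpha> a w w' F'"
  using assms unfolding ivp_solution_def radial_ivp_def by blast

theorem theorem4p11:
  fixes N :: nat and p q \<alpha> :: real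
  assumes "N \<ge> 1" and "1 < p" and "p < 2" and "q > 1" and "delta p \<le> \<alpha>"
  shows
    "(p \<le> p_two N \<longrightarrow>
       (\<forall>a>0. \<forall>w. ivp_solution N p q \<alpha> a w \<longrightarrow>
          (\<forall>r\<ge>0. w r > 0) \<and>
          (delta p < \<alpha> \<longrightarrow>
             ((\<lambda>r. r powr delta p * w r) \<longlongrightarrow> ell N p \<alpha>) at_top) \<and>
          (\<alpha> = delta p \<longrightarrow>
             ((\<lambda>r. r powr delta p * ln r powr (- 1 / (2 - p)) * w r) \<longlongrightarrow>
                ((2 - p) * delta p powr (p - 1) * (real N - delta p)) powr (1 / (2 - p))) at_top)))
     \<and>
     (p_two N < p \<and> p < p_one N \<and> \<alpha> < (real N - 1) * conj_exp p / 2 \<longrightarrow>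
       q_star N p < ereal (q_star_alpha N p \<alpha>) \<and>
       (q \<ge> q_star_alpha N p \<alpha> \<longrightarrow>
         (\<forall>a>0. \<forall>w. ivp_solution N p q \<alpha> a w \<longrightarrow>
            (\<forall>r\<ge>0. w r > 0) \<and>
            (delta p < \<alpha> \<longrightarrow>
               ((\<lambda>r. r powr delta p * w r) \<longlongrightarrow> ell N p \<alpha>) at_top) \<and>
            (\<alpha> = delta p \<longrightarrow>
               ((\<lambda>r. r powr delta p * ln r powr (- 1 / (2 - p)) * w r) \<longlongrightarrow>
                  ((2 - p) * delta p powr (p - 1) * (real N - delta p)) powr (1 / (2 - p))) at_top))))"
proof -
  define \<delta> where "\<delta> = delta p"
  have \<delta>: "\<delta> * (2 - p) = p" "1 < \<delta>" using assms by (auto simp: \<delta>_def delta_def)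
  have alpha_pos: "0 < \<alpha>" using \<delta> assms(5) by (simp add: \<delta>_def)
  have nu_rel: "1 + 1 / (p - 1) = conj_exp p" using assms by (simp add: conj_exp_def field_simps)
  have conj_pos: "1 < conj_exp p" using assms by (simp add: conj_exp_def)
  have subcrit: "(\<forall>r\<ge>0. w r > 0) \<and>
          (delta p < \<alpha> \<longrightarrow>
             ((\<lambda>r. r powr delta p * w r) \<longlongrightarrow> ell N p \<alpha>) at_top) \<and>
          (\<alpha> = delta p \<longrightarrow>
             ((\<lambda>r. r powr delta p * ln r powr (- 1 / (2 - p)) * w r) \<longlongrightarrow>
                ((2 - p) * delta p powr (p - 1) * (real N - delta p)) powr (1 / (2 - p))) at_top)"
    if le: "p \<le> p_two N" and "0 < a" and sol: "ivp_solution N p q \<alpha> a w" for a w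
  proof -
    obtain w' F' where "radial_ivp N p q \<alpha> a w w' F'"
      using ivp_solution_radial[OF sol assms(1,2,4) alpha_pos \<open>0 < a\<close>] .
    then interpret radial_ivp N p q \<alpha> a w w' F' .
    have pN: "p * (real N + 2) \<le> 2 * real N" using le assms(1) by (simp add: p_two_def field_simps)
    have N2: "2 * \<delta> \<le> real N"
    proof -
      have "2 * p \<le> real N * (2 - p)" using pN by (simp add: algebra_simps)
      then have "2 * (\<delta> * (2 - p)) \<le> real N * (2 - p)" using \<delta>(1) by simp
      then show ?thesis using assms(3) by simp
    qed
    \<comment> \<open>Taking \<open>\<sigma> = \<mu> / 2\<close> satisfies \<open>square\<close> for
      every \<open>\<alpha>\<close>. With \<open>\<mu> = N\<close> the flux condition becomes
      \<open>p \<le> p_two N\<close>, and the strict power condition is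
      \<open>q > 1\<close>.\<close>
    interpret radial_energy N p q \<alpha> a w w' F' "real N" "real N / 2"
    proof unfold_locales
      have "real N / (1 + \<nu>) = real N * (p - 1) / p"
        unfolding \<nu>_def nu_rel by (simp add: conj_exp_def)
      also have "\<dots> \<le> real N / 2 - 1"
        using pN assms(2) by (simp add: field_simps)
      finally show "real N / (1 + \<nu>) - (real N - 1) + real N / 2 \<le> 0" by linarith
      show strict: "real N / (q + 1) < real N / 2 \<or> real N < real N"
        using assms(1,4) by (intro disjI1 divide_strict_left_mono) auto
      then show "real N / (q + 1) \<le> real N / 2" by simp
    qed (use assms(1) in auto)
    have rate: "real N - 2 * delta p < (1 + \<nu>) * (real N - delta p)"
      using N2 \<delta>(2) nu_pos unfolding \<delta>_def[symmetric] by (simp add: algebra_simps add_strict_increasing2)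
    have "delta p < real N" using N2 \<delta>(2) by (simp add: \<delta>_def)
    note asy = asymptotics[OF assms(3) this assms(5) rate]
    show ?thesis using w_pos asy N2 by (auto simp: \<delta>_def)
  qed
  have crit: "q_star N p < ereal (q_star_alpha N p \<alpha>) \<and>
       (q \<ge> q_star_alpha N p \<alpha> \<longrightarrow>
         (\<forall>a>0. \<forall>w. ivp_solution N p q \<alpha> a w \<longrightarrow>
            (\<forall>r\<ge>0. w r > 0) \<and>
            (delta p < \<alpha> \<longrightarrow>
               ((\<lambda>r. r powr delta p * w r) \<longlongrightarrow> ell N p \<alpha>) at_top) \<and>
            (\<alpha> = delta p \<longrightarrow>
               ((\<lambda>r. r powr delta p * ln r powr (- 1 / (2 - p)) * w r) \<longlongrightarrow>
                  ((2 - p) * delta p powr (p - 1) * (real N - delta p)) powr (1 / (2 - p))) at_top)))"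
    if p2: "p_two N < p" and p1: "p < p_one N" and alpha: "\<alpha> < (real N - 1) * conj_exp p / 2"
  proof -
    have pN1: "p * (real N + 1) < 2 * real N" using p1 assms(1) by (simp add: p_one_def field_simps)
    have pN2: "2 * real N < p * (real N + 2)" using p2 assms(1) by (simp add: p_two_def field_simps)
    have N_gt: "\<delta> < real N"
    proof -
      have "\<delta> * (2 - p) < real N * (2 - p)" using pN1 \<delta>(1) by (simp add: algebra_simps)
      then show ?thesis using assms(3) by simp
    qed
    have N_lt: "real N < 2 * \<delta>"
    proof -
      have "real N * (2 - p) < 2 * (\<delta> * (2 - p))" using pN2 \<delta>(1) by (simp add: algebra_simps)
      then show ?thesis using assms(3) by simp
    qed
    have N2: "2 \<le> N" using N_gt \<delta>(2) by linarith
    then have pN: "p < real N" using assms(3) by linarith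
    \<comment> \<open>The other way to satisfy \<open>square\<close> is
      \<open>\<mu> = 2 * \<alpha>\<close>. This \<open>\<sigma>\<close> makes the flux coefficient
      vanish, and the power condition then reads \<open>q + 1 \<ge> 2 * \<alpha> / \<sigma>\<close>,
      which is \<open>q \<ge> q_star_alpha N p \<alpha>\<close>.\<close>
    define \<sigma> where "\<sigma> = real N - 1 - 2 * \<alpha> / conj_exp p"
    have sigma: "0 < \<sigma>" using alpha conj_pos by (simp add: \<sigma>_def field_simps)
    have qsa: "q_star_alpha N p \<alpha> + 1 = 2 * \<alpha> / \<sigma>"
    proof -
      have "(real N - 1) / (2 * \<alpha>) - 1 / conj_exp p = \<sigma> / (2 * \<alpha>)"
        using alpha_pos by (simp add: \<sigma>_def diff_divide_distrib)
      then show ?thesis by (simp add: q_star_alpha_def)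
    qed
    have alpha_N: "real N < 2 * \<alpha>" using N_lt assms(5) by (simp add: \<delta>_def)
    \<comment> \<open>With \<open>N\<close> in place of \<open>2 * \<alpha>\<close> the defining
      equation of \<open>q_star_alpha\<close> would give \<open>q_star\<close>; the inequality
      reflects \<open>N < 2 * \<alpha>\<close>.\<close>
    have "q_star N p < ereal (q_star_alpha N p \<alpha>)"
    proof -
      have "\<sigma> / (2 * \<alpha>) = (real N - 1) / (2 * \<alpha>) - 1 / conj_exp p"
        using alpha_pos by (simp add: \<sigma>_def diff_divide_distrib)
      also have "\<dots> < (real N - 1) / real N - 1 / conj_exp p"
        using alpha_N N2 by (intro diff_strict_right_mono divide_strict_left_mono) auto
      also have "\<dots> = (real N - p) / (real N * p)"
        using N2 assms(2) by (simp add: conj_exp_def field_simps)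
      finally have "\<sigma> / (2 * \<alpha>) < (real N - p) / (real N * p)" .
      then have "real N * p / (real N - p) < 2 * \<alpha> / \<sigma>"
        using sigma alpha_pos pN N2 assms(2) by (simp add: field_simps)
      moreover have "(real N * (p - 1) + p) / (real N - p) = real N * p / (real N - p) - 1"
        using pN by (simp add: field_simps)
      ultimately show ?thesis using qsa pN by (simp add: q_star_def)
    qed
    moreover have "(\<forall>r\<ge>0. w r > 0) \<and>
            (delta p < \<alpha> \<longrightarrow>
               ((\<lambda>r. r powr delta p * w r) \<longlongrightarrow> ell N p \<alpha>) at_top) \<and>
            (\<alpha> = delta p \<longrightarrow>
               ((\<lambda>r. r powr delta p * ln r powr (- 1 / (2 - p)) * w r) \<longlongrightarrow>
                  ((2 - p) * delta p powr (p - 1) * (real N - delta p)) powr (1 / (2 - p))) at_top)"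
      if q_ge: "q_star_alpha N p \<alpha> \<le> q" and "0 < a" and sol: "ivp_solution N p q \<alpha> a w" for a w
    proof -
      obtain w' F' where "radial_ivp N p q \<alpha> a w w' F'"
        using ivp_solution_radial[OF sol assms(1,2,4) alpha_pos \<open>0 < a\<close>] .
      then interpret radial_ivp N p q \<alpha> a w w' F' .
      have nu1: "1 + \<nu> = conj_exp p" unfolding \<nu>_def nu_rel ..
      interpret radial_energy N p q \<alpha> a w w' F' "2 * \<alpha>" \<sigma>
      proof unfold_locales
        show "2 * \<alpha> / (1 + \<nu>) - (real N - 1) + \<sigma> \<le> 0" unfolding nu1 \<sigma>_def by simp
        have "2 * \<alpha> / \<sigma> \<le> q + 1" using q_ge qsa by simp
        then show "2 * \<alpha> / (q + 1) \<le> \<sigma>" using sigma assms(4) by (simp add: field_simps)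
      qed (use alpha_N sigma in auto)
      have nup: "\<nu> * (p - 1) = 1" using assms(2) by (simp add: \<nu>_def)
      have shift: "\<delta> * (\<nu> - 1) = 1 + \<nu>"
      proof -
        have "(\<delta> * (\<nu> - 1)) * (p - 1) = \<delta> * (\<nu> * (p - 1) - (p - 1))" by (simp add: algebra_simps)
        also have "\<dots> = \<delta> * (2 - p)" unfolding nup by simp
        also have "\<dots> = (p - 1) + \<nu> * (p - 1)" unfolding \<delta>(1) nup by simp
        finally have "(\<delta> * (\<nu> - 1)) * (p - 1) = (1 + \<nu>) * (p - 1)" by (simp add: distrib_right)
        then show ?thesis using assms(2) by simp
      qed
      \<comment> \<open>The first identity turns \<open>rate\<close> for
        \<open>\<mu> = 2 * \<alpha>\<close> into the assumed upper bound on \<open>\<alpha>\<close>;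
        the second computes \<open>\<eta>\<close>.\<close>
      have ident: "2 * \<delta> + (1 + \<nu>) * (real N - \<delta>) = (real N - 1) * conj_exp p"
        "\<delta> + \<nu> * (real N - \<delta>) = (real N - p) / (p - 1)"
      proof -
        have "2 * \<delta> + (1 + \<nu>) * (real N - \<delta>) = (1 + \<nu>) * real N - \<delta> * (\<nu> - 1)"
          by (simp add: algebra_simps)
        then show "2 * \<delta> + (1 + \<nu>) * (real N - \<delta>) = (real N - 1) * conj_exp p"
          unfolding shift nu1[symmetric] by (simp add: algebra_simps)
        have "\<delta> + \<nu> * (real N - \<delta>) = \<nu> * real N - \<delta> * (\<nu> - 1)" by (simp add: algebra_simps)
        also have "\<dots> = \<nu> * real N - (\<nu> * (p - 1) + \<nu>)" unfolding shift nup by simp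
        also have "\<dots> = \<nu> * (real N - p)" by (simp add: algebra_simps)
        finally show "\<delta> + \<nu> * (real N - \<delta>) = (real N - p) / (p - 1)" by (simp add: \<nu>_def)
      qed
      have rate: "2 * \<alpha> - 2 * delta p < (1 + \<nu>) * (real N - delta p)"
        using ident(1) alpha by (simp add: \<delta>_def)
      \<comment> \<open>By \<open>p < p_one N\<close> the bound on \<open>\<alpha>\<close> implies
        \<open>\<alpha> < \<eta>\<close>, so the predator-prey argument covers this whole
        range.\<close>
      have "(real N - 1) * conj_exp p / 2 \<le> (real N - p) / (p - 1)"
      proof -
        have "(real N - 1) * conj_exp p / 2 = ((real N - 1) * p / 2) / (p - 1)" by (simp add: conj_exp_def)
        also have "\<dots> \<le> (real N - p) / (p - 1)"
          using pN1 assms(2) by (intro divide_right_mono) (auto simp: field_simps)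
        finally show ?thesis .
      qed
      then have "\<alpha> < delta p + \<nu> * (real N - delta p)"
        using ident(2) alpha unfolding \<delta>_def by linarith
      note asy = asymptotics[OF assms(3) N_gt[unfolded \<delta>_def] assms(5) rate disjI1[OF this]]
      show ?thesis using w_pos asy by auto
    qed
    ultimately show ?thesis by blast
  qed
  show ?thesis using subcrit crit by blast
qed

end
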